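(* Let $p$ be an odd prime, $q$ a power of $p$, $m$ a positive integer and $r$ a prime with $m/2<r\leq m-2$, and suppose $p\nmid r(r+2)(m-r-2)$. Let $g(x)\in\mathbb{F}_q[x]$ be squarefree of degree $m$ with $g(0)\neq 0$, let $\mathcal{C}_f$ be the curve $x^{m-r-2}y^2=g(x)$, and let $L=\overline{\mathbb{F}}_q(x)[y]/(x^{m-r-2}y^2-g(x))$ be its function field. Let $\Lambda$ be the set of lines $\ell_P$ tangent to $\mathcal{C}_f$ at a point $P$ such that $\ell_P$ meets $\mathcal{C}_f$ in fewer than $m-1$ distinct points, and let $\Gamma=\bigcup_{\ell_P\in\Lambda}\{Q : Q\in\ell_P\}$. Let $(a,b)\in\mathrm{AG}(2,q)\setminus(\mathcal{C}_f\cup\Gamma)$, let $F_{a,b}=\overline{\mathbb{F}}_q\big((y-b)/(x-a)\big)\subseteq L$, and let $G_{a,b}$ be the Galois group of the Galois closure $M_{a,b}$ of the extension $L:F_{a,b}$. Then $G_{a,b}\cong\mathcal{S}_m$.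
   Context: Tangent lines and intersections are taken over the algebraic closure $\overline{\mathbb{F}}_q$ in the projective plane, using the projective closure of $\mathcal{C}_f$. $\mathrm{AG}(2,q)$ is the affine plane over $\mathbb{F}_q$; $\mathcal{S}_m$ is the symmetric group on $m$ letters. *)

theory Defs
  imports
    "HOL-Analysis.Cartesian_Space"
    "HOL-Library.Extended_Nat"
    "HOL-Computational_Algebra.Computational_Algebra"
    "HOL-Algebra.Algebra"
    "HOL-Algebra.Algebraic_Closure_Type"
begin

section \<open>Plane projective curves and their tangent lines\<close>

text \<open>
  A bivariate polynomial in \<open>x, y\<close> is an element of \<open>'a poly poly\<close>: the outer variable is \<open>y\<close>,
  the inner one \<open>x\<close>.  So \<open>coeff (coeff f j) i\<close> is the coefficient of \<open>x\<^sup>i y\<^sup>j\<close>.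
\<close>

definition total_degree :: "'a::zero poly poly \<Rightarrow> nat" where
  "total_degree f =
     Max {i + j | i j. Polynomial.coeff (Polynomial.coeff f j) i \<noteq> 0}"

text \<open>
  The value at \<open>(x, y, z)\<close> of the homogenization of \<open>f\<close>; the map \<open>h\<close> transports the
  coefficients to the ring in which the arguments live.
\<close>

definition homog_eval :: "('a::zero \<Rightarrow> 'b::comm_ring_1) \<Rightarrow> 'a poly poly \<Rightarrow> 'b \<Rightarrow> 'b \<Rightarrow> 'b \<Rightarrow> 'b" where
  "homog_eval h f x y z =
     (\<Sum>j\<le>Polynomial.degree f. \<Sum>i\<le>Polynomial.degree (Polynomial.coeff f j).
        h (Polynomial.coeff (Polynomial.coeff f j) i) * x ^ i * y ^ j * z ^ (total_degree f - i - j))"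

text \<open>The point of the projective plane with homogeneous coordinates \<open>v \<noteq> 0\<close>.\<close>

definition proj_point :: "'a::field ^ 3 \<Rightarrow> ('a ^ 3) set" where
  "proj_point v = {c *s v | c. c \<noteq> 0}"

definition affine_point :: "'a::field \<Rightarrow> 'a \<Rightarrow> ('a ^ 3) set" where
  "affine_point a b = proj_point (vector [a, b, 1])"

text \<open>The line joining two distinct points \<open>proj_point u\<close> and \<open>proj_point w\<close>.\<close>

definition proj_line :: "'a::field ^ 3 \<Rightarrow> 'a ^ 3 \<Rightarrow> ('a ^ 3) set set" where
  "proj_line u w = {proj_point (c *s u + d *s w) | c d. c \<noteq> 0 \<or> d \<noteq> 0}"

definition distinct_points :: "'a::field ^ 3 \<Rightarrow> 'a ^ 3 \<Rightarrow> bool" where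
  "distinct_points u w \<longleftrightarrow> u \<noteq> 0 \<and> w \<noteq> 0 \<and> proj_point u \<noteq> proj_point w"

text \<open>The projective closure of the affine curve \<open>f(x,y) = 0\<close>.\<close>

definition proj_curve :: "'a::field poly poly \<Rightarrow> ('a ^ 3) set set" where
  "proj_curve f = {proj_point v | v. v \<noteq> 0 \<and> homog_eval id f (v$1) (v$2) (v$3) = 0}"

text \<open>
  The intersection multiplicity at \<open>P = proj_point u\<close> of the curve with the line joining \<open>P\<close> to
  \<open>proj_point w\<close>: the order of vanishing at \<open>s = 0\<close> of the homogenized equation at \<open>u + s w\<close>.
  It is infinite if the line is a component of the curve.
\<close>

definition line_mult :: "'a::field poly poly \<Rightarrow> 'a ^ 3 \<Rightarrow> 'a ^ 3 \<Rightarrow> enat" where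
  "line_mult f u w =
     (let e = homog_eval (\<lambda>c. [:c:]) f [:u$1, w$1:] [:u$2, w$2:] [:u$3, w$3:]
      in if e = 0 then \<infinity> else enat (Polynomial.order 0 e))"

text \<open>
  The multiplicity of a point on a curve is the minimal intersection multiplicity at that point
  with a line through it; a line is tangent at a point of the curve if its intersection multiplicity
  there exceeds the multiplicity of the point.  At a singular point the tangents are thus the
  lines of the tangent cone (over an infinite ground field).
\<close>

definition point_mult :: "'a::field poly poly \<Rightarrow> 'a ^ 3 \<Rightarrow> enat" where
  "point_mult f u = (INF w\<in>{w. distinct_points u w}. line_mult f u w)"

definition tangent_line_at :: "'a::field poly poly \<Rightarrow> ('a ^ 3) set \<Rightarrow> ('a ^ 3) set set \<Rightarrow> bool" where
  "tangent_line_at f P l \<longleftrightarrow> P \<in> proj_curve f \<and>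
     (\<exists>u w. distinct_points u w \<and> P = proj_point u \<and> l = proj_line u w \<and>
            point_mult f u < line_mult f u w)"

definition special_tangents :: "'a::field poly poly \<Rightarrow> nat \<Rightarrow> ('a ^ 3) set set set" where
  "special_tangents f m =
     {l. (\<exists>P. tangent_line_at f P l) \<and> finite (l \<inter> proj_curve f) \<and> card (l \<inter> proj_curve f) < m - 1}"


section \<open>The function field of a plane curve\<close>

text \<open>The function field \<open>K(x)[y]/(f)\<close>, for \<open>f\<close> irreducible over \<open>K(x)\<close>.\<close>

definition curve_ideal :: "'a::field poly poly \<Rightarrow> 'a poly fract poly set" where
  "curve_ideal f = PIdl\<^bsub>ring_of_type_algebra\<^esub> (map_poly to_fract f)"

definition function_field :: "'a::field poly poly \<Rightarrow> 'a poly fract poly set ring" where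
  "function_field f = ring_of_type_algebra Quot (curve_ideal f)"

definition ff_class :: "'a::field poly poly \<Rightarrow> 'a poly fract poly \<Rightarrow> 'a poly fract poly set" where
  "ff_class f h = curve_ideal f +>\<^bsub>ring_of_type_algebra\<^esub> h"

definition ff_const :: "'a::field poly poly \<Rightarrow> 'a \<Rightarrow> 'a poly fract poly set" where
  "ff_const f c = ff_class f [:to_fract [:c:]:]"

definition ff_x :: "'a::field poly poly \<Rightarrow> 'a poly fract poly set" where
  "ff_x f = ff_class f [:to_fract [:0, 1:]:]"

definition ff_y :: "'a::field poly poly \<Rightarrow> 'a poly fract poly set" where
  "ff_y f = ff_class f [:0, 1:]"

text \<open>The subfield \<open>K((y - b)/(x - a))\<close> of the function field.\<close>

definition projection_subfield :: "'a::field poly poly \<Rightarrow> 'a \<Rightarrow> 'a \<Rightarrow> 'a poly fract poly set set" where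
  "projection_subfield f a b =
     (let L = function_field f
      in generate_field L
           (insert ((ff_y f \<ominus>\<^bsub>L\<^esub> ff_const f b) \<otimes>\<^bsub>L\<^esub> inv\<^bsub>L\<^esub> (ff_x f \<ominus>\<^bsub>L\<^esub> ff_const f a))
             (range (ff_const f))))"


section \<open>Galois closures\<close>

text \<open>
  \<open>M\<close> is Galois over \<open>F\<close> if it is normal and separable: the minimal polynomial of every element
  of \<open>M\<close> exists and splits over \<open>M\<close> into pairwise distinct linear factors.
\<close>

definition galois_extension :: "('a, 'b) ring_scheme \<Rightarrow> 'a set \<Rightarrow> bool" where
  "galois_extension M F \<longleftrightarrow> field M \<and> subfield F M \<and>
     (\<forall>x\<in>carrier M. \<not> ring.transcendental M F x \<and>
        ring.splitted M (ring.Irr M F x) \<and>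
        (\<forall>z. ring.alg_mult M (ring.Irr M F x) z \<le> 1))"

text \<open>
  \<open>M\<close>, together with the embedding \<open>\<sigma>\<close> of \<open>L\<close>, is a Galois closure of the extension \<open>L\<close> of \<open>F\<close>.
\<close>

definition galois_closure ::
  "('a, 'b) ring_scheme \<Rightarrow> 'a set \<Rightarrow> ('c, 'd) ring_scheme \<Rightarrow> ('a \<Rightarrow> 'c) \<Rightarrow> bool" where
  "galois_closure L F M \<sigma> \<longleftrightarrow>
     \<sigma> \<in> ring_hom L M \<and> galois_extension M (\<sigma> ` F) \<and>
     (\<forall>E. subfield E M \<and> \<sigma> ` carrier L \<subseteq> E \<and> galois_extension (M\<lparr>carrier := E\<rparr>) (\<sigma> ` F)
          \<longrightarrow> E = carrier M)"

definition galois_group :: "('a, 'b) ring_scheme \<Rightarrow> 'a set \<Rightarrow> ('a \<Rightarrow> 'a) monoid" where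
  "galois_group M F =
     (BijGroup (carrier M))\<lparr>carrier := {h \<in> Bij (carrier M) \<inter> ring_hom M M. \<forall>x\<in>F. h x = x}\<rparr>"

end

theory Submission
  imports Defs "HOL-Combinatorics.Permutations" "HOL-Number_Theory.Residues"
begin

text \<open>
  Put \<open>n = m - r - 2\<close>, \<open>d = r + 2\<close>, so that \<open>m = n + d\<close>, and let \<open>t = (y - b) / (x - a)\<close>.  Over \<open>K(t)\<close> the
  function \<open>x\<close> is a root of \<open>x\<^sup>n (b + t (x - a))\<^sup>2 - g(x)\<close>, of degree \<open>m\<close>, and the Galois group \<open>G\<close> acts
  faithfully and transitively on its \<open>m\<close> roots.

  Some line \<open>t = t0\<close> through \<open>(a, b)\<close> is tangent to the curve.  Since \<open>(a, b)\<close> is on no special tangent,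
  the polynomial at \<open>t0\<close> has one double root and \<open>m - 2\<close> simple ones, so that with \<open>t = t0 + u\<^sup>2\<close> all
  roots are power series in \<open>u\<close>.  They generate the Galois closure, and \<open>u \<mapsto> -u\<close> induces
  a transposition in \<open>G\<close>.

  Being equal or swapped by a transposition in \<open>G\<close> is a \<open>G\<close>-invariant equivalence relation on the
  roots; its classes have the same size \<open>c > 1\<close>.  The coefficients of the polynomial whose roots are the
  class of \<open>x\<close> lie in \<open>K(x, y)\<close> and have at most \<open>m / c < r\<close> conjugates over \<open>K(t)\<close>.  At a point at
  infinity of the curve, \<open>t\<close> has a pole of order \<open>r\<close> and \<open>x\<close> a pole of order 2.  A nonzero root of a polynomial
  of degree less than the prime \<open>r\<close> over a field with valuations in \<open>r\<int>\<close> has its valuation in \<open>r\<int>\<close>.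
  So the coefficients have valuations divisible by \<open>r\<close>, and since \<open>x\<close> has not, \<open>c \<ge> r > m / 2\<close>.  Hence there is
  only one class, and \<open>G\<close> contains all transpositions.
\<close>

section \<open>Extension of embeddings into an algebraically closed field\<close>

text \<open>The closure M is an arbitrary ring with an abstract carrier, whereas power series and
  orders live in field types. Therefore M is embedded by \<open>\<psi>\<close> into the algebraic
  closure of the Laurent series field K((u)), and automorphisms of M arise by comparing two
  embeddings that agree on the base field. A point of the curve whose x-coordinate is a nonconstant
  Laurent series embeds the whole function field in K((u)). Two such points are used: one near the
  tangency, where u -> -u acts, and one at infinity, where orders are read off. That \<alpha> is
  nonzero comes from the geometry: the line x = 0 meets the closure of the curve in a single point
  and is a special tangent. As for the characteristic: 2 must be invertible to separate the two
  branches at the tangency; p not dividing n keeps the point of tangency off x = 0; p not dividing r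
  fixes the degree of the polynomial W that yields the tangency, and makes Hensel's lemma applicable
  at infinity. Finally r is odd, since r = 2 contradicts r + 3 \<le> m < 2r; so r does not divide
  the pole order 2 of x.\<close>

definition subfld :: "'a::field set \<Rightarrow> bool" where
  "subfld S \<longleftrightarrow> 1 \<in> S \<and> (\<forall>x\<in>S. \<forall>y\<in>S. x + y \<in> S \<and> x * y \<in> S) \<and> (\<forall>x\<in>S. - x \<in> S \<and> inverse x \<in> S)"

lemma subfldD:
  assumes "subfld S"
  shows "1 \<in> S" "0 \<in> S" "x \<in> S \<Longrightarrow> y \<in> S \<Longrightarrow> x + y \<in> S" "x \<in> S \<Longrightarrow> y \<in> S \<Longrightarrow> x * y \<in> S"
    "x \<in> S \<Longrightarrow> - x \<in> S" "x \<in> S \<Longrightarrow> inverse x \<in> S" "x \<in> S \<Longrightarrow> y \<in> S \<Longrightarrow> x - y \<in> S"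
    "x \<in> S \<Longrightarrow> y \<in> S \<Longrightarrow> x / y \<in> S"
proof -
  have "1 + - 1 \<in> S"
    using assms unfolding subfld_def by blast
  then show "0 \<in> S" by simp
  show "x \<in> S \<Longrightarrow> y \<in> S \<Longrightarrow> x - y \<in> S"
    using assms unfolding subfld_def diff_conv_add_uminus by blast
  show "x \<in> S \<Longrightarrow> y \<in> S \<Longrightarrow> x / y \<in> S"
    using assms unfolding subfld_def divide_inverse by blast
qed (use assms in \<open>auto simp: subfld_def\<close>)

lemma subfld_sum:
  assumes "subfld S" "\<And>i. i \<in> I \<Longrightarrow> f i \<in> S"
  shows "sum f I \<in> S"
  using assms(2) by (induction I rule: infinite_finite_induct) (auto intro: subfldD[OF assms(1)])

lemma subfld_prod:
  assumes "subfld S" "\<And>i. i \<in> I \<Longrightarrow> f i \<in> S"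
  shows "prod f I \<in> S"
  using assms(2) by (induction I rule: infinite_finite_induct) (auto intro: subfldD[OF assms(1)])

section \<open>Polynomials with coefficients in a subfield\<close>

definition poly_over :: "'a::zero set \<Rightarrow> 'a poly \<Rightarrow> bool" where
  "poly_over S p \<longleftrightarrow> (\<forall>i. Polynomial.coeff p i \<in> S)"

lemma poly_over_pCons_iff [simp]: "poly_over S (pCons c p) \<longleftrightarrow> c \<in> S \<and> poly_over S p"
  unfolding poly_over_def by (auto simp: coeff_pCons split: nat.splits)

lemma poly_over_0_iff [simp]: "poly_over S 0 \<longleftrightarrow> 0 \<in> S"
  by (simp add: poly_over_def)

context
  fixes S :: "'a::field set"
  assumes S: "subfld S"
begin

lemma poly_over_1: "poly_over S 1"
  using subfldD[OF S] by (simp add: poly_over_def)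

lemma poly_over_add: "poly_over S p \<Longrightarrow> poly_over S q \<Longrightarrow> poly_over S (p + q)"
  using subfldD[OF S] by (simp add: poly_over_def)

lemma poly_over_diff: "poly_over S p \<Longrightarrow> poly_over S q \<Longrightarrow> poly_over S (p - q)"
  using subfldD[OF S] by (simp add: poly_over_def)

lemma poly_over_uminus: "poly_over S p \<Longrightarrow> poly_over S (- p)"
  using subfldD[OF S] by (simp add: poly_over_def)

lemma poly_over_smult: "c \<in> S \<Longrightarrow> poly_over S p \<Longrightarrow> poly_over S (Polynomial.smult c p)"
  using subfldD[OF S] by (simp add: poly_over_def)

lemma poly_over_monom: "c \<in> S \<Longrightarrow> poly_over S (Polynomial.monom c n)"
  using subfldD[OF S] by (simp add: poly_over_def)

lemma poly_over_mult: "poly_over S p \<Longrightarrow> poly_over S q \<Longrightarrow> poly_over S (p * q)"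
  unfolding poly_over_def coeff_mult by (auto intro!: subfld_sum[OF S] subfldD[OF S])

lemma poly_over_power: "poly_over S p \<Longrightarrow> poly_over S (p ^ n)"
  by (induction n) (auto intro: poly_over_mult poly_over_1)

lemma poly_over_sum: "(\<And>i. i \<in> I \<Longrightarrow> poly_over S (f i)) \<Longrightarrow> poly_over S (sum f I)"
  unfolding poly_over_def by (auto simp: coeff_sum intro: subfld_sum[OF S])

lemma poly_over_prod: "(\<And>i. i \<in> I \<Longrightarrow> poly_over S (f i)) \<Longrightarrow> poly_over S (prod f I)"
  by (induction I rule: infinite_finite_induct) (auto intro: poly_over_mult poly_over_1)

lemma poly_over_pcompose: "poly_over S p \<Longrightarrow> poly_over S q \<Longrightarrow> poly_over S (pcompose p q)"
  by (induction p) (auto simp: pcompose_pCons intro!: poly_over_add poly_over_mult subfldD[OF S])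

lemma poly_over_poly: "poly_over S p \<Longrightarrow> x \<in> S \<Longrightarrow> poly p x \<in> S"
  by (induction p) (auto intro!: subfldD[OF S])

text \<open>Long division is carried out by hand because the coefficients of quotient and remainder
  must be seen to stay in S; each round cancels the leading term and lowers the degree.\<close>

lemma poly_over_division:
  assumes "poly_over S p" "poly_over S q" "q \<noteq> 0"
  obtains d r where "poly_over S d" "poly_over S r" "p = d * q + r"
    "r = 0 \<or> Polynomial.degree r < Polynomial.degree q"
  using assms(1)
proof (induction "Polynomial.degree p" arbitrary: p thesis rule: less_induct)
  case (less p)
  show thesis
  proof (cases "p = 0 \<or> Polynomial.degree p < Polynomial.degree q")
    case True
    then show thesis
      using less.prems(1)[of 0 p] less.prems(2) subfldD(2)[OF S] by auto
  next
    case False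
    define c where "c = lead_coeff p / lead_coeff q"
    define k where "k = Polynomial.degree p - Polynomial.degree q"
    define p' where "p' = p - Polynomial.monom c k * q"
    have c: "c \<in> S"
      using less.prems(2) assms(2) unfolding c_def by (auto intro!: subfldD[OF S] simp: poly_over_def)
    have p': "poly_over S p'"
      unfolding p'_def using less.prems(2) assms(2) c
      by (intro poly_over_diff poly_over_mult poly_over_monom)
    have "c \<noteq> 0" using False assms(3) by (auto simp: c_def)
    then have deg: "Polynomial.degree (Polynomial.monom c k * q) = Polynomial.degree p"
      using False degree_mult_eq[of "Polynomial.monom c k" q] degree_monom_eq[OF \<open>c \<noteq> 0\<close>, of k]
        assms(3) \<open>c \<noteq> 0\<close> by (auto simp: k_def)
    have "lead_coeff (Polynomial.monom c k * q) = lead_coeff p"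
      using assms(3) degree_monom_eq[OF \<open>c \<noteq> 0\<close>, of k]
      by (simp add: lead_coeff_mult) (simp add: c_def)
    then have lc: "Polynomial.coeff p' (Polynomial.degree p) = 0"
      by (simp add: p'_def deg)
    show thesis
    proof (cases "p' = 0")
      case True
      then show thesis
        using less.prems(1)[of "Polynomial.monom c k" 0] c subfldD(2)[OF S]
        by (auto simp: p'_def intro: poly_over_monom)
    next
      case False
      have "Polynomial.degree p' \<le> Polynomial.degree p"
        unfolding p'_def using deg by (intro degree_diff_le) auto
      moreover have "Polynomial.degree p' \<noteq> Polynomial.degree p"
        using lc False by (metis leading_coeff_0_iff)
      ultimately have "Polynomial.degree p' < Polynomial.degree p" by simp
      then obtain d r where "poly_over S d" "poly_over S r" "p' = d * q + r"
        "r = 0 \<or> Polynomial.degree r < Polynomial.degree q"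
        using less.hyps p' by metis
      then show thesis
        using less.prems(1)[of "d + Polynomial.monom c k" r] c
        by (auto simp: p'_def algebra_simps intro!: poly_over_add poly_over_monom)
    qed
  qed
qed

end

definition (in ring) eval_via :: "('c::zero \<Rightarrow> 'a) \<Rightarrow> 'c poly \<Rightarrow> 'a \<Rightarrow> 'a" where
  "eval_via g p w = fold_coeffs (\<lambda>c x. g c \<oplus> w \<otimes> x) p \<zero>"

text \<open>An embedding of a part of \<open>R\<close> into a field type is represented by its inverse \<open>g\<close>, so that
  polynomials over the part can be treated as polynomials over the field type.\<close>

locale inv_embedding = field R for R (structure) +
  fixes S :: "'c::field set" and g :: "'c \<Rightarrow> 'a"
  assumes S: "subfld S"
    and g_closed [simp]: "x \<in> S \<Longrightarrow> g x \<in> carrier R"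
    and g_one [simp]: "g 1 = \<one>"
    and g_add: "x \<in> S \<Longrightarrow> y \<in> S \<Longrightarrow> g (x + y) = g x \<oplus> g y"
    and g_mult: "x \<in> S \<Longrightarrow> y \<in> S \<Longrightarrow> g (x * y) = g x \<otimes> g y"
begin

lemmas S_closed [simp, intro] = subfldD[OF S]

lemma g_zero [simp]: "g 0 = \<zero>"
proof -
  have "g 0 = g 0 \<oplus> g 0"
    using g_add[of 0 0] by simp
  then show ?thesis
    by (metis S_closed(2) add.l_cancel_one g_closed)
qed

lemma g_uminus: "x \<in> S \<Longrightarrow> g (- x) = \<ominus> g x"
  using g_add[of x "- x"] by (simp add: add.inv_unique' sum_zero_eq_neg add.inv_equality a_comm)

lemma g_nonzero: "x \<in> S \<Longrightarrow> g x = \<zero> \<Longrightarrow> x = 0"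
  using g_mult[of x "inverse x"] by (cases "x = 0") auto

lemma eval_via_0 [simp]: "eval_via g 0 w = \<zero>"
  by (simp add: eval_via_def)

lemma eval_via_pCons [simp]: "w \<in> carrier R \<Longrightarrow> eval_via g (pCons c p) w = g c \<oplus> w \<otimes> eval_via g p w"
  by (cases "c = 0 \<and> p = 0") (auto simp: eval_via_def)

lemma eval_via_closed [simp]: "w \<in> carrier R \<Longrightarrow> poly_over S p \<Longrightarrow> eval_via g p w \<in> carrier R"
  by (induction p) auto

lemma eval_via_add:
  assumes w: "w \<in> carrier R"
  shows "poly_over S p \<Longrightarrow> poly_over S q \<Longrightarrow> eval_via g (p + q) w = eval_via g p w \<oplus> eval_via g q w"
proof (induction p q rule: poly_induct2)
  case (pCons a p b q)
  then show ?case
    using w by (simp add: g_add r_distr a_ac)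
qed simp

lemma eval_via_smult:
  assumes w: "w \<in> carrier R" and c: "c \<in> S"
  shows "poly_over S p \<Longrightarrow> eval_via g (Polynomial.smult c p) w = g c \<otimes> eval_via g p w"
proof (induction p)
  case (pCons a p)
  then show ?case
    using w c by (simp add: g_mult r_distr m_ac)
qed (use c in simp)

lemma eval_via_mult:
  assumes w: "w \<in> carrier R"
  shows "poly_over S p \<Longrightarrow> poly_over S q \<Longrightarrow> eval_via g (p * q) w = eval_via g p w \<otimes> eval_via g q w"
proof (induction p)
  case (pCons a p)
  then have "eval_via g (pCons a p * q) w = g a \<otimes> eval_via g q w \<oplus> w \<otimes> (eval_via g p w \<otimes> eval_via g q w)"
    using w by (simp add: eval_via_add eval_via_smult poly_over_smult[OF S] poly_over_mult[OF S])
  then show ?case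
    using w pCons by (simp add: l_distr m_assoc)
qed (use w in simp)

lemma eval_via_pcompose:
  assumes w: "w \<in> carrier R" and q: "poly_over S q"
  shows "poly_over S p \<Longrightarrow> eval_via g (pcompose p q) w = eval_via g p (eval_via g q w)"
proof (induction p)
  case (pCons a p)
  then show ?case
    using w q
    by (simp add: pcompose_pCons eval_via_add eval_via_mult poly_over_mult[OF S] poly_over_pcompose[OF S])
qed simp

lemma eval_via_monom:
  assumes w: "w \<in> carrier R" and c: "c \<in> S"
  shows "eval_via g (Polynomial.monom c n) w = g c \<otimes> w [^] n"
proof (induction n)
  case (Suc n)
  then show ?case
    using w c by (simp add: monom_Suc m_ac)
qed (use w c in \<open>simp add: monom_0\<close>)

definition alg_over :: "'a \<Rightarrow> bool" where
  "alg_over w \<longleftrightarrow> (\<exists>p. poly_over S p \<and> p \<noteq> 0 \<and> eval_via g p w = \<zero>)"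

text \<open>The inverse of an algebraic element is a polynomial in it: factors X are cancelled from
  an annihilating polynomial until the constant term c is nonzero, and then z p(z) = -c exhibits the
  inverse of z.\<close>

lemma ex_inverse_via:
  assumes z: "z \<in> carrier R" "z \<noteq> \<zero>" and "alg_over z"
  obtains q where "poly_over S q" "z \<otimes> eval_via g q z = \<one>"
proof -
  obtain p where "poly_over S p" "p \<noteq> 0" "eval_via g p z = \<zero>"
    using assms(3) by (auto simp: alg_over_def)
  then have "\<exists>q. poly_over S q \<and> z \<otimes> eval_via g q z = \<one>"
  proof (induction p)
    case (pCons c p)
    show ?case
    proof (cases "c = 0")
      case True
      then have "z \<otimes> eval_via g p z = \<zero>" "p \<noteq> 0"
        using pCons z by auto
      then have "eval_via g p z = \<zero>"
        using pCons.prems(1) z integral[of z "eval_via g p z"] by auto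
      then show ?thesis
        using pCons \<open>p \<noteq> 0\<close> by simp
    next
      case False
      define q where "q = Polynomial.smult (- inverse c) p"
      have "c \<in> S" using pCons by simp
      then have "poly_over S q" unfolding q_def
        using pCons.prems(1) by (intro poly_over_smult[OF S]) auto
      have "eval_via g q z = g (- inverse c) \<otimes> eval_via g p z"
        unfolding q_def using \<open>c \<in> S\<close> z pCons.prems(1) by (intro eval_via_smult) auto
      moreover have "z \<otimes> eval_via g p z = \<ominus> g c"
        using pCons z \<open>c \<in> S\<close>
        by (metis a_comm eval_via_closed eval_via_pCons g_closed m_closed minus_equality poly_over_pCons_iff)
      ultimately have "z \<otimes> eval_via g q z = g (- inverse c) \<otimes> (\<ominus> g c)"
        using z \<open>c \<in> S\<close> pCons by (metis S_closed(5,6) eval_via_closed g_closed m_lcomm poly_over_pCons_iff)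
      also have "\<dots> = g (- inverse c * (- c))"
        using \<open>c \<in> S\<close> by (simp only: g_mult S_closed(5,6) g_uminus)
      also have "\<dots> = \<one>" using False by simp
      finally show ?thesis using \<open>poly_over S q\<close> by blast
    qed
  qed simp
  then show thesis using that by blast
qed

text \<open>The simple extension S[w'] is mapped to R by p(w') -> p(w). The hypothesis says only
  that relations of w hold for w'. The converse, which makes the map well defined, comes from
  inverses: if p(w) is nonzero, then p q - 1 kills w for some q, hence kills w', so p(w') is nonzero
  too. The same q gives inverses in S[w'].\<close>

lemma one_step:
  assumes w: "w \<in> carrier R" and alg: "\<And>z. z \<in> carrier R \<Longrightarrow> alg_over z"
    and w': "\<And>p. poly_over S p \<Longrightarrow> eval_via g p w = \<zero> \<Longrightarrow> poly p w' = 0"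
  obtains S' g' where "inv_embedding R S' g'" "S \<subseteq> S'" "\<And>x. x \<in> S \<Longrightarrow> g' x = g x" "w' \<in> S'" "g' w' = w"
proof -
  define S' where "S' = {poly p w' | p. poly_over S p}"
  have inv: "\<exists>q. poly_over S q \<and> eval_via g p w \<otimes> eval_via g q w = \<one> \<and> poly p w' * poly q w' = 1"
    if p: "poly_over S p" "eval_via g p w \<noteq> \<zero>" for p
  proof -
    define z where "z = eval_via g p w"
    have z: "z \<in> carrier R" "z \<noteq> \<zero>" using p w by (auto simp: z_def)
    obtain q where q: "poly_over S q" "z \<otimes> eval_via g q z = \<one>"
      using ex_inverse_via[OF z alg[OF z(1)]] by blast
    define q' where "q' = pcompose q p"
    have q': "poly_over S q'"
      using q p by (simp add: q'_def poly_over_pcompose[OF S])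
    have 1: "eval_via g p w \<otimes> eval_via g q' w = \<one>"
      using q p w unfolding q'_def by (simp add: eval_via_pcompose z_def)
    have "eval_via g (p * q' + [:- 1:]) w = \<zero>"
      using 1 w p q' S
      by (simp add: eval_via_add eval_via_mult poly_over_mult[OF S] g_uminus r_neg)
    then have "poly (p * q' + [:- 1:]) w' = 0"
      by (intro w' poly_over_add[OF S] poly_over_mult[OF S] p q') auto
    then show ?thesis using 1 q' by auto
  qed
  have wd: "eval_via g p w = \<zero>" if "poly_over S p" "poly p w' = 0" for p
    using inv[OF that(1)] that(2) by auto
  have wd2: "eval_via g p w = eval_via g q w" if "poly_over S p" "poly_over S q" "poly p w' = poly q w'" for p q
  proof -
    have "eval_via g (p + Polynomial.smult (- 1) q) w = \<zero>"
      using that by (intro wd poly_over_add[OF S] poly_over_smult[OF S]) auto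
    then have "eval_via g p w \<oplus> (\<ominus> \<one>) \<otimes> eval_via g q w = \<zero>"
      using that w eval_via_add[OF w that(1) poly_over_smult[OF S _ that(2)], of "- 1"]
        eval_via_smult[OF w _ that(2), of "- 1"] by (simp add: g_uminus)
    then have "eval_via g p w \<oplus> \<ominus> eval_via g q w = \<zero>"
      using that w by (simp add: l_minus)
    then show ?thesis
      using that w by (metis a_inv_closed eval_via_closed minus_equality minus_minus)
  qed
  define g' where "g' x = eval_via g (SOME p. poly_over S p \<and> poly p w' = x) w" for x
  have g': "g' (poly p w') = eval_via g p w" if "poly_over S p" for p
  proof -
    have "poly_over S (SOME q. poly_over S q \<and> poly q w' = poly p w') \<and>
        poly (SOME q. poly_over S q \<and> poly q w' = poly p w') w' = poly p w'"
      by (rule someI[of _ p]) (use that in simp)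
    then show ?thesis
      unfolding g'_def using that by (intro wd2) auto
  qed
  have const: "x \<in> S' \<and> g' x = g x" if "x \<in> S" for x
  proof -
    have "poly_over S [:x:]" using that by simp
    then have "poly [:x:] w' \<in> S'" "g' (poly [:x:] w') = g x"
      using g'[of "[:x:]"] that w \<open>poly_over S [:x:]\<close> unfolding S'_def by (blast, simp)
    then show ?thesis by simp
  qed
  have var: "w' \<in> S'" "g' w' = w"
  proof -
    have "poly_over S [:0, 1:]" by simp
    then have "poly [:0, 1:] w' \<in> S'" "g' (poly [:0, 1:] w') = w"
      using g'[of "[:0, 1:]"] w \<open>poly_over S [:0, 1:]\<close> unfolding S'_def by (blast, simp)
    then show "w' \<in> S'" "g' w' = w" by simp_all
  qed
  have "inv_embedding R S' g'"
  proof
    show "subfld S'"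
      unfolding subfld_def
    proof (intro conjI ballI)
      show "1 \<in> S'" using const by auto
      fix x assume "x \<in> S'"
      then obtain p where p: "poly_over S p" "x = poly p w'" by (auto simp: S'_def)
      have "- x = poly (- p) w'" using p by simp
      then show "- x \<in> S'" using p poly_over_uminus[OF S] unfolding S'_def by blast
      show "inverse x \<in> S'"
      proof (cases "x = 0")
        case True
        then show ?thesis using const by auto
      next
        case False
        then have "eval_via g p w \<noteq> \<zero>"
          using p w' by auto
        from inv[OF p(1) this] obtain q where "poly_over S q" "x * poly q w' = 1" using p by auto
        then have "inverse x = poly q w'" by (simp add: inverse_unique)
        then show ?thesis using \<open>poly_over S q\<close> unfolding S'_def by blast
      qed
      fix y assume "y \<in> S'"
      then obtain q where q: "poly_over S q" "y = poly q w'" by (auto simp: S'_def)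
      have "x + y = poly (p + q) w'" "x * y = poly (p * q) w'" using p q by auto
      then show "x + y \<in> S'" "x * y \<in> S'"
        using p q poly_over_add[OF S] poly_over_mult[OF S] unfolding S'_def by blast+
    qed
    show "g' x \<in> carrier R" if "x \<in> S'" for x
      using that g' w unfolding S'_def by auto
    show "g' 1 = \<one>" using const[of 1] by simp
    fix x y assume "x \<in> S'" "y \<in> S'"
    then obtain p q where p: "poly_over S p" "x = poly p w'" and q: "poly_over S q" "y = poly q w'"
      by (auto simp: S'_def)
    show "g' (x + y) = g' x \<oplus> g' y"
      using g'[of "p + q"] g'[of p] g'[of q] p q w poly_over_add[OF S] by (simp add: eval_via_add)
    show "g' (x * y) = g' x \<otimes> g' y"
      using g'[of "p * q"] g'[of p] g'[of q] p q w poly_over_mult[OF S] by (simp add: eval_via_mult)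
  qed
  then show thesis
    using that[of S' g'] const var by auto
qed

end

text \<open>The form in which the union of a chain of embeddings is recognized as an embedding: the
  relation is single-valued because it is closed under differences and relates 0 only to
  zero.\<close>

lemma (in field) inv_embedding_of_graph:
  fixes \<Gamma> :: "('c::field \<times> 'a) set"
  assumes G: "\<Gamma> \<subseteq> UNIV \<times> carrier R" "(1, \<one>) \<in> \<Gamma>"
    "\<And>x a y b. (x, a) \<in> \<Gamma> \<Longrightarrow> (y, b) \<in> \<Gamma> \<Longrightarrow> (x + y, a \<oplus> b) \<in> \<Gamma> \<and> (x * y, a \<otimes> b) \<in> \<Gamma>"
    "\<And>x a. (x, a) \<in> \<Gamma> \<Longrightarrow> (- x, \<ominus> a) \<in> \<Gamma> \<and> inverse x \<in> Domain \<Gamma>"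
    "\<And>a. (0, a) \<in> \<Gamma> \<Longrightarrow> a = \<zero>"
  obtains S g where "inv_embedding R S g" "\<Gamma> = (\<lambda>x. (x, g x)) ` S"
proof -
  have uniq: "a = b" if "(x, a) \<in> \<Gamma>" "(x, b) \<in> \<Gamma>" for x a b
  proof -
    have "(x + - x, a \<oplus> \<ominus> b) \<in> \<Gamma>"
      using G(3,4) that by blast
    then have "a \<oplus> \<ominus> b = \<zero>" using G(5) by simp
    then show ?thesis
      using that G(1) by (metis SigmaD2 a_inv_closed minus_equality minus_minus subsetD)
  qed
  define S where "S = Domain \<Gamma>"
  define g where "g x = (THE a. (x, a) \<in> \<Gamma>)" for x
  have g: "(x, g x) \<in> \<Gamma>" if "x \<in> S" for x
    unfolding g_def by (rule theI') (use that uniq in \<open>auto simp: S_def\<close>)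
  have g_eq: "x \<in> S \<and> g x = a" if "(x, a) \<in> \<Gamma>" for x a
    using g uniq that unfolding S_def by blast
  show thesis
  proof (rule that)
    show "\<Gamma> = (\<lambda>x. (x, g x)) ` S"
      using g g_eq by auto
    show "inv_embedding R S g"
    proof
      show "subfld S"
        unfolding subfld_def
        using G(2) G(3)[OF g g] G(4)[OF g] g_eq unfolding S_def by blast
      show "g x \<in> carrier R" if "x \<in> S" for x
        using g[OF that] G(1) by blast
      show "g 1 = \<one>" using g_eq[OF G(2)] by simp
      fix x y assume "x \<in> S" "y \<in> S"
      then show "g (x + y) = g x \<oplus> g y" "g (x * y) = g x \<otimes> g y"
        using G(3)[OF g g] g_eq by blast+
    qed
  qed
qed

text \<open>Zorn's lemma is applied to the graphs of the partial embeddings.\<close>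

lemma (in field) extend_inv_embedding:
  fixes S0 :: "'c::alg_closed_field set"
  assumes emb: "inv_embedding R S0 g0" and alg: "\<And>z. z \<in> carrier R \<Longrightarrow> inv_embedding.alg_over R S0 g0 z"
  obtains S g where "inv_embedding R S g" "S0 \<subseteq> S" "\<And>x. x \<in> S0 \<Longrightarrow> g x = g0 x" "g ` S = carrier R"
proof -
  interpret E0: inv_embedding R S0 g0 by (rule emb)
  define gr where "gr S g = (\<lambda>x. (x, g x)) ` S" for S :: "'c set" and g :: "'c \<Rightarrow> 'a"
  define \<A> where "\<A> = {gr S g | S g. inv_embedding R S g \<and> gr S0 g0 \<subseteq> gr S g}"
  have sub: "S0 \<subseteq> S" "x \<in> S0 \<Longrightarrow> g x = g0 x" if "gr S0 g0 \<subseteq> gr S g" for S g x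
    using that unfolding gr_def by auto
  have props: "\<Gamma> \<subseteq> UNIV \<times> carrier R \<and> (1, \<one>) \<in> \<Gamma> \<and>
    (\<forall>x a y b. (x, a) \<in> \<Gamma> \<longrightarrow> (y, b) \<in> \<Gamma> \<longrightarrow> (x + y, a \<oplus> b) \<in> \<Gamma> \<and> (x * y, a \<otimes> b) \<in> \<Gamma>) \<and>
    (\<forall>x a. (x, a) \<in> \<Gamma> \<longrightarrow> (- x, \<ominus> a) \<in> \<Gamma> \<and> inverse x \<in> Domain \<Gamma>) \<and>
    (\<forall>a. (0, a) \<in> \<Gamma> \<longrightarrow> a = \<zero>)" if GA: "\<Gamma> \<in> \<A>" for \<Gamma>
  proof -
    obtain S g where Sg: "inv_embedding R S g" "\<Gamma> = gr S g"
      using GA unfolding \<A>_def by blast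
    interpret inv_embedding R S g by (rule Sg(1))
    show ?thesis
      unfolding Sg(2) gr_def
      by (auto simp: image_iff g_add g_mult g_uminus Domain_iff intro!: bexI[of _ 1])
  qed
  have ne: "gr S0 g0 \<in> \<A>" using emb by (auto simp: \<A>_def)
  have bound: "\<exists>U\<in>\<A>. \<forall>Z\<in>C. Z \<subseteq> U" if C: "C \<in> chains \<A>" for C
  proof (cases "C = {}")
    case True
    then show ?thesis using ne by auto
  next
    case False
    have CA: "C \<subseteq> \<A>" and ch: "\<And>Z Y. Z \<in> C \<Longrightarrow> Y \<in> C \<Longrightarrow> Z \<subseteq> Y \<or> Y \<subseteq> Z"
      using C by (auto simp: chains_def chain_subset_def)
    have two: "\<exists>Z\<in>C. u \<in> Z \<and> v \<in> Z" if "u \<in> \<Union>C" "v \<in> \<Union>C" for u v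
      using that ch by blast
    note propsC = props[OF subsetD[OF CA]]
    have "\<exists>S g. inv_embedding R S g \<and> \<Union>C = gr S g"
    proof (rule inv_embedding_of_graph[of "\<Union>C"])
      show "\<Union>C \<subseteq> UNIV \<times> carrier R" "(1, \<one>) \<in> \<Union>C"
        using propsC False by blast+
      show "(x + y, a \<oplus> b) \<in> \<Union>C \<and> (x * y, a \<otimes> b) \<in> \<Union>C" if xy: "(x, a) \<in> \<Union>C" "(y, b) \<in> \<Union>C" for x a y b
      proof -
        obtain Y where Y: "Y \<in> C" "(x, a) \<in> Y" "(y, b) \<in> Y" using two[OF xy] by blast
        then have "(x + y, a \<oplus> b) \<in> Y \<and> (x * y, a \<otimes> b) \<in> Y" using propsC[OF Y(1)] by blast
        then show ?thesis using Y(1) by blast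
      qed
      show "(- x, \<ominus> a) \<in> \<Union>C \<and> inverse x \<in> Domain (\<Union>C)" if xa: "(x, a) \<in> \<Union>C" for x a
      proof -
        obtain Y where Y: "Y \<in> C" "(x, a) \<in> Y" using xa by blast
        then have "(- x, \<ominus> a) \<in> Y \<and> inverse x \<in> Domain Y" using propsC[OF Y(1)] by blast
        then show ?thesis using Y(1) by blast
      qed
      show "a = \<zero>" if "(0, a) \<in> \<Union>C" for a
        using that propsC by blast
    qed (auto simp: gr_def)
    then have "\<Union>C \<in> \<A>"
      using False CA unfolding \<A>_def by fastforce
    then show ?thesis by blast
  qed
  from Zorn_Lemma2[OF ballI, OF bound] obtain \<Gamma> where
    \<Gamma>: "\<Gamma> \<in> \<A>" and max: "\<And>Z. Z \<in> \<A> \<Longrightarrow> \<Gamma> \<subseteq> Z \<Longrightarrow> Z = \<Gamma>" by blast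
  then obtain S g where Sg: "inv_embedding R S g" "gr S0 g0 \<subseteq> gr S g" "\<Gamma> = gr S g"
    by (auto simp: \<A>_def)
  interpret E: inv_embedding R S g by (rule Sg(1))
  note S0S = sub[OF Sg(2)]
  have eval_eq: "eval_via g p z = eval_via g0 p z" if "poly_over S0 p" "z \<in> carrier R" for p z
    using that S0S by (induction p) auto
  have algE: "E.alg_over z" if z: "z \<in> carrier R" for z
  proof -
    obtain p where "poly_over S0 p" "p \<noteq> 0" "eval_via g0 p z = \<zero>"
      using alg[OF z] by (auto simp: E0.alg_over_def)
    then show ?thesis
      using eval_eq z S0S unfolding E.alg_over_def poly_over_def by (metis subsetD)
  qed
  have "w \<in> g ` S" if w: "w \<in> carrier R" for w
  proof -
    \<comment> \<open>If w were missed by a maximal embedding, a root w' of a polynomial of least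
      degree killing w would extend it: by least degree every relation of w is a multiple of
      \<open>p0\<close>, hence a relation of w'.\<close>
    define P where "P p \<longleftrightarrow> poly_over S p \<and> p \<noteq> 0 \<and> eval_via g p w = \<zero>" for p
    have "\<exists>p. P p" using algE[OF w] by (auto simp: P_def E.alg_over_def)
    then obtain p0 where p0: "P p0" and min: "\<And>q. P q \<Longrightarrow> Polynomial.degree p0 \<le> Polynomial.degree q"
      using ex_has_least_nat[of P _ Polynomial.degree] by metis
    have "Polynomial.degree p0 \<noteq> 0"
    proof
      assume "Polynomial.degree p0 = 0"
      then obtain c where "p0 = [:c:]" by (auto elim: degree_eq_zeroE)
      then show False
        using p0 w by (auto simp: P_def dest: E.g_nonzero)
    qed
    then obtain w' where w': "poly p0 w' = 0"
      using alg_closed_imp_poly_has_root[of p0] by auto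
    have "poly p w' = 0" if p: "poly_over S p" "eval_via g p w = \<zero>" for p
    proof -
      obtain d r where dr: "poly_over S d" "poly_over S r" "p = d * p0 + r"
        "r = 0 \<or> Polynomial.degree r < Polynomial.degree p0"
        using poly_over_division[OF E.S p(1), of p0] p0 by (auto simp: P_def)
      have "eval_via g p w = eval_via g d w \<otimes> \<zero> \<oplus> eval_via g r w"
        using dr p0 w by (simp add: P_def E.eval_via_add E.eval_via_mult poly_over_mult[OF E.S])
      then have "eval_via g r w = \<zero>"
        using p dr w by simp
      then have "r = 0"
        using min[of r] dr unfolding P_def by fastforce
      then show ?thesis using dr w' by simp
    qed
    from E.one_step[OF w algE this] obtain S' g' where
      S': "inv_embedding R S' g'" "S \<subseteq> S'" "\<And>x. x \<in> S \<Longrightarrow> g' x = g x" "w' \<in> S'" "g' w' = w"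
      by metis
    have "gr S g \<subseteq> gr S' g'"
      using S'(2,3) by (auto simp: gr_def image_iff)
    then have "gr S' g' = \<Gamma>"
      using S'(1) Sg by (intro max) (auto simp: \<A>_def)
    moreover have "(w', w) \<in> gr S' g'" using S' by (auto simp: gr_def)
    ultimately show ?thesis using Sg(3) by (auto simp: gr_def)
  qed
  then have "g ` S = carrier R" by auto
  with Sg(1) S0S that show thesis by blast
qed

section \<open>From coefficient lists, leading coefficient first, to polynomials over a type\<close>

definition list_poly :: "('a \<Rightarrow> 'c::zero) \<Rightarrow> 'a list \<Rightarrow> 'c poly" where
  "list_poly h p = Poly (rev (map h p))"

lemma list_poly_Nil [simp]: "list_poly h [] = 0"
  by (simp add: list_poly_def)

lemma list_poly_Cons: "list_poly h (a # p) = list_poly h p + Polynomial.monom (h a :: 'c::comm_ring_1) (length p)"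
  by (simp add: list_poly_def Poly_append Poly_snoc monom_altdef)

lemma coeff_list_poly:
  "Polynomial.coeff (list_poly h p) i = (if i < length p then h (p ! (length p - 1 - i)) else 0)"
  by (auto simp: list_poly_def nth_default_def rev_nth)

lemma poly_over_list_poly: "0 \<in> S \<Longrightarrow> h ` set p \<subseteq> S \<Longrightarrow> poly_over S (list_poly h p)"
  by (auto simp: poly_over_def coeff_list_poly)

lemma degree_list_poly:
  assumes "p \<noteq> []" "h (hd p) \<noteq> 0"
  shows "Polynomial.degree (list_poly h p) = length p - 1" "list_poly h p \<noteq> 0"
proof -
  have 1: "Polynomial.coeff (list_poly h p) (length p - 1) \<noteq> 0"
    using assms by (auto simp: coeff_list_poly hd_conv_nth)
  then show "list_poly h p \<noteq> 0" by auto
  show "Polynomial.degree (list_poly h p) = length p - 1"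
    using le_degree[OF 1] degree_le[of "length p - 1" "list_poly h p"]
    by (force simp: coeff_list_poly)
qed

lemma (in inv_embedding) eval_via_list_poly:
  assumes w: "w \<in> carrier R" and h: "\<And>a. a \<in> set p \<Longrightarrow> h a \<in> S \<and> g (h a) = a"
  shows "eval_via g (list_poly h p) w = eval p w"
  using h
proof (induction p)
  case (Cons a p)
  then have "poly_over S (list_poly h p)"
    by (intro poly_over_list_poly) auto
  moreover have "a \<in> carrier R"
    using Cons.prems[of a] g_closed[of "h a"] by simp
  ultimately show ?case
    using Cons w a_comm[of "eval_via g (list_poly h p) w" "a \<otimes> w [^] length p"]
    by (auto simp: list_poly_Cons eval_via_add eval_via_monom poly_over_monom[OF S] a_comm simp flip: Cons.IH)
qed simp

text \<open>Homomorphisms from a part of R into a field type; the values outside A are arbitrary. On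
  a subfield the laws for zero, negatives and inverses follow.\<close>

definition (in ring) type_hom :: "'a set \<Rightarrow> ('a \<Rightarrow> 'c::field) \<Rightarrow> bool" where
  "type_hom A h \<longleftrightarrow> h \<one> = 1 \<and> (\<forall>x\<in>A. \<forall>y\<in>A. h (x \<oplus> y) = h x + h y \<and> h (x \<otimes> y) = h x * h y)"

lemma (in ring) type_homD:
  assumes "type_hom A h"
  shows "h \<one> = 1" "x \<in> A \<Longrightarrow> y \<in> A \<Longrightarrow> h (x \<oplus> y) = h x + h y"
    "x \<in> A \<Longrightarrow> y \<in> A \<Longrightarrow> h (x \<otimes> y) = h x * h y"
  using assms by (auto simp: type_hom_def)

lemma list_poly_cong: "(\<And>a. a \<in> set p \<Longrightarrow> h a = h' a) \<Longrightarrow> list_poly h p = list_poly h' p"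
  unfolding list_poly_def by (metis map_cong)

lemma (in field) type_hom_subfield:
  assumes K: "subfield K R" and h: "type_hom K h"
  shows "h \<zero> = 0" "x \<in> K \<Longrightarrow> h (\<ominus> x) = - h x" "x \<in> K \<Longrightarrow> h x = 0 \<Longrightarrow> x = \<zero>" "inj_on h K"
    "x \<in> K \<Longrightarrow> x \<noteq> \<zero> \<Longrightarrow> h (inv x) = inverse (h x)" "subfld (h ` K)"
proof -
  note sub = subringE[OF subfieldE(1)[OF K]]
  note hD = type_homD[OF h]
  have KR: "x \<in> K \<Longrightarrow> x \<in> carrier R" for x using sub(1) by auto
  show h0: "h \<zero> = 0"
  proof -
    have "h \<zero> + h \<zero> = h \<zero>"
      using hD(2)[of \<zero> \<zero>] sub(2) by simp
    then show ?thesis by (metis add_cancel_left_left)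
  qed
  show um: "h (\<ominus> x) = - h x" if "x \<in> K" for x
    using hD(2)[of x "\<ominus> x"] sub(5)[OF that] that h0 r_neg[OF KR[OF that]]
    by (simp add: eq_neg_iff_add_eq_0 add.commute)
  have inv: "inv x \<in> K \<and> x \<otimes> inv x = \<one>" if "x \<in> K" "x \<noteq> \<zero>" for x
    using subfield_m_inv[OF K, of x] that by auto
  have inv2: "h x * h (inv x) = 1" if "x \<in> K" "x \<noteq> \<zero>" for x
    using hD(1) hD(3)[of x "inv x"] inv[OF that] that(1) by simp
  show nz: "x = \<zero>" if "x \<in> K" "h x = 0" for x
    using inv2[of x] that by auto
  show invh: "h (inv x) = inverse (h x)" if "x \<in> K" "x \<noteq> \<zero>" for x
    using inverse_unique[OF inv2[OF that]] by simp
  have inv3: "\<exists>y\<in>K. h y = inverse (h x)" if "x \<in> K" for x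
    using inv[OF that] invh[OF that] h0 sub(2) that by (cases "x = \<zero>") auto
  show "inj_on h K"
  proof (rule inj_onI)
    fix x y assume xy: "x \<in> K" "y \<in> K" "h x = h y"
    then have "h (x \<oplus> \<ominus> y) = 0"
      using hD(2)[of x "\<ominus> y"] um sub(5) by simp
    then have "x \<oplus> \<ominus> y = \<zero>"
      using nz xy sub(5,7) by blast
    then show "x = y" using xy KR by (metis a_inv_closed minus_equality minus_minus)
  qed
  show "subfld (h ` K)"
    unfolding subfld_def
  proof (intro conjI ballI)
    show "1 \<in> h ` K" using hD(1) sub(3) by (metis imageI)
    fix u assume "u \<in> h ` K"
    then obtain x where x: "x \<in> K" "u = h x" by blast
    show "- u \<in> h ` K" "inverse u \<in> h ` K"
      using um inv3 x sub(5) by (metis imageI)+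
    fix v assume "v \<in> h ` K"
    then obtain y where y: "y \<in> K" "v = h y" by blast
    show "u + v \<in> h ` K" "u * v \<in> h ` K"
      using x y hD(2,3) sub(6,7) by (metis imageI)+
  qed
qed

lemma (in field) poly_list_poly_type_hom:
  assumes h: "type_hom (carrier R) h" and w: "w \<in> carrier R" and p: "set p \<subseteq> carrier R"
  shows "poly (list_poly h p) (h w) = h (eval p w)"
  using p
proof (induction p)
  case Nil
  then show ?case using type_hom_subfield(1)[OF carrier_is_subfield h] by simp
next
  case (Cons a p)
  have pow: "h (w [^] n) = h w ^ n" for n :: nat
    by (induction n) (use w type_homD[OF h] in \<open>auto simp: mult.commute\<close>)
  show ?case
    using Cons w type_homD[OF h] eval_in_carrier[of p w]
    by (simp add: list_poly_Cons poly_monom pow)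
qed

text \<open>Extension with a prescribed value at w: \<open>one_step\<close> is applied to the
  inverse of h0, the result is extended until its image is all of R, and that extension is inverted
  again. The condition on w' is that it satisfies all relations of w over K.\<close>

lemma (in field) extend_embedding_at:
  fixes h0 :: "'a \<Rightarrow> 'c::alg_closed_field"
  assumes K: "subfield K R" and h0: "type_hom K h0"
    and alg: "\<And>z. z \<in> carrier R \<Longrightarrow> algebraic K z"
    and w: "w \<in> carrier R"
    and w': "\<And>p. p \<in> carrier (K[X]) \<Longrightarrow> eval p w = \<zero> \<Longrightarrow> poly (list_poly h0 p) w' = 0"
  obtains h where "type_hom (carrier R) h" "\<And>x. x \<in> K \<Longrightarrow> h x = h0 x" "h w = w'"
proof -
  define g where "g = inv_into K h0"
  note sub = subringE[OF subfieldE(1)[OF K]]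
  note h0D = type_hom_subfield[OF K h0]
  have g_h0: "g (h0 x) = x" if "x \<in> K" for x
    unfolding g_def using h0D(4) that by (rule inv_into_f_f)
  have g_in: "g x \<in> K" "h0 (g x) = x" if "x \<in> h0 ` K" for x
    using that g_h0 by auto
  have emb: "inv_embedding R (h0 ` K) g"
  proof
    show "subfld (h0 ` K)" by (rule h0D(6))
    show "g x \<in> carrier R" if "x \<in> h0 ` K" for x
      using g_in(1)[OF that] sub(1) by auto
    show "g 1 = \<one>" using g_h0[OF sub(3)] type_homD(1)[OF h0] by simp
    fix x y assume "x \<in> h0 ` K" "y \<in> h0 ` K"
    then obtain u v where "u \<in> K" "x = h0 u" "v \<in> K" "y = h0 v" by blast
    then show "g (x + y) = g x \<oplus> g y" "g (x * y) = g x \<otimes> g y"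
      using g_h0 type_homD[OF h0] sub(6,7) by metis+
  qed
  interpret E: inv_embedding R "h0 ` K" g by (rule emb)
  have alg': "E.alg_over z" if z: "z \<in> carrier R" for z
  proof -
    obtain p where p: "p \<in> carrier (K[X])" "p \<noteq> []" "eval p z = \<zero>"
      using algebraicE[OF subfieldE(1)[OF K] z] alg[OF z] by (auto simp: over_def)
    then have pK: "set p \<subseteq> K" "hd p \<noteq> \<zero>"
      unfolding univ_poly_def polynomial_def by auto
    have "hd p \<in> K" using pK p(2) by auto
    then have "h0 (hd p) \<noteq> 0" using pK h0D(3) by auto
    moreover have "eval_via g (list_poly h0 p) z = eval p z"
      using z pK(1) g_h0 by (intro E.eval_via_list_poly) auto
    moreover have "poly_over (h0 ` K) (list_poly h0 p)"
      using pK(1) by (intro poly_over_list_poly) auto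
    ultimately show ?thesis
      unfolding E.alg_over_def using degree_list_poly(2)[of p h0] p by metis
  qed
  have "poly p w' = 0" if p: "poly_over (h0 ` K) p" "eval_via g p w = \<zero>" for p
  proof (cases "p = 0")
    case False
    define q where "q = rev (map g (coeffs p))"
    have cf: "set (coeffs p) \<subseteq> h0 ` K"
      using p(1) by (auto simp: poly_over_def coeffs_def)
    have "map (h0 \<circ> g) (coeffs p) = coeffs p"
      using cf g_in(2) by (intro map_idI) auto
    then have lp: "list_poly h0 q = p"
      by (simp add: list_poly_def q_def rev_map)
    have qK: "set q \<subseteq> K" using cf g_in(1) by (auto simp: q_def)
    have "hd q = g (lead_coeff p)"
      using False by (simp add: q_def hd_rev last_map last_coeffs_eq_coeff_degree)
    moreover have "g (lead_coeff p) \<noteq> \<zero>"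
      using p(1) False E.g_nonzero[of "lead_coeff p"] by (auto simp: poly_over_def)
    ultimately have "q \<in> carrier (K[X])"
      using qK unfolding univ_poly_def polynomial_def by simp
    moreover have "eval q w = \<zero>"
    proof -
      have "eval_via g (list_poly h0 q) w = eval q w"
        using qK g_h0 by (intro E.eval_via_list_poly[OF w]) auto
      then show ?thesis using lp p(2) by simp
    qed
    ultimately show ?thesis using w' lp by metis
  qed simp
  from E.one_step[OF w alg' this] obtain S1 g1 where
    S1: "inv_embedding R S1 g1" "h0 ` K \<subseteq> S1" "\<And>x. x \<in> h0 ` K \<Longrightarrow> g1 x = g x" "w' \<in> S1" "g1 w' = w"
    by metis
  have "inv_embedding.alg_over R S1 g1 z" if z: "z \<in> carrier R" for z
  proof -
    interpret E1: inv_embedding R S1 g1 by (rule S1(1))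
    have ev: "eval_via g1 p z = eval_via g p z" if "poly_over (h0 ` K) p" for p
      using that S1(3) z by (induction p) auto
    obtain p where p: "poly_over (h0 ` K) p" "p \<noteq> 0" "eval_via g p z = \<zero>"
      using alg'[OF z] unfolding E.alg_over_def by metis
    then have "poly_over S1 p" using S1(2) unfolding poly_over_def by (metis subsetD)
    then show ?thesis
      unfolding E1.alg_over_def using ev[OF p(1)] p(2,3) by (intro exI[of _ p]) simp
  qed
  from extend_inv_embedding[OF S1(1) this] obtain S g2 where
    S: "inv_embedding R S g2" "S1 \<subseteq> S" "\<And>x. x \<in> S1 \<Longrightarrow> g2 x = g1 x" "g2 ` S = carrier R"
    by metis
  interpret E2: inv_embedding R S g2 by (rule S(1))
  have inj: "inj_on g2 S"
  proof (rule inj_onI)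
    fix x y assume xy: "x \<in> S" "y \<in> S" "g2 x = g2 y"
    then have "g2 (x + - y) = \<zero>"
      by (simp only: E2.g_add E2.g_uminus E2.S_closed) (simp add: r_neg)
    then show "x = y" using E2.g_nonzero[of "x + - y"] xy by auto
  qed
  define h where "h = inv_into S g2"
  have h: "h (g2 x) = x" if "x \<in> S" for x
    unfolding h_def using inj that by (rule inv_into_f_f)
  show thesis
  proof (rule that)
    show "type_hom (carrier R) h"
      unfolding type_hom_def
    proof (intro conjI ballI)
      show "h \<one> = 1" using h[of 1] by simp
      fix x y assume "x \<in> carrier R" "y \<in> carrier R"
      then obtain u v where uv: "u \<in> S" "x = g2 u" "v \<in> S" "y = g2 v" using S(4) by blast
      then show "h (x \<oplus> y) = h x + h y" "h (x \<otimes> y) = h x * h y"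
        using h[of u] h[of v] h[of "u + v"] h[of "u * v"] by (simp_all add: E2.g_add E2.g_mult)
    qed
    show "h x = h0 x" if "x \<in> K" for x
    proof -
      have "h0 x \<in> h0 ` K" using that by simp
      then have "h0 x \<in> S1" "g1 (h0 x) = x" using S1(2,3) g_h0[OF that] by auto
      then have "h0 x \<in> S" "g2 (h0 x) = x" using S(2,3) by auto
      then show ?thesis using h[of "h0 x"] by simp
    qed
    have "w' \<in> S" "g2 w' = w" using S(2) S(3)[OF S1(4)] S1(4,5) by auto
    then show "h w = w'" using h[of w'] by simp
  qed
qed

text \<open>The case w = 0, w' = 0 of the previous lemma; its condition says that a polynomial
  vanishing at 0 has constant term 0, and this term is the last entry of the list.\<close>

lemma (in field) extend_embedding:
  fixes h0 :: "'a \<Rightarrow> 'c::alg_closed_field"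
  assumes K: "subfield K R" and h0: "type_hom K h0"
    and alg: "\<And>z. z \<in> carrier R \<Longrightarrow> algebraic K z"
  obtains h where "type_hom (carrier R) h" "\<And>x. x \<in> K \<Longrightarrow> h x = h0 x"
proof -
  have "poly (list_poly h0 p) 0 = 0" if p: "p \<in> carrier (K[X])" "eval p \<zero> = \<zero>" for p
  proof (cases "p = []")
    case False
    have pF: "set p \<subseteq> K" using p unfolding univ_poly_def polynomial_def by auto
    then have "set p \<subseteq> carrier R" using subringE(1)[OF subfieldE(1)[OF K]] by auto
    then have "last p = eval p \<zero>"
      using False by (metis const_term_def const_term_eq_last append_butlast_last_id le_sup_iff
        last_in_set set_append subsetD)
    then have "h0 (last p) = 0" using p(2) type_hom_subfield(1)[OF K h0] by simp
    then show ?thesis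
      using False by (simp add: poly_0_coeff_0 coeff_list_poly last_conv_nth)
  qed simp
  from extend_embedding_at[OF K h0 alg zero_closed this] that show thesis by metis
qed

section \<open>Galois groups\<close>

definition (in ring) conjugates :: "'a set \<Rightarrow> 'a \<Rightarrow> 'a set" where
  "conjugates F z = {w \<in> carrier R. eval (Irr F z) w = \<zero>}"

locale galois_ext = field R for R (structure) +
  fixes F :: "'a set"
  assumes gal: "galois_extension R F"
begin

lemma F_subfield: "subfield F R"
  using gal by (simp add: galois_extension_def)

lemma algebraic_F: "z \<in> carrier R \<Longrightarrow> algebraic F z"
  using gal by (simp add: galois_extension_def)

lemma Irr_props:
  assumes "z \<in> carrier R"
  shows "Irr F z \<in> carrier (F[X])" "pirreducible F (Irr F z)" "hd (Irr F z) = \<one>" "eval (Irr F z) z = \<zero>"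
proof -
  have "(algebraic over F) z" using algebraic_F[OF assms] by (simp add: over_def)
  note * = IrrE[OF F_subfield assms this]
  show "Irr F z \<in> carrier (F[X])" "pirreducible F (Irr F z)" "hd (Irr F z) = \<one>" "eval (Irr F z) z = \<zero>"
    using * by simp_all
qed

lemma F_carrier: "F \<subseteq> carrier R"
  using subringE(1)[OF subfieldE(1)[OF F_subfield]] .

lemma Irr_carrier: "z \<in> carrier R \<Longrightarrow> Irr F z \<in> carrier (poly_ring R)" "z \<in> carrier R \<Longrightarrow> Irr F z \<noteq> []"
  "z \<in> carrier R \<Longrightarrow> set (Irr F z) \<subseteq> F"
proof -
  assume z: "z \<in> carrier R"
  show 1: "set (Irr F z) \<subseteq> F"
    using Irr_props(1)[OF z] unfolding univ_poly_def polynomial_def by auto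
  show 2: "Irr F z \<noteq> []"
    using Irr_props(2)[OF z] unfolding ring_irreducible_def univ_poly_zero by auto
  show "Irr F z \<in> carrier (poly_ring R)"
    using 1 2 Irr_props(3)[OF z] F_carrier unfolding univ_poly_def polynomial_def by auto
qed

lemma conjugates_self: "z \<in> carrier R \<Longrightarrow> z \<in> conjugates F z"
  using Irr_props(4) by (simp add: conjugates_def)

text \<open>Normality supplies as many roots as the degree, counted with multiplicity, and
  separability makes them distinct.\<close>

lemma card_conjugates:
  assumes z: "z \<in> carrier R"
  shows "finite (conjugates F z)" "card (conjugates F z) = Polynomials.degree (Irr F z)"
proof -
  let ?p = "Irr F z"
  have set: "set_mset (roots ?p) = conjugates F z"
    using roots_mem_iff_is_root[OF Irr_carrier(1)[OF z]] Irr_carrier(2)[OF z]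
    by (auto simp: is_root_def conjugates_def)
  show "finite (conjugates F z)"
    unfolding set[symmetric] by simp
  have cnt: "count (roots ?p) x = 1" if "x \<in> set_mset (roots ?p)" for x
    using gal z alg_mult_eq_count_roots[OF Irr_carrier(1)[OF z]] that
    unfolding galois_extension_def by (metis One_nat_def count_greater_zero_iff le_antisym less_eq_Suc_le)
  have "size (roots ?p) = card (set_mset (roots ?p))"
    unfolding size_multiset_overloaded_eq using cnt by simp
  moreover have "size (roots ?p) = Polynomials.degree ?p"
    using gal z by (simp add: galois_extension_def splitted_def)
  ultimately show "card (conjugates F z) = Polynomials.degree ?p"
    using set by simp
qed

text \<open>The transported minimal polynomial of z is the same for h and h', and the images under h
  of the conjugates of z already exhaust its roots by degree.\<close>

lemma type_hom_conjugates:
  assumes h: "type_hom (carrier R) h" and h': "type_hom (carrier R) h'"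
    and eq: "\<And>x. x \<in> F \<Longrightarrow> h x = h' x" and z: "z \<in> carrier R"
  shows "h' z \<in> h ` conjugates F z"
proof -
  define P where "P = list_poly h (Irr F z)"
  have "hd (Irr F z) = \<one>" using Irr_props(3)[OF z] .
  then have P: "Polynomial.degree P = Polynomials.degree (Irr F z)" "P \<noteq> 0"
    unfolding P_def using degree_list_poly[of "Irr F z" h] Irr_carrier(2)[OF z] type_homD(1)[OF h] by auto
  have P': "P = list_poly h' (Irr F z)"
    unfolding P_def using Irr_carrier(3)[OF z] eq by (intro list_poly_cong) auto
  have irrR: "set (Irr F z) \<subseteq> carrier R" using Irr_carrier(3)[OF z] F_carrier by auto
  have "h ` conjugates F z \<subseteq> {x. poly P x = 0}"
    using poly_list_poly_type_hom[OF h _ irrR] type_hom_subfield(1)[OF carrier_is_subfield h]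
    by (auto simp: conjugates_def P_def)
  moreover have "card (h ` conjugates F z) = Polynomial.degree P"
    using card_conjugates[OF z] P type_hom_subfield(4)[OF carrier_is_subfield h]
    by (metis (no_types, lifting) card_image conjugates_def inj_on_subset mem_Collect_eq subsetI)
  ultimately have "{x. poly P x = 0} = h ` conjugates F z"
    using poly_roots_finite[OF P(2)] card_poly_roots_bound[OF P(2)] by (metis card_seteq)
  moreover have "poly P (h' z) = 0"
    unfolding P' using poly_list_poly_type_hom[OF h' z irrR] Irr_props(4)[OF z]
      type_hom_subfield(1)[OF carrier_is_subfield h'] by simp
  ultimately show ?thesis by blast
qed

text \<open>The automorphism is h' followed by the inverse of h, which makes sense because h' z is
  the h-image of a conjugate of z. It is onto because an injective map of the finite set of
  conjugates to itself is onto.\<close>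

lemma galois_group_memI:
  assumes h: "type_hom (carrier R) h" and h': "type_hom (carrier R) h'"
    and eq: "\<And>x. x \<in> F \<Longrightarrow> h x = h' x"
  obtains \<phi> where "\<phi> \<in> carrier (galois_group R F)" "\<And>x. x \<in> carrier R \<Longrightarrow> h (\<phi> x) = h' x"
proof -
  \<comment> \<open>Members of \<open>Bij\<close> are extensional, hence the restriction.\<close>
  define \<phi> where "\<phi> = restrict (\<lambda>x. inv_into (carrier R) h (h' x)) (carrier R)"
  note injh = type_hom_subfield(4)[OF carrier_is_subfield h]
  note injh' = type_hom_subfield(4)[OF carrier_is_subfield h']
  have \<phi>: "\<phi> x \<in> conjugates F x" "h (\<phi> x) = h' x" if x: "x \<in> carrier R" for x
  proof -
    obtain y where y: "y \<in> conjugates F x" "h' x = h y"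
      using type_hom_conjugates[OF h h' eq x] by auto
    then have "\<phi> x = y"
      using x injh by (simp add: \<phi>_def conjugates_def inv_into_f_f)
    then show "\<phi> x \<in> conjugates F x" "h (\<phi> x) = h' x" using y by auto
  qed
  have \<phi>_closed: "\<phi> x \<in> carrier R" if "x \<in> carrier R" for x
    using \<phi>(1)[OF that] by (simp add: conjugates_def)
  have hom: "\<phi> \<in> ring_hom R R"
  proof (rule ring_hom_memI)
    fix x y assume xy: "x \<in> carrier R" "y \<in> carrier R"
    have "h (\<phi> (x \<otimes> y)) = h (\<phi> x \<otimes> \<phi> y)" "h (\<phi> (x \<oplus> y)) = h (\<phi> x \<oplus> \<phi> y)"
      using xy \<phi>(2) \<phi>_closed type_homD[OF h] type_homD[OF h'] by auto
    then show "\<phi> (x \<otimes> y) = \<phi> x \<otimes> \<phi> y" "\<phi> (x \<oplus> y) = \<phi> x \<oplus> \<phi> y"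
      using inj_onD[OF injh] xy \<phi>_closed by auto
  next
    show "\<phi> \<one> = \<one>"
      using inj_onD[OF injh, of "\<phi> \<one>" \<one>] \<phi>(2) \<phi>_closed type_homD(1)[OF h] type_homD(1)[OF h'] by auto
  qed (use \<phi>_closed in auto)
  have inj: "inj_on \<phi> (carrier R)"
    using \<phi>(2) injh' unfolding inj_on_def by metis
  have surj: "z \<in> \<phi> ` carrier R" if z: "z \<in> carrier R" for z
  proof -
    have sub: "conjugates F z \<subseteq> carrier R" by (auto simp: conjugates_def)
    have "\<phi> w \<in> conjugates F z" if w: "w \<in> conjugates F z" for w
    proof -
      have wR: "w \<in> carrier R" using w sub by auto
      have irrR: "set (Irr F z) \<subseteq> carrier R" using Irr_carrier(3)[OF z] F_carrier by auto
      have "h (eval (Irr F z) (\<phi> w)) = poly (list_poly h (Irr F z)) (h' w)"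
        using poly_list_poly_type_hom[OF h \<phi>_closed[OF wR] irrR] \<phi>(2)[OF wR] by simp
      also have "list_poly h (Irr F z) = list_poly h' (Irr F z)"
        using Irr_carrier(3)[OF z] eq by (intro list_poly_cong) auto
      also have "poly \<dots> (h' w) = h' (eval (Irr F z) w)"
        by (rule poly_list_poly_type_hom[OF h' wR irrR])
      also have "\<dots> = 0"
        using w type_hom_subfield(1)[OF carrier_is_subfield h'] by (simp add: conjugates_def)
      finally have "eval (Irr F z) (\<phi> w) = \<zero>"
        using type_hom_subfield(3)[OF carrier_is_subfield h] eval_in_carrier[OF irrR] \<phi>_closed[OF wR] by blast
      then show ?thesis using \<phi>_closed[OF wR] by (simp add: conjugates_def)
    qed
    then have "\<phi> ` conjugates F z = conjugates F z"
      using inj sub card_conjugates(1)[OF z]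
      by (intro endo_inj_surj) (auto intro: inj_on_subset)
    then show ?thesis using conjugates_self[OF z] sub by blast
  qed
  have "\<phi> x = x" if "x \<in> F" for x
    using that \<phi>(2)[of x] eq[OF that] F_carrier \<phi>_closed[of x] inj_onD[OF injh, of "\<phi> x" x] by auto
  then have "\<phi> \<in> carrier (galois_group R F)"
    using hom inj surj \<phi>_closed unfolding galois_group_def Bij_def bij_betw_def
    by (auto simp: \<phi>_def)
  then show thesis using that \<phi>(2) by blast
qed

lemma galois_groupD:
  assumes "\<phi> \<in> carrier (galois_group R F)"
  shows "\<phi> \<in> ring_hom R R" "bij_betw \<phi> (carrier R) (carrier R)" "\<phi> \<in> extensional (carrier R)"
    "x \<in> F \<Longrightarrow> \<phi> x = x"
  using assms by (auto simp: galois_group_def Bij_def)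

context
  fixes h0 :: "'a \<Rightarrow> 'c::alg_closed_field"
  assumes h0: "type_hom F h0"
begin

text \<open>Two embeddings of R into one algebraically closed field, of which the second sends z to
  where the first sends z', differ by an automorphism. The map h0 serves to provide such a
  field.\<close>

lemma conjugate_by_galois_group:
  assumes z: "z \<in> carrier R" and z': "z' \<in> conjugates F z"
  obtains \<phi> where "\<phi> \<in> carrier (galois_group R F)" "\<phi> z = z'"
proof -
  obtain h where h: "type_hom (carrier R) h" "\<And>x. x \<in> F \<Longrightarrow> h x = h0 x"
    using extend_embedding[OF F_subfield h0 algebraic_F] by blast
  have z'R: "z' \<in> carrier R" using z' by (simp add: conjugates_def)
  have hF: "type_hom F h" using h(1) F_carrier unfolding type_hom_def by auto
  have "poly (list_poly h p) (h z') = 0" if p: "p \<in> carrier (F[X])" "eval p z = \<zero>" for p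
  proof -
    have "Irr F z pdivides p"
      using Irr_minimal[OF F_subfield z _ p] algebraic_F[OF z] by (simp add: over_def)
    then have "eval p z' = \<zero>"
      using pdivides_imp_root_sharing[OF Irr_carrier(1)[OF z] _ z'R] z' by (simp add: conjugates_def)
    moreover have "set p \<subseteq> carrier R"
      using p F_carrier unfolding univ_poly_def polynomial_def by auto
    ultimately show ?thesis
      using poly_list_poly_type_hom[OF h(1) z'R] type_hom_subfield(1)[OF carrier_is_subfield h(1)] by simp
  qed
  from extend_embedding_at[OF F_subfield hF algebraic_F z this] obtain h' where
    h': "type_hom (carrier R) h'" "\<And>x. x \<in> F \<Longrightarrow> h' x = h x" "h' z = h z'" by metis
  obtain \<phi> where \<phi>: "\<phi> \<in> carrier (galois_group R F)" "\<And>x. x \<in> carrier R \<Longrightarrow> h (\<phi> x) = h' x"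
    using galois_group_memI[OF h(1) h'(1)] h'(2) by metis
  have "\<phi> z \<in> carrier R"
    using galois_groupD(2)[OF \<phi>(1)] z by (auto simp: bij_betw_def)
  then have "\<phi> z = z'"
    using \<phi>(2)[OF z] h'(3) z'R type_hom_subfield(4)[OF carrier_is_subfield h(1)]
    by (metis inj_onD)
  then show thesis using that \<phi>(1) by blast
qed

text \<open>A fixed element is its own only conjugate, so its minimal polynomial is linear.\<close>

lemma fixed_by_galois_group:
  assumes z: "z \<in> carrier R" and fixed: "\<And>\<phi>. \<phi> \<in> carrier (galois_group R F) \<Longrightarrow> \<phi> z = z"
  shows "z \<in> F"
proof -
  have "conjugates F z = {z}"
    using conjugate_by_galois_group[OF z] fixed conjugates_self[OF z] by blast
  then have "Polynomials.degree (Irr F z) = 1"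
    using card_conjugates(2)[OF z] by simp
  then obtain u v where uv: "Irr F z = [u, v]"
    by (cases "Irr F z"; cases "tl (Irr F z)") auto
  then have "u = \<one>" "v \<in> F" using Irr_props(3)[OF z] Irr_carrier(3)[OF z] by auto
  then have "z \<oplus> v = \<zero>"
    using Irr_props(4)[OF z] uv z F_carrier by auto
  then have "z = \<ominus> v" using z \<open>v \<in> F\<close> F_carrier by (metis minus_equality subsetD)
  then show ?thesis
    using \<open>v \<in> F\<close> subringE(5)[OF subfieldE(1)[OF F_subfield]] by simp
qed

text \<open>A subfield stable under the Galois group contains all conjugates of its elements, so
  their minimal polynomials split in it. In this form the minimality of a Galois closure is
  exploited.\<close>

lemma galois_subextension:
  assumes E: "subfield E R" and FE: "F \<subseteq> E"
    and stable: "\<And>\<phi>. \<phi> \<in> carrier (galois_group R F) \<Longrightarrow> \<phi> ` E \<subseteq> E"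
  shows "galois_extension (R\<lparr>carrier := E\<rparr>) F"
proof -
  let ?E = "R\<lparr>carrier := E\<rparr>"
  note subE = subfieldE(1)[OF E]
  have ER: "E \<subseteq> carrier R" using subringE(1)[OF subE] .
  interpret E: field ?E by (rule subfield_iff(2)[OF E])
  have "field (?E\<lparr>carrier := F\<rparr>)" using subfield_iff(2)[OF F_subfield] by simp
  then have FsubE: "subfield F ?E" using E.subfield_iff(1) FE by simp
  have Irr_eq: "ring.Irr ?E F z = Irr F z" for z
    unfolding Irr_def E.Irr_def univ_poly_consistent[OF subE] eval_consistent[OF subE] by simp
  have "\<not> ring.transcendental ?E F z \<and> ring.splitted ?E (ring.Irr ?E F z) \<and>
      (\<forall>w. ring.alg_mult ?E (ring.Irr ?E F z) w \<le> 1)" if z: "z \<in> E" for z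
  proof -
    have zR: "z \<in> carrier R" using z ER by auto
    let ?p = "Irr F z"
    have pE: "?p \<in> carrier (poly_ring ?E)"
      using Irr_carrier[OF zR] Irr_props(3)[OF zR] FE
      unfolding univ_poly_def polynomial_def by auto
    have conjE: "conjugates F z \<subseteq> E"
    proof
      fix w assume "w \<in> conjugates F z"
      then show "w \<in> E"
        using conjugate_by_galois_group[OF zR] stable z by (metis image_subset_iff)
    qed
    have "set_mset (E.roots ?p) = conjugates F z"
      using E.roots_mem_iff_is_root[OF pE] Irr_carrier(2)[OF zR] conjE ER
      by (auto simp: E.is_root_def conjugates_def eval_consistent[OF subE])
    then have card: "card (set_mset (E.roots ?p)) = Polynomials.degree ?p"
      using card_conjugates(2)[OF zR] by simp
    \<comment> \<open>At most degree many roots exist with multiplicity and exactly that many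
      distinct ones, so all multiplicities are 1.\<close>
    have "(\<Sum>w\<in>set_mset (E.roots ?p). count (E.roots ?p) w) = size (E.roots ?p)"
      by (simp add: size_multiset_overloaded_eq)
    also have "\<dots> \<le> (\<Sum>w\<in>set_mset (E.roots ?p). 1)"
      using E.size_roots_le_degree[OF pE] card by simp
    finally have le: "(\<Sum>w\<in>set_mset (E.roots ?p). count (E.roots ?p) w) \<le> (\<Sum>w\<in>set_mset (E.roots ?p). 1)" .
    have cnt: "count (E.roots ?p) w \<le> 1" for w
    proof (rule ccontr)
      assume "\<not> ?thesis"
      then have "w \<in># E.roots ?p" "1 < count (E.roots ?p) w" by (auto intro: ccontr simp: not_in_iff)
      then have "(\<Sum>w\<in>set_mset (E.roots ?p). 1) < (\<Sum>w\<in>set_mset (E.roots ?p). count (E.roots ?p) w)"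
        by (intro sum_strict_mono_ex1) (auto simp: Suc_le_eq)
      with le show False by simp
    qed
    have "count (E.roots ?p) w = 1" if "w \<in># E.roots ?p" for w
      using cnt[of w] that by (metis One_nat_def count_greater_zero_iff le_antisym less_eq_Suc_le)
    then have "size (E.roots ?p) = card (set_mset (E.roots ?p))"
      unfolding size_multiset_overloaded_eq by simp
    then have "E.splitted ?p" using card by (simp add: E.splitted_def)
    moreover have "\<not> E.transcendental F z"
      using algebraic_F[OF zR] transcendental_consistent[OF subE] by simp
    ultimately show ?thesis
      using cnt E.alg_mult_eq_count_roots[OF pE] by (simp add: Irr_eq)
  qed
  then show ?thesis
    unfolding galois_extension_def using FsubE E.field_axioms by simp
qed

end

end

section \<open>A transitive group with a transposition and a large valuation\<close>

text \<open>If r did not divide the order of z, the terms with nonzero coefficients would have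
  orders distinct modulo r, because 0 < |i - j| < r; then the term of least order could not cancel.
  A zero coefficient has \<open>fls_subdegree\<close> 0, so the divisibility hypothesis covers
  it.\<close>

lemma subdegree_root_dvd:
  fixes p :: "'b::field fls poly"
  assumes r: "Factorial_Ring.prime r" and p: "p \<noteq> 0" "Polynomial.degree p < r"
    and cf: "\<And>i. int r dvd fls_subdegree (Polynomial.coeff p i)" and z: "poly p z = 0"
  shows "int r dvd fls_subdegree z"
proof (rule ccontr)
  assume nd: "\<not> ?thesis"
  then have z0: "z \<noteq> 0" by auto
  define I where "I = {i. Polynomial.coeff p i \<noteq> 0}"
  define v where "v i = fls_subdegree (Polynomial.coeff p i * z ^ i)" for i
  have I: "I \<subseteq> {..Polynomial.degree p}" by (auto simp: I_def le_degree)
  then have fin: "finite I" by (rule finite_subset) simp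
  have ne: "I \<noteq> {}" using p(1) by (auto simp: I_def poly_eq_iff)
  have v: "v i = fls_subdegree (Polynomial.coeff p i) + int i * fls_subdegree z" if "i \<in> I" for i
    using that z0 by (simp add: v_def I_def fls_subdegree_pow)
  have inj: "inj_on v I"
  proof (rule inj_onI)
    fix i j assume ij: "i \<in> I" "j \<in> I" "v i = v j"
    then have "(int i - int j) * fls_subdegree z
        = fls_subdegree (Polynomial.coeff p j) - fls_subdegree (Polynomial.coeff p i)"
      using v by (simp add: algebra_simps)
    then have "int r dvd (int i - int j) * fls_subdegree z"
      using cf by simp
    then have "int r dvd int i - int j"
      using nd r prime_dvd_mult_iff[of "int r"] by auto
    moreover have "i < r" "j < r" using I ij(1,2) p(2) by force+
    then have "\<bar>int i - int j\<bar> < int r" by linarith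
    ultimately show "i = j" using dvd_imp_le_int[of "int i - int j" "int r"] by auto
  qed
  obtain k where k: "k \<in> I" "\<And>i. i \<in> I \<Longrightarrow> v k \<le> v i"
    using ex_min_if_finite[of "v ` I"] fin ne by (metis (no_types, lifting) empty_is_image finite_imageI image_iff not_le)
  have "poly p z = (\<Sum>i\<in>I. Polynomial.coeff p i * z ^ i)"
    unfolding poly_altdef by (rule sum.mono_neutral_right) (use I in \<open>auto simp: I_def\<close>)
  then have "fls_nth (poly p z) (v k) = (\<Sum>i\<in>I. fls_nth (Polynomial.coeff p i * z ^ i) (v k))"
    by (simp add: fls_nth_sum)
  also have "\<dots> = fls_nth (Polynomial.coeff p k * z ^ k) (v k)"
  proof (subst sum.remove[OF fin k(1)])
    have "fls_nth (Polynomial.coeff p i * z ^ i) (v k) = 0" if "i \<in> I - {k}" for i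
    proof -
      have "v k \<noteq> v i" using that k(1) inj by (auto dest: inj_onD)
      then have "v k < v i" using k(2)[of i] that by auto
      then show ?thesis unfolding v_def by (rule fls_eq0_below_subdegree)
    qed
    then show "fls_nth (Polynomial.coeff p k * z ^ k) (v k) +
        (\<Sum>i\<in>I - {k}. fls_nth (Polynomial.coeff p i * z ^ i) (v k)) =
        fls_nth (Polynomial.coeff p k * z ^ k) (v k)" by simp
  qed
  also have "\<dots> \<noteq> 0"
    unfolding v_def using k(1) z0 by (intro nth_fls_subdegree_nonzero) (auto simp: I_def)
  finally show False using z by simp
qed

text \<open>A Galois extension N of F0 inside a field type. Members of A are maps on the whole type
  of which only the restrictions to N matter, so identity, composition and inverses are asked for up
  to equality on N.\<close>

locale galois_set =
  fixes N F0 :: "'a::field set" and A :: "('a \<Rightarrow> 'a) set"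
  assumes N: "subfld N" and F0: "subfld F0" and F0N: "F0 \<subseteq> N"
    and A_closed: "h \<in> A \<Longrightarrow> x \<in> N \<Longrightarrow> h x \<in> N"
    and A_add: "h \<in> A \<Longrightarrow> x \<in> N \<Longrightarrow> y \<in> N \<Longrightarrow> h (x + y) = h x + h y"
    and A_mult: "h \<in> A \<Longrightarrow> x \<in> N \<Longrightarrow> y \<in> N \<Longrightarrow> h (x * y) = h x * h y"
    and A_fix: "h \<in> A \<Longrightarrow> x \<in> F0 \<Longrightarrow> h x = x"
    and A_id: "\<exists>k\<in>A. \<forall>x\<in>N. k x = x"
    and A_comp: "h \<in> A \<Longrightarrow> k \<in> A \<Longrightarrow> \<exists>l\<in>A. \<forall>x\<in>N. l x = h (k x)"
    and A_inv: "h \<in> A \<Longrightarrow> \<exists>k\<in>A. \<forall>x\<in>N. k (h x) = x \<and> h (k x) = x"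
    and A_fixed: "z \<in> N \<Longrightarrow> (\<And>h. h \<in> A \<Longrightarrow> h z = z) \<Longrightarrow> z \<in> F0"
begin

lemmas N_closed = subfldD[OF N] subfld_sum[OF N] subfld_prod[OF N]

lemma A_0: "h \<in> A \<Longrightarrow> h 0 = 0" and A_1: "h \<in> A \<Longrightarrow> h 1 = 1"
  using A_fix subfldD[OF F0] by auto

lemma A_uminus: "h \<in> A \<Longrightarrow> x \<in> N \<Longrightarrow> h (- x) = - h x"
  using A_add[of h x "- x"] A_0[of h] N_closed by (simp add: eq_neg_iff_add_eq_0 add.commute)

lemma A_diff: "h \<in> A \<Longrightarrow> x \<in> N \<Longrightarrow> y \<in> N \<Longrightarrow> h (x - y) = h x - h y"
  using A_add[of h x "- y"] A_uminus[of h y] N_closed by simp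

lemma A_inj: "h \<in> A \<Longrightarrow> x \<in> N \<Longrightarrow> y \<in> N \<Longrightarrow> h x = h y \<Longrightarrow> x = y"
  using A_inv[of h] by metis

lemma A_inverse: "h \<in> A \<Longrightarrow> x \<in> N \<Longrightarrow> h (inverse x) = inverse (h x)"
proof (cases "x = 0")
  case False
  assume h: "h \<in> A" "x \<in> N"
  then have "h x * h (inverse x) = 1"
    using A_mult[of h x "inverse x"] A_1[of h] N_closed False by simp
  then show ?thesis by (simp add: inverse_unique)
qed (simp add: A_0)

lemma A_divide: "h \<in> A \<Longrightarrow> x \<in> N \<Longrightarrow> y \<in> N \<Longrightarrow> h (x / y) = h x / h y"
  unfolding divide_inverse using A_mult[of h x "inverse y"] A_inverse[of h y] N_closed by simp

lemma A_sum: "h \<in> A \<Longrightarrow> (\<And>i. i \<in> I \<Longrightarrow> f i \<in> N) \<Longrightarrow> h (sum f I) = (\<Sum>i\<in>I. h (f i))"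
  by (induction I rule: infinite_finite_induct) (auto simp: A_0 A_add N_closed)

lemma A_prod: "h \<in> A \<Longrightarrow> (\<And>i. i \<in> I \<Longrightarrow> f i \<in> N) \<Longrightarrow> h (prod f I) = (\<Prod>i\<in>I. h (f i))"
  by (induction I rule: infinite_finite_induct) (auto simp: A_1 A_mult N_closed)

lemma coeff_map_A: "h \<in> A \<Longrightarrow> Polynomial.coeff (map_poly h p) i = h (Polynomial.coeff p i)"
  by (simp add: coeff_map_poly A_0)

lemma map_A_mult:
  "h \<in> A \<Longrightarrow> poly_over N p \<Longrightarrow> poly_over N q \<Longrightarrow> map_poly h (p * q) = map_poly h p * map_poly h q"
  by (rule poly_eqI) (simp add: coeff_map_A coeff_mult A_sum A_mult poly_over_def N_closed)

lemma map_A_sum: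
  "h \<in> A \<Longrightarrow> (\<And>i. i \<in> I \<Longrightarrow> poly_over N (f i)) \<Longrightarrow> map_poly h (sum f I) = (\<Sum>i\<in>I. map_poly h (f i))"
  by (rule poly_eqI) (simp add: coeff_map_A coeff_sum A_sum poly_over_def)

lemma map_A_prod:
  "h \<in> A \<Longrightarrow> (\<And>i. i \<in> I \<Longrightarrow> poly_over N (f i)) \<Longrightarrow> map_poly h (prod f I) = (\<Prod>i\<in>I. map_poly h (f i))"
  by (induction I rule: infinite_finite_induct)
    (auto simp: map_A_mult poly_over_prod[OF N] A_0 A_1 map_poly_1)

lemma map_A_linear: "h \<in> A \<Longrightarrow> w \<in> N \<Longrightarrow> map_poly h [:- w, 1:] = [:- h w, 1:]"
  by (simp add: map_poly_pCons A_0 A_1 A_uminus)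

definition root_poly :: "'a set \<Rightarrow> 'a poly" where
  "root_poly W = (\<Prod>w\<in>W. [:- w, 1:])"

lemma poly_over_root_poly: "W \<subseteq> N \<Longrightarrow> poly_over N (root_poly W)"
  unfolding root_poly_def by (intro poly_over_prod[OF N]) (auto intro: N_closed)

lemma map_A_root_poly:
  assumes h: "h \<in> A" and W: "W \<subseteq> N"
  shows "map_poly h (root_poly W) = root_poly (h ` W)"
proof -
  have "map_poly h (root_poly W) = (\<Prod>w\<in>W. [:- h w, 1:])"
    unfolding root_poly_def using W
    by (subst map_A_prod[OF h]) (auto simp: map_A_linear[OF h] intro!: prod.cong N_closed)
  also have "\<dots> = root_poly (h ` W)"
    unfolding root_poly_def using W A_inj[OF h] by (subst prod.reindex) (auto simp: inj_on_def)
  finally show ?thesis .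
qed

lemma degree_root_poly: "finite W \<Longrightarrow> Polynomial.degree (root_poly W) = card W"
  unfolding root_poly_def by (subst degree_prod_eq_sum_degree) auto

lemma root_poly_nonzero: "finite W \<Longrightarrow> root_poly W \<noteq> 0"
  by (simp add: root_poly_def)

lemma poly_root_poly: "finite W \<Longrightarrow> poly (root_poly W) x = 0 \<longleftrightarrow> x \<in> W"
  by (auto simp: root_poly_def poly_prod)

lemma invariant_poly_over_F0:
  assumes "poly_over N p" "\<And>h. h \<in> A \<Longrightarrow> map_poly h p = p"
  shows "poly_over F0 p"
  unfolding poly_over_def
proof
  fix i show "Polynomial.coeff p i \<in> F0"
    using assms by (intro A_fixed) (auto simp: poly_over_def simp flip: coeff_map_A)
qed

definition orbit :: "'a \<Rightarrow> 'a set" where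
  "orbit z = {h z | h. h \<in> A}"

lemma orbit_self: "z \<in> N \<Longrightarrow> z \<in> orbit z"
proof -
  obtain k where "k \<in> A" "\<And>x. x \<in> N \<Longrightarrow> k x = x" using A_id by blast
  then show "z \<in> N \<Longrightarrow> z \<in> orbit z" unfolding orbit_def by (auto intro!: exI[of _ k])
qed

lemma orbit_N: "z \<in> N \<Longrightarrow> orbit z \<subseteq> N"
  using A_closed by (auto simp: orbit_def)

lemma image_orbit:
  assumes h: "h \<in> A" and z: "z \<in> N"
  shows "h ` orbit z = orbit z"
proof
  have sub: "h ` orbit z \<subseteq> orbit z" if h: "h \<in> A" for h
  proof
    fix w assume "w \<in> h ` orbit z"
    then obtain k where k: "k \<in> A" "w = h (k z)" by (auto simp: orbit_def)
    obtain l where "l \<in> A" "\<And>x. x \<in> N \<Longrightarrow> l x = h (k x)" using A_comp[OF h k(1)] by blast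
    then show "w \<in> orbit z" using k z by (auto simp: orbit_def intro!: exI[of _ l])
  qed
  show "h ` orbit z \<subseteq> orbit z" by (rule sub[OF h])
  obtain k where k: "k \<in> A" "\<And>x. x \<in> N \<Longrightarrow> h (k x) = x" using A_inv[OF h] by blast
  show "orbit z \<subseteq> h ` orbit z"
  proof
    fix w assume w: "w \<in> orbit z"
    then have "k w \<in> orbit z" using sub[OF k(1)] by auto
    then show "w \<in> h ` orbit z" using k(2)[of w] w orbit_N[OF z] by (metis imageI subsetD)
  qed
qed

lemma orbit_poly_over_F0: "z \<in> N \<Longrightarrow> poly_over F0 (root_poly (orbit z))"
  by (rule invariant_poly_over_F0)
    (auto simp: map_A_root_poly orbit_N image_orbit poly_over_root_poly)

end

text \<open>R has at most m elements and will turn out to be the set of all conjugates of \<xi>.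
  Irreducibility of a degree m equation for \<xi> is expressed by the lower bound on the degree of
  any nonzero polynomial over F0 that vanishes at \<xi>.\<close>

locale galois_roots = galois_set +
  fixes R :: "'a set" and \<xi> :: 'a and m :: nat
  assumes finR: "finite R" and RN: "R \<subseteq> N" and \<xi>: "\<xi> \<in> R" and card_le: "card R \<le> m"
    and stable: "h \<in> A \<Longrightarrow> h ` R \<subseteq> R"
    and irred: "poly_over F0 Q \<Longrightarrow> Q \<noteq> 0 \<Longrightarrow> poly Q \<xi> = 0 \<Longrightarrow> m \<le> Polynomial.degree Q"
begin

lemma \<xi>N: "\<xi> \<in> N" using RN \<xi> by auto

text \<open>The polynomial whose roots form the orbit of \<xi> has coefficients in F0, so the orbit
  has at least m elements.\<close>

lemma orbit_eq: "orbit \<xi> = R" and card_R: "card R = m"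
proof -
  have sub: "orbit \<xi> \<subseteq> R" using stable \<xi> by (auto simp: orbit_def)
  then have fin: "finite (orbit \<xi>)" using finR finite_subset by auto
  have "m \<le> Polynomial.degree (root_poly (orbit \<xi>))"
    using orbit_poly_over_F0[OF \<xi>N] root_poly_nonzero[OF fin] poly_root_poly[OF fin] orbit_self[OF \<xi>N]
    by (intro irred) auto
  then have "m \<le> card (orbit \<xi>)" by (simp add: degree_root_poly[OF fin])
  moreover have "card (orbit \<xi>) \<le> card R" using sub finR card_mono by blast
  ultimately show "orbit \<xi> = R" "card R = m"
    using card_le sub finR card_subset_eq by (metis le_antisym le_trans)+
qed

lemma A_image_R: "h \<in> A \<Longrightarrow> h ` R = R"
  using image_orbit[OF _ \<xi>N] orbit_eq by auto

lemma A_inj_R: "h \<in> A \<Longrightarrow> inj_on h R"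
  using A_inj RN by (meson inj_onI subsetD)

text \<open>Since \<xi> is algebraic over F0, this is the field F0(\<xi>).\<close>

definition generated :: "'a set" where
  "generated = {poly P \<xi> | P. poly_over F0 P}"

lemma generated_poly: "poly_over F0 P \<Longrightarrow> poly P \<xi> \<in> generated"
  by (auto simp: generated_def)

lemma generated_closed:
  "x \<in> generated \<Longrightarrow> y \<in> generated \<Longrightarrow> x + y \<in> generated"
  "x \<in> generated \<Longrightarrow> y \<in> generated \<Longrightarrow> x * y \<in> generated"
  "c \<in> F0 \<Longrightarrow> c \<in> generated" "\<xi> \<in> generated"
proof -
  show "c \<in> F0 \<Longrightarrow> c \<in> generated"
    using generated_poly[of "[:c:]"] subfldD(2)[OF F0] by simp
  show "\<xi> \<in> generated"
    using generated_poly[of "[:0, 1:]"] subfldD(1,2)[OF F0] by simp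
  assume "x \<in> generated" "y \<in> generated"
  then obtain P Q where "poly_over F0 P" "x = poly P \<xi>" "poly_over F0 Q" "y = poly Q \<xi>"
    by (auto simp: generated_def)
  then show "x + y \<in> generated" "x * y \<in> generated"
    using generated_poly[of "P + Q"] generated_poly[of "P * Q"] poly_over_add[OF F0] poly_over_mult[OF F0]
    by auto
qed

text \<open>An element fixed by the stabilizer of \<open>\<xi>\<close> is the value at \<open>\<xi>\<close> of the Lagrange
  interpolation polynomial through its conjugates.\<close>

lemma fixed_by_stabilizer:
  assumes z: "z \<in> N" and fixed: "\<And>h. h \<in> A \<Longrightarrow> h \<xi> = \<xi> \<Longrightarrow> h z = z"
  shows "z \<in> generated"
proof -
  \<comment> \<open>The value at z depends only on the value at \<xi>: two maps that agree at \<xi>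
    differ by a member of its stabilizer.\<close>
  have "\<exists>y. \<forall>h\<in>A. h \<xi> = \<rho> \<longrightarrow> h z = y" for \<rho>
  proof (cases "\<exists>h\<in>A. h \<xi> = \<rho>")
    case True
    then obtain h0 where h0: "h0 \<in> A" "h0 \<xi> = \<rho>" by blast
    have "h z = h0 z" if h: "h \<in> A" "h \<xi> = \<rho>" for h
    proof -
      obtain k where k: "k \<in> A" "\<And>x. x \<in> N \<Longrightarrow> k (h0 x) = x \<and> h0 (k x) = x" using A_inv[OF h0(1)] by blast
      obtain l where l: "l \<in> A" "\<And>x. x \<in> N \<Longrightarrow> l x = k (h x)" using A_comp[OF k(1) h(1)] by blast
      have "l \<xi> = \<xi>" using l(2)[OF \<xi>N] k(2)[OF \<xi>N] h h0 by simp
      then have "k (h z) = z" using fixed[OF l(1)] l(2)[OF z] by simp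
      then show ?thesis using k(2)[OF A_closed[OF h(1) z]] by simp
    qed
    then show ?thesis by blast
  qed blast
  then obtain y where y: "\<And>h. h \<in> A \<Longrightarrow> y (h \<xi>) = h z" by metis
  have yN: "y \<rho> \<in> N" if "\<rho> \<in> R" for \<rho>
    using that y A_closed[OF _ z] unfolding orbit_eq[symmetric] orbit_def by auto
  have y_map: "h (y \<rho>) = y (h \<rho>)" if h: "h \<in> A" and \<rho>: "\<rho> \<in> R" for h \<rho>
  proof -
    obtain k where k: "k \<in> A" "\<rho> = k \<xi>" using \<rho> unfolding orbit_eq[symmetric] orbit_def by auto
    obtain l where l: "l \<in> A" "\<And>x. x \<in> N \<Longrightarrow> l x = h (k x)" using A_comp[OF h k(1)] by blast
    show ?thesis using y[OF k(1)] y[OF l(1)] l(2)[OF \<xi>N] l(2)[OF z] k(2) by simp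
  qed
  \<comment> \<open>Denominators of Lagrange interpolation; A permutes the values \<open>y\<close>
    and \<open>e\<close> along with the roots, so the interpolation polynomial is invariant.\<close>
  define e where "e \<rho> = (\<Prod>\<rho>'\<in>R - {\<rho>}. \<rho> - \<rho>')" for \<rho>
  have eN: "e \<rho> \<in> N" if "\<rho> \<in> R" for \<rho>
    unfolding e_def using RN that by (intro N_closed) auto
  have e_nz: "e \<rho> \<noteq> 0" for \<rho>
    unfolding e_def using finR by auto
  have im: "h ` (R - {\<rho>}) = R - {h \<rho>}" if "h \<in> A" "\<rho> \<in> R" for h \<rho>
    using A_image_R[OF that(1)] A_inj_R[OF that(1)] that(2) by (auto simp: inj_on_def)
  have e_map: "h (e \<rho>) = e (h \<rho>)" if h: "h \<in> A" and \<rho>: "\<rho> \<in> R" for h \<rho>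
  proof -
    have "h (e \<rho>) = (\<Prod>\<rho>'\<in>R - {\<rho>}. h \<rho> - h \<rho>')"
      unfolding e_def using RN \<rho>
      by (subst A_prod[OF h]) (auto simp: A_diff[OF h] subset_iff intro!: N_closed prod.cong)
    also have "\<dots> = (\<Prod>\<rho>'\<in>h ` (R - {\<rho>}). h \<rho> - \<rho>')"
      using A_inj_R[OF h] by (subst prod.reindex) (auto intro: inj_on_subset)
    finally show ?thesis by (simp add: im[OF h \<rho>] e_def)
  qed
  define P where "P = (\<Sum>\<rho>\<in>R. Polynomial.smult (y \<rho> / e \<rho>) (root_poly (R - {\<rho>})))"
  have termN: "poly_over N (Polynomial.smult (y \<rho> / e \<rho>) (root_poly (R - {\<rho>})))" if "\<rho> \<in> R" for \<rho>
    using that yN eN RN by (intro poly_over_smult[OF N] poly_over_root_poly N_closed) auto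
  have "map_poly h P = P" if h: "h \<in> A" for h
  proof -
    have "map_poly h P = (\<Sum>\<rho>\<in>R. Polynomial.smult (y (h \<rho>) / e (h \<rho>)) (root_poly (R - {h \<rho>})))"
      unfolding P_def
    proof (subst map_A_sum[OF h termN], assumption, rule sum.cong)
      fix \<rho> assume \<rho>: "\<rho> \<in> R"
      have cN: "y \<rho> / e \<rho> \<in> N" using \<rho> yN eN by (intro N_closed)
      have "map_poly h (Polynomial.smult (y \<rho> / e \<rho>) (root_poly (R - {\<rho>})))
          = Polynomial.smult (h (y \<rho> / e \<rho>)) (map_poly h (root_poly (R - {\<rho>})))"
      proof (rule poly_eqI)
        fix i
        have "Polynomial.coeff (root_poly (R - {\<rho>})) i \<in> N"
          using poly_over_root_poly[of "R - {\<rho>}"] RN by (auto simp: poly_over_def)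
        then show "Polynomial.coeff (map_poly h (Polynomial.smult (y \<rho> / e \<rho>) (root_poly (R - {\<rho>})))) i
          = Polynomial.coeff (Polynomial.smult (h (y \<rho> / e \<rho>)) (map_poly h (root_poly (R - {\<rho>})))) i"
          unfolding coeff_map_A[OF h] coeff_smult using cN by (intro A_mult[OF h])
      qed
      also have "map_poly h (root_poly (R - {\<rho>})) = root_poly (R - {h \<rho>})"
        using RN by (subst map_A_root_poly[OF h]) (auto simp: im[OF h \<rho>])
      finally show "map_poly h (Polynomial.smult (y \<rho> / e \<rho>) (root_poly (R - {\<rho>})))
          = Polynomial.smult (y (h \<rho>) / e (h \<rho>)) (root_poly (R - {h \<rho>}))"
        using \<rho> yN eN by (simp add: A_divide[OF h] y_map[OF h] e_map[OF h])
    qed simp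
    also have "\<dots> = (\<Sum>\<rho>\<in>h ` R. Polynomial.smult (y \<rho> / e \<rho>) (root_poly (R - {\<rho>})))"
      using A_inj_R[OF h] by (subst sum.reindex) auto
    finally show ?thesis by (simp add: A_image_R[OF h] P_def)
  qed
  then have P: "poly_over F0 P"
    unfolding P_def using termN
    by (intro invariant_poly_over_F0 poly_over_sum[OF N]) auto
  have "poly P \<xi> = (\<Sum>\<rho>\<in>R. (y \<rho> / e \<rho>) * poly (root_poly (R - {\<rho>})) \<xi>)"
    by (simp add: P_def poly_sum)
  also have "\<dots> = (y \<xi> / e \<xi>) * poly (root_poly (R - {\<xi>})) \<xi>"
    using poly_root_poly finR \<xi> by (subst sum.remove[OF finR \<xi>]) (auto intro!: sum.neutral)
  also have "poly (root_poly (R - {\<xi>})) \<xi> = e \<xi>"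
    by (simp add: root_poly_def poly_prod e_def)
  also have "y \<xi> = z"
    using y A_id \<xi>N z by metis
  finally have "poly P \<xi> = z" using e_nz by simp
  then show ?thesis using generated_poly[OF P] by simp
qed

section \<open>Blocks of roots connected by transpositions\<close>

definition swappable :: "'a \<Rightarrow> 'a \<Rightarrow> bool" where
  "swappable a b \<longleftrightarrow> (\<exists>s\<in>A. \<forall>x\<in>R. s x = Transposition.transpose a b x)"

lemma swappable_refl: "swappable a a"
  unfolding swappable_def using A_id RN by (auto simp: subset_iff)

lemma swappable_sym: "swappable a b \<Longrightarrow> swappable b a"
  by (simp add: swappable_def transpose_commute)

lemma A_comp3:
  assumes "h \<in> A" "k \<in> A" "l \<in> A"
  obtains j where "j \<in> A" "\<And>x. x \<in> N \<Longrightarrow> j x = h (k (l x))"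
proof -
  obtain u where u: "u \<in> A" "\<And>x. x \<in> N \<Longrightarrow> u x = k (l x)" using A_comp[OF assms(2,3)] by blast
  obtain j where "j \<in> A" "\<And>x. x \<in> N \<Longrightarrow> j x = h (u x)" using A_comp[OF assms(1) u(1)] by blast
  then show thesis using u that[of j] by auto
qed

text \<open>Conjugation: (a b)(b c)(a b) = (a c) once c differs from a and b.\<close>

lemma swappable_trans:
  assumes "swappable a b" "swappable b c" "a \<in> R" "b \<in> R" "c \<in> R"
  shows "swappable a c"
proof (cases "a = c \<or> b = c")
  case True
  then show ?thesis using assms swappable_refl by auto
next
  case False
  obtain s t where s: "s \<in> A" "\<And>x. x \<in> R \<Longrightarrow> s x = Transposition.transpose a b x"
    and t: "t \<in> A" "\<And>x. x \<in> R \<Longrightarrow> t x = Transposition.transpose b c x"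
    using assms by (auto simp: swappable_def)
  obtain j where j: "j \<in> A" "\<And>x. x \<in> N \<Longrightarrow> j x = s (t (s x))" using A_comp3[OF s(1) t(1) s(1)] by blast
  have "j x = Transposition.transpose a c x" if x: "x \<in> R" for x
  proof -
    have "s x \<in> R" "t (s x) \<in> R" using stable s(1) t(1) x by blast+
    then have "j x = (Transposition.transpose a b \<circ> Transposition.transpose b c \<circ> Transposition.transpose a b) x"
      using j(2) s(2) t(2) x RN by (auto simp: subset_iff)
    then show ?thesis using False by (subst (asm) transpose_comp_triple) auto
  qed
  then show ?thesis using j(1) by (auto simp: swappable_def)
qed

text \<open>Conjugating the transposition of a and b by h gives that of h a and h b.\<close>

lemma swappable_map:
  assumes sw: "swappable a b" and h: "h \<in> A" and ab: "a \<in> R" "b \<in> R"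
  shows "swappable (h a) (h b)"
proof -
  obtain s where s: "s \<in> A" "\<And>x. x \<in> R \<Longrightarrow> s x = Transposition.transpose a b x"
    using sw by (auto simp: swappable_def)
  obtain k where k: "k \<in> A" "\<And>x. x \<in> N \<Longrightarrow> k (h x) = x \<and> h (k x) = x" using A_inv[OF h] by blast
  obtain j where j: "j \<in> A" "\<And>x. x \<in> N \<Longrightarrow> j x = h (s (k x))" using A_comp3[OF h s(1) k(1)] by blast
  have "j x = Transposition.transpose (h a) (h b) x" if x: "x \<in> R" for x
  proof -
    have xN: "x \<in> N" and kx: "k x \<in> R" using x RN stable[OF k(1)] by auto
    have "j x = h (Transposition.transpose a b (k x))" using j(2)[OF xN] s(2)[OF kx] by simp
    also have "\<dots> = Transposition.transpose (h a) (h b) (h (k x))"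
      using A_inj_R[OF h] kx ab by (auto simp: Transposition.transpose_def inj_on_def)
    finally show ?thesis using k(2)[OF xN] by simp
  qed
  then show ?thesis using j(1) by (auto simp: swappable_def)
qed

definition cls :: "'a \<Rightarrow> 'a set" where
  "cls \<rho> = {\<rho>'\<in>R. swappable \<rho> \<rho>'}"

lemma image_cls:
  assumes h: "h \<in> A" and \<rho>: "\<rho> \<in> R"
  shows "h ` cls \<rho> = cls (h \<rho>)"
proof
  have sub: "h ` cls \<rho> \<subseteq> cls (h \<rho>)" if "h \<in> A" "\<rho> \<in> R" for h \<rho>
    using that stable swappable_map by (auto simp: cls_def)
  show "h ` cls \<rho> \<subseteq> cls (h \<rho>)" using sub[OF h \<rho>] .
  obtain k where k: "k \<in> A" "\<And>x. x \<in> N \<Longrightarrow> k (h x) = x \<and> h (k x) = x" using A_inv[OF h] by blast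
  show "cls (h \<rho>) \<subseteq> h ` cls \<rho>"
  proof
    fix x assume x: "x \<in> cls (h \<rho>)"
    then have "k x \<in> cls (k (h \<rho>))" using sub[OF k(1)] stable[OF h] \<rho> by blast
    then have "k x \<in> cls \<rho>" using k(2) \<rho> RN by auto
    moreover have "h (k x) = x" using k(2) x RN by (auto simp: cls_def)
    ultimately show "x \<in> h ` cls \<rho>" by (metis imageI)
  qed
qed

lemma card_cls:
  assumes "\<rho> \<in> R"
  shows "card (cls \<rho>) = card (cls \<xi>)"
proof -
  obtain h where h: "h \<in> A" "\<rho> = h \<xi>" using assms unfolding orbit_eq[symmetric] orbit_def by auto
  have "card (h ` cls \<xi>) = card (cls \<xi>)"
    using A_inj_R[OF h(1)] by (intro card_image) (auto simp: cls_def inj_on_def)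
  then show ?thesis using image_cls[OF h(1) \<xi>] h(2) by simp
qed

lemma card_cls_mult: "card (cls \<xi>) * card (cls ` R) = m"
proof -
  have "card (cls \<xi>) * card (cls ` R) = card (\<Union>(cls ` R))"
  proof (rule card_partition)
    show "c1 \<inter> c2 = {}" if "c1 \<in> cls ` R" "c2 \<in> cls ` R" "c1 \<noteq> c2" for c1 c2
    proof (rule ccontr)
      assume "c1 \<inter> c2 \<noteq> {}"
      then obtain a b x where *: "a \<in> R" "b \<in> R" "c1 = cls a" "c2 = cls b" "x \<in> R" "swappable a x" "swappable b x"
        using \<open>c1 \<in> cls ` R\<close> \<open>c2 \<in> cls ` R\<close> unfolding cls_def by blast
      then have "swappable a b" using swappable_trans swappable_sym by blast
      then have "cls a = cls b" using * swappable_trans swappable_sym unfolding cls_def by blast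
      then show False using * that by simp
    qed
  qed (use finR card_cls in \<open>auto simp: cls_def\<close>)
  also have "\<Union>(cls ` R) = R" using swappable_refl by (auto simp: cls_def)
  finally show ?thesis by (simp add: card_R)
qed

text \<open>The coefficients of the polynomial with root set \<open>cls \<xi>\<close> lie in the field generated by
  \<open>\<xi>\<close> and have few conjugates, hence small degree over \<open>F0\<close>; so their valuation is divisible
  by \<open>r\<close>, while that of \<open>\<xi>\<close> is not.\<close>

lemma large_class:
  fixes \<nu> :: "'a \<Rightarrow> 'b::field fls"
  assumes sw: "\<rho>1 \<in> R" "\<rho>2 \<in> R" "\<rho>1 \<noteq> \<rho>2" "swappable \<rho>1 \<rho>2"
    and r: "Factorial_Ring.prime r" "m < 2 * r"
    and \<nu>_add: "\<And>x y. x \<in> generated \<Longrightarrow> y \<in> generated \<Longrightarrow> \<nu> (x + y) = \<nu> x + \<nu> y"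
    and \<nu>_mult: "\<And>x y. x \<in> generated \<Longrightarrow> y \<in> generated \<Longrightarrow> \<nu> (x * y) = \<nu> x * \<nu> y"
    and \<nu>_0: "\<And>x. x \<in> generated \<Longrightarrow> \<nu> x = 0 \<longleftrightarrow> x = 0"
    and \<nu>_F0: "\<And>c. c \<in> F0 \<Longrightarrow> int r dvd fls_subdegree (\<nu> c)"
    and \<nu>_\<xi>: "\<not> int r dvd fls_subdegree (\<nu> \<xi>)"
  shows "cls \<xi> = R"
proof -
  note gen0 = generated_closed(3)[OF subfldD(2)[OF F0]]
  \<comment> \<open>The map \<nu> carries a relation for z to a relation for \<nu> z over Laurent
    series whose degree is still below r, so the divisibility lemma for orders applies.\<close>
  have val: "int r dvd fls_subdegree (\<nu> z)"
    if p: "poly_over generated p" "p \<noteq> 0" "Polynomial.degree p < r" "poly p z = 0" "z \<in> generated"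
      and v: "\<And>i. int r dvd fls_subdegree (\<nu> (Polynomial.coeff p i))" for p z
  proof -
    have \<nu>0: "\<nu> 0 = 0" using \<nu>_0[OF gen0] by simp
    have ev: "poly q z \<in> generated \<and> poly (map_poly \<nu> q) (\<nu> z) = \<nu> (poly q z)" if "poly_over generated q" for q
      using that
    proof (induction q)
      case (pCons a q)
      then show ?case
        using p(5) \<nu>0 by (simp add: map_poly_pCons \<nu>_add \<nu>_mult generated_closed)
    qed (use gen0 \<nu>0 in simp)
    have cf: "Polynomial.coeff (map_poly \<nu> p) i = \<nu> (Polynomial.coeff p i)" for i
      using \<nu>0 by (simp add: coeff_map_poly)
    have "Polynomial.coeff (map_poly \<nu> p) (Polynomial.degree p) \<noteq> 0"
      using p \<nu>_0 by (auto simp: cf poly_over_def)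
    then have "map_poly \<nu> p \<noteq> 0" by auto
    moreover have "Polynomial.degree (map_poly \<nu> p) < r"
      using p(3) cf \<nu>0 by (metis (no_types, lifting) le_less_trans degree_le le_degree leading_coeff_0_iff coeff_0 coeff_eq_0)
    ultimately show ?thesis
      using subdegree_root_dvd[OF r(1), of "map_poly \<nu> p" "\<nu> z"] ev[OF p(1)] p(4) \<nu>0 v cf by simp
  qed
  have finc: "finite (cls \<rho>)" for \<rho> using finR by (simp add: cls_def)
  have clsN: "cls \<rho> \<subseteq> N" for \<rho> using RN by (auto simp: cls_def)
  have "{\<rho>1, \<rho>2} \<subseteq> cls \<rho>1" using sw swappable_refl by (auto simp: cls_def)
  then have "card {\<rho>1, \<rho>2} \<le> card (cls \<rho>1)" by (intro card_mono finc)
  then have d2: "2 \<le> card (cls \<xi>)" using sw card_cls[OF sw(1)] by simp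
  \<comment> \<open>Every class has at least two members, so there are at most m / 2 < r
    classes.\<close>
  have "2 * card (cls ` R) \<le> card (cls \<xi>) * card (cls ` R)" using d2 by simp
  then have k_lt: "card (cls ` R) < r" using card_cls_mult r(2) by simp
  define q where "q = root_poly (cls \<xi>)"
  have cq: "Polynomial.coeff q i \<in> generated \<and> int r dvd fls_subdegree (\<nu> (Polynomial.coeff q i))" for i
  proof
    define c where "c \<rho> = Polynomial.coeff (root_poly (cls \<rho>)) i" for \<rho>
    have c_map: "h (c \<rho>) = c (h \<rho>)" if "h \<in> A" "\<rho> \<in> R" for h \<rho>
      using map_A_root_poly[OF that(1) clsN] image_cls[OF that] that(1)
      by (simp add: c_def flip: coeff_map_A)
    have cN: "c \<xi> \<in> N" using poly_over_root_poly[OF clsN] by (simp add: c_def poly_over_def)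
    show gen: "Polynomial.coeff q i \<in> generated"
    proof -
      have "h (c \<xi>) = c \<xi>" if "h \<in> A" "h \<xi> = \<xi>" for h
        using c_map[OF that(1) \<xi>] that(2) by simp
      then have "c \<xi> \<in> generated" by (rule fixed_by_stabilizer[OF cN])
      then show ?thesis by (simp add: c_def q_def)
    qed
    \<comment> \<open>The conjugates of a coefficient are the corresponding coefficients for the
      other classes, so there are fewer than r of them.\<close>
    have "orbit (c \<xi>) \<subseteq> (\<lambda>B. Polynomial.coeff (root_poly B) i) ` (cls ` R)"
    proof
      fix w assume "w \<in> orbit (c \<xi>)"
      then obtain h where h: "h \<in> A" "w = h (c \<xi>)" by (auto simp: orbit_def)
      then have "w = Polynomial.coeff (root_poly (cls (h \<xi>))) i" using c_map[OF h(1) \<xi>] by (simp add: c_def)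
      moreover have "h \<xi> \<in> R" using stable[OF h(1)] \<xi> by auto
      ultimately show "w \<in> (\<lambda>B. Polynomial.coeff (root_poly B) i) ` (cls ` R)" by blast
    qed
    then have fin: "finite (orbit (c \<xi>))" and "card (orbit (c \<xi>)) \<le> card (cls ` R)"
      using finR by (auto intro: finite_subset surj_card_le)
    then have lt: "card (orbit (c \<xi>)) < r" using k_lt by simp
    have "int r dvd fls_subdegree (\<nu> (c \<xi>))"
    proof (rule val)
      show "poly_over generated (root_poly (orbit (c \<xi>)))"
        using orbit_poly_over_F0[OF cN] generated_closed(3) by (auto simp: poly_over_def)
      show "Polynomial.degree (root_poly (orbit (c \<xi>))) < r" using lt by (simp add: degree_root_poly[OF fin])
      show "int r dvd fls_subdegree (\<nu> (Polynomial.coeff (root_poly (orbit (c \<xi>))) j))" for j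
        using orbit_poly_over_F0[OF cN] \<nu>_F0 by (auto simp: poly_over_def)
    qed (use fin gen cN root_poly_nonzero poly_root_poly orbit_self in \<open>auto simp: c_def q_def\<close>)
    then show "int r dvd fls_subdegree (\<nu> (Polynomial.coeff q i))" by (simp add: c_def q_def)
  qed
  \<comment> \<open>Otherwise the class polynomial itself would be a relation for \<xi> of degree
    below r whose coefficients have order divisible by r.\<close>
  have "r \<le> card (cls \<xi>)"
  proof (rule ccontr)
    assume lt: "\<not> ?thesis"
    have "int r dvd fls_subdegree (\<nu> \<xi>)"
    proof (rule val)
      show "poly_over generated q" using cq by (simp add: poly_over_def)
      show "q \<noteq> 0" unfolding q_def by (rule root_poly_nonzero[OF finc])
      show "Polynomial.degree q < r" using lt by (simp add: q_def degree_root_poly[OF finc])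
      show "poly q \<xi> = 0" unfolding q_def poly_root_poly[OF finc] using swappable_refl \<xi> by (simp add: cls_def)
    qed (use cq generated_closed(4) in blast)+
    then show False using \<nu>_\<xi> by simp
  qed
  then have "r * card (cls ` R) \<le> m" using card_cls_mult by (metis mult_le_mono1)
  then have "r * card (cls ` R) < r * 2" using r(2) by linarith
  then have "card (cls ` R) < 2" by simp
  moreover have "card (cls ` R) \<noteq> 0" using finR \<xi> by auto
  ultimately have "card (cls ` R) = 1" by simp
  then have "card (cls \<xi>) = card R" using card_cls_mult card_R by simp
  then show ?thesis by (intro card_subset_eq[OF finR]) (auto simp: cls_def)
qed

text \<open>With a single class every transposition of roots is realized, and these generate all
  permutations.\<close>

lemma all_permutations:
  assumes all: "cls \<xi> = R" and \<pi>: "\<pi> permutes R"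
  shows "\<exists>h\<in>A. \<forall>x\<in>R. h x = \<pi> x"
  using \<pi> finR
proof (induction rule: permutes_induct)
  case id
  then show ?case using A_id RN by auto
next
  case (swap a b p)
  obtain h where h: "h \<in> A" "\<And>x. x \<in> R \<Longrightarrow> h x = p x" using swap by auto
  have "swappable \<xi> a" "swappable \<xi> b"
    using all swap.hyps(1,2) by (auto simp: cls_def)
  then have "swappable a b"
    using swappable_trans[of a \<xi> b] swappable_sym swap.hyps(1,2) \<xi> by blast
  then obtain s where s: "s \<in> A" "\<And>x. x \<in> R \<Longrightarrow> s x = Transposition.transpose a b x"
    by (auto simp: swappable_def)
  obtain j where j: "j \<in> A" "\<And>x. x \<in> N \<Longrightarrow> j x = s (h x)" using A_comp[OF s(1) h(1)] by blast
  have "j x = (Transposition.transpose a b \<circ> p) x" if x: "x \<in> R" for x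
  proof -
    have "h x \<in> R" using stable[OF h(1)] x by auto
    then show ?thesis using j(2)[of x] s(2) h(2)[OF x] x RN by auto
  qed
  then show ?case using j(1) by auto
qed

end

section \<open>Hensel's lemma for formal power series\<close>

lemma poly_add_taylor2:
  fixes P :: "'a::idom poly"
  shows "\<exists>q. poly P (z + h) = poly P z + h * poly (pderiv P) z + h ^ 2 * q"
proof (induction P)
  case (pCons a P)
  then obtain q where "poly P (z + h) = poly P z + h * poly (pderiv P) z + h ^ 2 * q" by blast
  then show ?case
    by (intro exI[of _ "poly (pderiv P) z + (z + h) * q"])
      (simp add: pderiv_pCons algebra_simps power2_eq_square)
qed simp

lemma fps_poly_cong_upto:
  fixes P :: "'a::comm_ring_1 fps poly"
  assumes "\<And>i. i \<le> k \<Longrightarrow> fps_nth u i = fps_nth v i" "i \<le> k"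
  shows "fps_nth (poly P u) i = fps_nth (poly P v) i"
  using assms(2)
proof (induction P arbitrary: i)
  case (pCons a P)
  then show ?case
    using assms(1) by (auto simp: fps_mult_nth intro!: sum.cong)
qed simp

text \<open>Newton's method, one coefficient at a time: adding \<open>a X^(k+1)\<close> changes the
  coefficient of index k + 1 of P(z) by a times the nonzero constant term of P'(z), and leaves the
  lower ones unchanged.\<close>

lemma hensel_fps_const:
  fixes P :: "'a::field fps poly"
  assumes root: "fps_nth (poly P (fps_const c)) 0 = 0"
    and simple: "fps_nth (poly (pderiv P) (fps_const c)) 0 \<noteq> 0"
  obtains z where "poly P z = 0" "fps_nth z 0 = c"
proof -
  define Q where "Q k z \<longleftrightarrow> fps_nth z 0 = c \<and> (\<forall>i\<le>k. fps_nth (poly P z) i = 0)" for k z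
  have "\<exists>z. \<forall>k. Q k (z k) \<and> (\<forall>i\<le>k. fps_nth (z (Suc k)) i = fps_nth (z k) i)"
  proof (rule dependent_nat_choice)
    show "\<exists>z. Q 0 z" using root by (intro exI[of _ "fps_const c"]) (simp add: Q_def)
    fix z k assume z: "Q k z"
    have d: "fps_nth (poly (pderiv P) z) 0 \<noteq> 0"
      using fps_poly_cong_upto[of 0 z "fps_const c" 0 "pderiv P"] simple z by (simp add: Q_def)
    define a where "a = - fps_nth (poly P z) (Suc k) / fps_nth (poly (pderiv P) z) 0"
    define h where "h = fps_const a * fps_X ^ Suc k"
    obtain q where q: "poly P (z + h) = poly P z + h * poly (pderiv P) z + h ^ 2 * q"
      using poly_add_taylor2 by blast
    have h: "fps_nth (h * w) i = (if i \<le> k then 0 else a * fps_nth w (i - Suc k))" for w i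
      unfolding h_def mult.assoc by (auto simp: fps_X_power_mult_nth simp del: power_Suc)
    have hz: "fps_nth h i = 0" if "i \<le> k" for i
      using h[of 1 i] that by simp
    have "fps_nth (h * q) 0 = 0" using h[of q 0] by simp
    then have "fps_nth (h ^ 2 * q) i = 0" if "i \<le> Suc k" for i
      using h[of "h * q" i] that by (cases "i = Suc k") (auto simp: power2_eq_square mult.assoc)
    then have "fps_nth (poly P (z + h)) i = 0" if "i \<le> Suc k" for i
      using z q d h[of "poly (pderiv P) z" i] that
      by (cases "i = Suc k") (auto simp: Q_def a_def)
    then have "Q (Suc k) (z + h)" using z hz by (auto simp: Q_def)
    moreover have "\<forall>i\<le>k. fps_nth (z + h) i = fps_nth z i" using hz by simp
    ultimately show "\<exists>y. Q (Suc k) y \<and> (\<forall>i\<le>k. fps_nth y i = fps_nth z i)" by blast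
  qed
  then obtain z where z: "\<And>k. Q k (z k)" "\<And>k i. i \<le> k \<Longrightarrow> fps_nth (z (Suc k)) i = fps_nth (z k) i" by blast
  \<comment> \<open>The approximations agree on ever longer initial segments, so the diagonal is
    their limit.\<close>
  define Z where "Z = Abs_fps (\<lambda>i. fps_nth (z i) i)"
  have "fps_nth (z k) i = fps_nth (z i) i" if "i \<le> k" for i k
    using that
  proof (induction k rule: dec_induct)
    case (step k)
    from z(2)[OF step(1)] step(3) show ?case by (rule trans)
  qed (rule refl)
  then have ZZ: "fps_nth Z i = fps_nth (z k) i" if "i \<le> k" for i k
    using that unfolding Z_def fps_nth_Abs_fps by metis
  have "poly P Z = 0"
  proof (rule fps_ext)
    fix k
    show "fps_nth (poly P Z) k = fps_nth 0 k"
      using fps_poly_cong_upto[of k Z "z k" k P] ZZ z(1)[of k] by (simp add: Q_def)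
  qed
  moreover have "fps_nth Z 0 = c" using z(1)[of 0] by (simp add: Z_def Q_def)
  ultimately show thesis using that by blast
qed

section \<open>Homomorphisms from polynomials and from their fractions\<close>

locale type_ring_hom =
  fixes \<kappa> :: "'a::comm_ring_1 \<Rightarrow> 'b::comm_ring_1"
  assumes hom_add: "\<kappa> (x + y) = \<kappa> x + \<kappa> y" and hom_mult: "\<kappa> (x * y) = \<kappa> x * \<kappa> y" and hom_1: "\<kappa> 1 = 1"
begin

lemma hom_0: "\<kappa> 0 = 0"
  using hom_add[of 0 0] by simp

lemma hom_uminus: "\<kappa> (- x) = - \<kappa> x"
  using hom_add[of x "- x"] by (simp add: hom_0 eq_neg_iff_add_eq_0 add.commute)

lemma hom_diff: "\<kappa> (x - y) = \<kappa> x - \<kappa> y"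
  using hom_add[of x "- y"] by (simp add: hom_uminus)

lemma hom_power: "\<kappa> (x ^ n) = \<kappa> x ^ n"
  by (induction n) (auto simp: hom_1 hom_mult)

lemma hom_sum: "\<kappa> (sum f I) = (\<Sum>i\<in>I. \<kappa> (f i))"
  by (induction I rule: infinite_finite_induct) (auto simp: hom_0 hom_add)

definition ev :: "'b \<Rightarrow> 'a poly \<Rightarrow> 'b" where
  "ev t p = poly (map_poly \<kappa> p) t"

lemma ev_pCons: "ev t (pCons a p) = \<kappa> a + t * ev t p"
  by (simp add: ev_def map_poly_pCons hom_0)

lemma ev_0 [simp]: "ev t 0 = 0"
  by (simp add: ev_def)

lemma ev_add: "ev t (p + q) = ev t p + ev t q"
  by (induction p q rule: poly_induct2) (auto simp: ev_pCons hom_add algebra_simps)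

lemma ev_smult: "ev t (Polynomial.smult c p) = \<kappa> c * ev t p"
  by (induction p) (auto simp: ev_pCons hom_mult algebra_simps)

lemma ev_mult: "ev t (p * q) = ev t p * ev t q"
  by (induction p) (auto simp: ev_pCons ev_add ev_smult hom_0 algebra_simps)

lemma ev_1: "ev t 1 = 1"
  by (simp add: one_pCons ev_pCons hom_1)

lemma ev_monom: "ev t (Polynomial.monom c n) = \<kappa> c * t ^ n"
  by (simp add: ev_def map_poly_monom hom_0 poly_monom)

lemma ev_hom: "type_ring_hom (ev t)"
  by unfold_locales (auto simp: ev_add ev_mult ev_1)

end

locale type_field_hom = type_ring_hom \<kappa> for \<kappa> :: "'a::field \<Rightarrow> 'b::field"
begin

lemma hom_nonzero: "x \<noteq> 0 \<Longrightarrow> \<kappa> x \<noteq> 0"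
  using hom_mult[of x "inverse x"] by (auto simp: hom_1)

lemma hom_eq_0_iff: "\<kappa> x = 0 \<longleftrightarrow> x = 0"
  using hom_nonzero hom_0 by auto

lemma hom_inverse: "\<kappa> (inverse x) = inverse (\<kappa> x)"
proof (cases "x = 0")
  case False
  then have "\<kappa> x * \<kappa> (inverse x) = 1" using hom_mult[of x "inverse x"] by (simp add: hom_1)
  then show ?thesis by (simp add: inverse_unique)
qed (simp add: hom_0)

lemma hom_divide: "\<kappa> (x / y) = \<kappa> x / \<kappa> y"
  by (simp add: divide_inverse hom_mult hom_inverse)

lemma inj: "inj \<kappa>"
proof (rule injI)
  fix x y assume "\<kappa> x = \<kappa> y"
  then have "\<kappa> (x - y) = 0" by (simp add: hom_diff)
  then show "x = y" by (simp add: hom_eq_0_iff)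
qed

end

locale closed_field_hom = type_field_hom \<kappa> for \<kappa> :: "'a::alg_closed_field \<Rightarrow> 'b::field"
begin

text \<open>Over an algebraically closed field a polynomial splits into linear factors, and t -
  \<kappa> c never vanishes when t is not a constant. Thus non-constancy already gives
  transcendence.\<close>

lemma transcendental:
  assumes t: "t \<notin> range \<kappa>"
  shows "ev t p = 0 \<longleftrightarrow> p = 0"
proof (induction "Polynomial.degree p" arbitrary: p rule: less_induct)
  case less
  show ?case
  proof (cases "Polynomial.degree p = 0")
    case True
    then obtain c where "p = [:c:]" by (auto elim: degree_eq_zeroE)
    then show ?thesis by (simp add: ev_pCons hom_eq_0_iff)
  next
    case False
    then obtain c where "poly p c = 0" using alg_closed_imp_poly_has_root[of p] by auto
    then obtain q where q: "p = [:- c, 1:] * q" by (auto simp: poly_eq_0_iff_dvd elim: dvdE)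
    then have "q \<noteq> 0" using False by auto
    then have "Polynomial.degree p = Suc (Polynomial.degree q)"
      unfolding q by (subst degree_mult_eq) auto
    then have "ev t q \<noteq> 0" using less[of q] \<open>q \<noteq> 0\<close> by simp
    moreover have "ev t [:- c, 1:] \<noteq> 0"
      using t by (auto simp: ev_pCons hom_uminus hom_1)
    ultimately have "ev t p \<noteq> 0" unfolding q ev_mult by simp
    moreover have "p \<noteq> 0" using False by auto
    ultimately show ?thesis by simp
  qed
qed

end

lemma fract_as_quot: "\<exists>a b. z = to_fract a / to_fract b \<and> b \<noteq> 0"
  by (cases z) (auto simp: Fract_conv_to_fract)

text \<open>The reduced fraction serves as canonical representative; for a homomorphism \<phi>
  without kernel any other fraction gives the same value.\<close>

definition fract_ext :: "('a::{ring_gcd,idom_divide,semiring_gcd_mult_normalize} \<Rightarrow> 'b::field) \<Rightarrow> 'a fract \<Rightarrow> 'b" where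
  "fract_ext \<phi> z = \<phi> (fst (quot_of_fract z)) / \<phi> (snd (quot_of_fract z))"

locale inj_hom = type_ring_hom \<phi>
  for \<phi> :: "'a::{ring_gcd,idom_divide,semiring_gcd_mult_normalize} \<Rightarrow> 'b::field" +
  assumes \<phi>_nonzero: "x \<noteq> 0 \<Longrightarrow> \<phi> x \<noteq> 0"
begin

lemma fract_ext_quot: "b \<noteq> 0 \<Longrightarrow> fract_ext \<phi> (to_fract a / to_fract b) = \<phi> a / \<phi> b"
proof -
  assume b: "b \<noteq> 0"
  define u v where "u = fst (quot_of_fract (to_fract a / to_fract b))"
    and "v = snd (quot_of_fract (to_fract a / to_fract b))"
  have v: "v \<noteq> 0" by (simp add: v_def)
  have "to_fract a / to_fract b = to_fract u / to_fract v"
    unfolding u_def v_def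
    by (metis Fract_conv_to_fract quot_to_fract_def quot_to_fract_quot_of_fract split_beta)
  then have "to_fract (a * v) = to_fract (u * b)"
    using b v by (simp add: field_simps)
  then have "a * v = u * b" by (simp only: to_fract_eq_iff)
  then have "\<phi> a * \<phi> v = \<phi> u * \<phi> b" by (metis hom_mult)
  then show ?thesis
    using \<phi>_nonzero[OF b] \<phi>_nonzero[OF v] by (simp add: fract_ext_def flip: u_def v_def) (simp add: field_simps)
qed

lemma fract_ext_to_fract [simp]: "fract_ext \<phi> (to_fract a) = \<phi> a"
  using fract_ext_quot[of 1 a] by (simp add: hom_1)

lemma fract_ext_hom: "type_field_hom (fract_ext \<phi>)"
proof
  fix x y :: "'a fract"
  obtain a b where ab: "x = to_fract a / to_fract b" "b \<noteq> 0"
    using fract_as_quot by blast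
  obtain c d where cd: "y = to_fract c / to_fract d" "d \<noteq> 0"
    using fract_as_quot by blast
  have "x + y = to_fract (a * d + c * b) / to_fract (b * d)" "x * y = to_fract (a * c) / to_fract (b * d)"
    using ab cd by (auto simp: field_simps)
  then show "fract_ext \<phi> (x + y) = fract_ext \<phi> x + fract_ext \<phi> y"
    "fract_ext \<phi> (x * y) = fract_ext \<phi> x * fract_ext \<phi> y"
    unfolding ab(1) cd(1)
    using ab(2) cd(2) \<phi>_nonzero[of b] \<phi>_nonzero[of d] fract_ext_quot[of "b * d"]
    by (simp_all only: fract_ext_quot mult_eq_0_iff simp_thms) (simp_all add: hom_add hom_mult field_simps)
next
  show "fract_ext \<phi> 1 = 1" using fract_ext_to_fract[of 1] by (simp add: hom_1)
qed

end

section \<open>The function field of the curve\<close>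

lemma ring_of_type_algebra_simps:
  "carrier (ring_of_type_algebra :: 'b::comm_ring_1 ring) = UNIV"
  "(x :: 'b) \<otimes>\<^bsub>ring_of_type_algebra\<^esub> y = x * y" "\<one>\<^bsub>ring_of_type_algebra\<^esub> = (1 :: 'b)"
  "\<zero>\<^bsub>ring_of_type_algebra\<^esub> = (0 :: 'b)" "(x :: 'b) \<oplus>\<^bsub>ring_of_type_algebra\<^esub> y = x + y"
  by (simp_all add: ring_of_type_algebra_def)

definition curve_poly :: "nat \<Rightarrow> 'a::comm_ring_1 poly \<Rightarrow> 'a poly poly" where
  "curve_poly n G = Polynomial.monom (Polynomial.monom 1 n) 2 - [:G:]"

lemma curve_poly_altdef: "curve_poly n G = [:- G, 0, Polynomial.monom 1 n:]"
  by (simp add: curve_poly_def numeral_2_eq_2 monom_Suc monom_0)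

text \<open>The parity of the degrees shows that \<open>G / x\<^sup>n\<close> is not a square of a rational function.\<close>

locale odd_curve =
  fixes n :: nat and G :: "'a::{alg_closed_field,field_gcd} poly" and d :: nat
  assumes degG: "Polynomial.degree G = n + d" and odd_d: "odd d"
begin

abbreviation \<Phi> :: "'a poly fract poly" where "\<Phi> \<equiv> map_poly to_fract (curve_poly n G)"
abbreviation xn :: "'a poly fract" where "xn \<equiv> to_fract (Polynomial.monom 1 n)"
abbreviation gf :: "'a poly fract" where "gf \<equiv> to_fract G"

lemma G_nonzero: "G \<noteq> 0"
  using degG odd_d by (auto intro: ccontr)

lemma \<Phi>_eq: "\<Phi> = [:- gf, 0, xn:]"
  by (simp add: curve_poly_altdef map_poly_pCons)

lemma xn_nonzero: "xn \<noteq> 0"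
  by simp

lemma \<Phi>_nonzero: "\<Phi> \<noteq> 0"
  by (simp add: \<Phi>_eq)

lemma degree_\<Phi>: "Polynomial.degree \<Phi> = 2"
  by (simp add: \<Phi>_eq)

lemma norm_poly:
  assumes "a ^ 2 * Polynomial.monom 1 n = b ^ 2 * G"
  shows "a = 0 \<and> b = 0"
proof (cases "a = 0 \<or> b = 0")
  case True
  then show ?thesis using assms G_nonzero by auto
next
  case False
  then have "2 * Polynomial.degree a + n = 2 * Polynomial.degree b + (n + d)"
    using arg_cong[OF assms, of Polynomial.degree] G_nonzero
    by (simp add: degree_mult_eq degree_power_eq degree_monom_eq degG)
  then have "even d" by presburger
  then show ?thesis using odd_d by simp
qed

lemma norm_fract:
  assumes "A ^ 2 * xn = B ^ 2 * gf"
  shows "A = 0 \<and> B = 0"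
proof -
  obtain a b where ab: "A = to_fract a / to_fract b" "b \<noteq> 0"
    using fract_as_quot by blast
  obtain c e where ce: "B = to_fract c / to_fract e" "e \<noteq> 0"
    using fract_as_quot by blast
  have "to_fract ((a * e) ^ 2 * Polynomial.monom 1 n) = to_fract ((c * b) ^ 2 * G)"
    using assms ab ce by (simp add: field_simps power2_eq_square)
  then have "(a * e) ^ 2 * Polynomial.monom 1 n = (c * b) ^ 2 * G" by (simp only: to_fract_eq_iff)
  from norm_poly[OF this] show ?thesis using ab ce by auto
qed

text \<open>\<Phi> is quadratic in y, so every class has the form A + B y.\<close>

lemma linear_reduction:
  obtains A B where "\<Phi> dvd h - [:A, B:]"
proof -
  have "Polynomial.degree (h mod \<Phi>) < 2"
    using degree_mod_less[OF \<Phi>_nonzero, of h] degree_\<Phi> by auto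
  then have "h mod \<Phi> = [:Polynomial.coeff (h mod \<Phi>) 0, Polynomial.coeff (h mod \<Phi>) 1:]"
    by (intro poly_eqI) (auto simp: coeff_pCons coeff_eq_0 split: nat.splits)
  then show thesis using that by (metis dvd_minus_mod)
qed

lemma \<Phi>_dvd_linear: "\<Phi> dvd [:A, B:] \<longleftrightarrow> A = 0 \<and> B = 0"
proof
  assume "\<Phi> dvd [:A, B:]"
  then show "A = 0 \<and> B = 0"
    using dvd_imp_degree_le[of \<Phi> "[:A, B:]"] unfolding degree_\<Phi> by (cases "B = 0"; cases "A = 0") auto
qed simp

text \<open>The inverse of A + B y is the conjugate A - B y divided by the norm A^2 - B^2 G / x^n,
  which is nonzero because G / x^n is not a square.\<close>

lemma inverse_mod_\<Phi>:
  assumes "\<not> \<Phi> dvd h"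
  obtains k where "\<Phi> dvd h * k - 1"
proof -
  obtain A B where AB: "\<Phi> dvd h - [:A, B:]" using linear_reduction by blast
  have nz: "\<not> (A = 0 \<and> B = 0)" using AB assms by auto
  define M where "M = A ^ 2 - B ^ 2 * gf / xn"
  have M: "M \<noteq> 0"
  proof
    assume "M = 0"
    then have "A ^ 2 * xn = B ^ 2 * gf" using xn_nonzero by (simp add: M_def field_simps)
    then show False using norm_fract nz by blast
  qed
  define k where "k = Polynomial.smult (1 / M) [:A, - B:]"
  have "h * k - 1 = (h - [:A, B:]) * k + ([:A, B:] * k - 1)" by (simp add: algebra_simps)
  moreover have "[:A, B:] * k - 1 = \<Phi> * [:- (B ^ 2 / xn) / M:]"
  proof -
    have "A * A / M - 1 = gf * (B ^ 2 / xn) / M"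
      using M unfolding M_def by (simp add: field_simps power2_eq_square)
    moreover have "B * B / M = xn * (B ^ 2 / xn) / M"
      using xn_nonzero by (simp add: power2_eq_square)
    ultimately show ?thesis
      by (simp add: k_def \<Phi>_eq one_pCons)
  qed
  ultimately have "\<Phi> dvd h * k - 1" using AB by (metis dvd_add dvd_mult2 dvd_triv_left)
  then show thesis using that by blast
qed

abbreviation L where "L \<equiv> function_field (curve_poly n G)"
abbreviation cl where "cl \<equiv> ff_class (curve_poly n G)"

lemma curve_ideal_eq: "curve_ideal (curve_poly n G) = {h. \<Phi> dvd h}"
  unfolding curve_ideal_def cgenideal_def ring_of_type_algebra_simps by (auto simp: dvd_def mult.commute)

lemma ideal: "ideal (curve_ideal (curve_poly n G)) ring_of_type_algebra"
proof -
  interpret R: cring "ring_of_type_algebra :: 'a poly fract poly ring" by (rule cring_from_type_algebra)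
  show ?thesis unfolding curve_ideal_def by (rule R.cgenideal_ideal) (simp add: ring_of_type_algebra_simps)
qed

lemma cl_eq: "cl h = {k. \<Phi> dvd k - h}"
proof -
  have "(\<Phi> dvd k - h) \<longleftrightarrow> (\<exists>u. \<Phi> dvd u \<and> k = u + h)" for k
    by (metis add_diff_cancel_right' diff_add_cancel)
  then show ?thesis
    unfolding ff_class_def a_r_coset_def' curve_ideal_eq ring_of_type_algebra_simps by auto
qed

lemma cl_eq_iff: "cl h = cl k \<longleftrightarrow> \<Phi> dvd h - k"
proof
  assume "cl h = cl k"
  moreover have "h \<in> cl h" unfolding cl_eq by simp
  ultimately have "h \<in> cl k" by (simp only:)
  then show "\<Phi> dvd h - k" unfolding cl_eq by simp
next
  assume *: "\<Phi> dvd h - k"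
  have "\<Phi> dvd u - h \<longleftrightarrow> \<Phi> dvd u - k" for u
    using dvd_add_left_iff[OF *, of "u - h"] by (simp add: algebra_simps)
  then show "cl h = cl k" by (simp add: cl_eq)
qed

lemma cl_hom: "cl \<in> ring_hom ring_of_type_algebra L"
  unfolding ff_class_def function_field_def by (rule ideal.rcos_ring_hom[OF ideal])

lemma cl_simps: "cl (h + k) = cl h \<oplus>\<^bsub>L\<^esub> cl k" "cl (h * k) = cl h \<otimes>\<^bsub>L\<^esub> cl k" "cl 1 = \<one>\<^bsub>L\<^esub>" "cl 0 = \<zero>\<^bsub>L\<^esub>"
proof -
  interpret R: cring "ring_of_type_algebra :: 'a poly fract poly ring" by (rule cring_from_type_algebra)
  show "cl (h + k) = cl h \<oplus>\<^bsub>L\<^esub> cl k" "cl (h * k) = cl h \<otimes>\<^bsub>L\<^esub> cl k" "cl 1 = \<one>\<^bsub>L\<^esub>"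
    using ring_hom_add[OF cl_hom, of h k] ring_hom_mult[OF cl_hom, of h k] ring_hom_one[OF cl_hom]
    by (auto simp: ring_of_type_algebra_simps)
  show "cl 0 = \<zero>\<^bsub>L\<^esub>"
    unfolding cl_eq function_field_def FactRing_def curve_ideal_eq by simp
qed

lemma carrier_L: "carrier L = range cl"
  unfolding function_field_def FactRing_def A_RCOSETS_def' ff_class_def ring_of_type_algebra_simps by auto

lemma cl_closed [simp]: "cl h \<in> carrier L"
  by (simp add: carrier_L)

lemma field_L: "field L"
proof -
  have cr: "cring L" unfolding function_field_def
    by (rule ideal.quotient_is_cring[OF ideal cring_from_type_algebra])
  interpret cring L by (rule cr)
  have "Units L = carrier L - {\<zero>\<^bsub>L\<^esub>}"
  proof
    have "\<not> \<Phi> dvd 1" using dvd_imp_degree_le[of \<Phi> 1] degree_\<Phi> by auto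
    then have "\<one>\<^bsub>L\<^esub> \<noteq> \<zero>\<^bsub>L\<^esub>" unfolding cl_simps(3,4)[symmetric] cl_eq_iff by simp
    then show "Units L \<subseteq> carrier L - {\<zero>\<^bsub>L\<^esub>}"
      by (auto simp: Units_def)
    show "carrier L - {\<zero>\<^bsub>L\<^esub>} \<subseteq> Units L"
    proof
      fix u assume "u \<in> carrier L - {\<zero>\<^bsub>L\<^esub>}"
      then obtain h where h: "u = cl h" "\<not> \<Phi> dvd h"
        unfolding carrier_L cl_simps(4)[symmetric] using cl_eq_iff[of _ 0] by auto
      then obtain k where "\<Phi> dvd h * k - 1" using inverse_mod_\<Phi> by blast
      then have "u \<otimes>\<^bsub>L\<^esub> cl k = \<one>\<^bsub>L\<^esub>"
        unfolding h cl_simps(2)[symmetric] cl_simps(3)[symmetric] cl_eq_iff .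
      then show "u \<in> Units L" using h m_comm[of u "cl k"] by (auto simp: Units_def)
    qed
  qed
  then show ?thesis by (rule cring_fieldI)
qed

end

lemma closed_field_hom_fls_const: "closed_field_hom (fls_const :: 'a::alg_closed_field \<Rightarrow> 'a fls)"
  by unfold_locales (simp_all flip: fls_plus_const)

interpretation fc: closed_field_hom "fls_const :: 'a::alg_closed_field \<Rightarrow> 'a fls"
  by (rule closed_field_hom_fls_const)

subsection \<open>Points of the curve over a field of Laurent series\<close>

text \<open>A nonconstant U is transcendental over K, so a point (U, V) determines an embedding x ->
  U, y -> V of the function field into Laurent series; \<Theta> is this map before passing to
  classes.\<close>

locale curve_point = odd_curve n G d
  for n :: nat and G :: "'a::{alg_closed_field,field_gcd} poly" and d :: nat +
  fixes U V :: "'a fls"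
  assumes UV: "U ^ n * V ^ 2 = fc.ev U G" and nonconst: "U \<notin> range fls_const"
begin

lemma ev_inj_hom: "inj_hom (fc.ev U)"
proof -
  interpret type_ring_hom "fc.ev U" by (rule fc.ev_hom)
  show ?thesis by unfold_locales (simp add: fc.transcendental[OF nonconst])
qed

sublocale E: inj_hom "fc.ev U" by (rule ev_inj_hom)

definition femb :: "'a poly fract \<Rightarrow> 'a fls" where "femb = fract_ext (fc.ev U)"

lemma femb_to_fract [simp]: "femb (to_fract p) = fc.ev U p"
  by (simp add: femb_def)

sublocale Fe: type_field_hom femb
  unfolding femb_def by (rule E.fract_ext_hom)

definition \<Theta> :: "'a poly fract poly \<Rightarrow> 'a fls" where "\<Theta> = Fe.ev V"

sublocale T: type_ring_hom \<Theta>
  unfolding \<Theta>_def by (rule Fe.ev_hom)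

lemma \<Theta>_pCons: "\<Theta> (pCons u p) = femb u + V * \<Theta> p"
  by (simp add: \<Theta>_def Fe.ev_pCons)

lemma \<Theta>_\<Phi>: "\<Theta> \<Phi> = 0"
  using UV by (simp add: \<Phi>_eq \<Theta>_pCons T.hom_0 Fe.hom_0 Fe.hom_uminus fc.ev_monom power2_eq_square algebra_simps)

text \<open>The kernel is no larger than the ideal: if a linear representative u + v y vanishes,
  squaring gives u^2 x^n = v^2 G, so u = v = 0.\<close>

lemma \<Theta>_eq_0_iff: "\<Theta> h = 0 \<longleftrightarrow> \<Phi> dvd h"
proof
  assume "\<Phi> dvd h"
  then show "\<Theta> h = 0" using \<Theta>_\<Phi> by (auto simp: T.hom_mult elim!: dvdE)
next
  assume 0: "\<Theta> h = 0"
  obtain u v where uv: "\<Phi> dvd h - [:u, v:]" using linear_reduction by blast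
  then have "\<Theta> (h - [:u, v:]) = 0" using \<Theta>_\<Phi> by (auto simp: T.hom_mult elim!: dvdE)
  then have "\<Theta> [:u, v:] = 0" unfolding T.hom_diff 0 by simp
  then have "femb u + V * femb v = 0" by (simp add: \<Theta>_pCons T.hom_0)
  then have "femb u = - (V * femb v)" by (metis eq_neg_iff_add_eq_0)
  then have "femb u ^ 2 * U ^ n = femb v ^ 2 * (U ^ n * V ^ 2)" by (simp add: power_mult_distrib mult_ac)
  also have "\<dots> = femb (v ^ 2 * gf)" by (simp add: UV Fe.hom_mult Fe.hom_power)
  also have "femb u ^ 2 * U ^ n = femb (u ^ 2 * xn)" by (simp add: Fe.hom_mult Fe.hom_power fc.ev_monom)
  finally have "u ^ 2 * xn = v ^ 2 * gf" using Fe.inj by (auto dest: injD)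
  then have "u = 0 \<and> v = 0" by (rule norm_fract)
  then show "\<Phi> dvd h" using uv by simp
qed

lemma \<Theta>_eq_iff: "\<Theta> h = \<Theta> k \<longleftrightarrow> cl h = cl k"
  unfolding cl_eq_iff \<Theta>_eq_0_iff[symmetric] by (simp add: T.hom_diff)

end

text \<open>The slope s of the line joining (\<alpha>, \<beta>) to (U, V) is the image of the
  generator t of F.\<close>

locale projected_curve_point = curve_point n G d U V
  for n G d and U V :: "'a::{alg_closed_field,field_gcd} fls" +
  fixes \<alpha> \<beta> :: 'a and s :: "'a fls"
  assumes V: "V = fls_const \<beta> + s * (U - fls_const \<alpha>)" and s: "s \<notin> range fls_const"
    and n: "n \<noteq> 0" and d3: "3 \<le> d" and G0: "poly G 0 \<noteq> 0" and G\<alpha>: "\<alpha> ^ n * \<beta> ^ 2 \<noteq> poly G \<alpha>"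
begin

abbreviation const :: "'a \<Rightarrow> 'a poly fract poly" where "const c \<equiv> [:to_fract [:c:]:]"
abbreviation xv :: "'a poly fract poly" where "xv \<equiv> [:to_fract [:0, 1:]:]"
abbreviation yv :: "'a poly fract poly" where "yv \<equiv> [:0, 1:]"
abbreviation xa :: "'a poly fract" where "xa \<equiv> to_fract [:- \<alpha>, 1:]"

definition tv :: "'a poly fract poly" where
  "tv = [:inverse xa:] * (yv - const \<beta>)"

lemma \<Theta>_const: "\<Theta> (const c) = fls_const c"
  by (simp add: \<Theta>_pCons T.hom_0 fc.ev_pCons)

lemma \<Theta>_xv: "\<Theta> xv = U"
  by (simp add: \<Theta>_pCons T.hom_0 fc.ev_pCons)

lemma \<Theta>_yv: "\<Theta> yv = V"
  by (simp add: \<Theta>_pCons T.hom_0 Fe.hom_0 Fe.hom_1)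

lemma U_\<alpha>: "U - fls_const \<alpha> \<noteq> 0"
  using nonconst by auto

lemma femb_xa: "femb xa = U - fls_const \<alpha>"
  by (simp add: fc.ev_pCons fc.hom_uminus)

lemma \<Theta>_tv: "\<Theta> tv = s"
proof -
  have "\<Theta> [:inverse xa:] = inverse (U - fls_const \<alpha>)"
    using femb_xa by (simp add: \<Theta>_pCons T.hom_0 Fe.hom_inverse)
  moreover have "V - fls_const \<beta> = s * (U - fls_const \<alpha>)" using V by simp
  ultimately show ?thesis
    using U_\<alpha> unfolding tv_def T.hom_mult T.hom_diff \<Theta>_const \<Theta>_yv by simp
qed

sublocale L: field L by (rule field_L)

lemma cl_diff: "cl (h - k) = cl h \<ominus>\<^bsub>L\<^esub> cl k"
proof -
  have "cl h = cl (h - k) \<oplus>\<^bsub>L\<^esub> cl k" unfolding cl_simps(1)[symmetric] by simp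
  then have "cl h \<ominus>\<^bsub>L\<^esub> cl k = (cl (h - k) \<oplus>\<^bsub>L\<^esub> cl k) \<ominus>\<^bsub>L\<^esub> cl k" by simp
  then show ?thesis by (simp add: L.minus_eq L.a_assoc L.r_neg)
qed

lemma cl_uminus: "cl (- h) = \<ominus>\<^bsub>L\<^esub> cl h"
  using cl_diff[of 0 h] by (simp add: cl_simps L.minus_eq)

abbreviation F where "F \<equiv> projection_subfield (curve_poly n G) \<alpha> \<beta>"

lemma F_eq: "F = generate_field L (insert (cl tv) (range (\<lambda>c. cl (const c))))"
proof -
  have "cl (xv - const \<alpha>) \<otimes>\<^bsub>L\<^esub> cl [:inverse xa:] = \<one>\<^bsub>L\<^esub>"
  proof -
    have "xv - const \<alpha> = [:xa:]" by (simp flip: to_fract_diff)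
    then have "(xv - const \<alpha>) * [:inverse xa:] = 1" by (simp add: one_pCons)
    then show ?thesis unfolding cl_simps(2,3)[symmetric] by simp
  qed
  then have "inv\<^bsub>L\<^esub> (cl (xv - const \<alpha>)) = cl [:inverse xa:]"
    using L.comm_inv_char[of "cl (xv - const \<alpha>)" "cl [:inverse xa:]"] by simp
  then have "cl tv = (cl yv \<ominus>\<^bsub>L\<^esub> cl (const \<beta>)) \<otimes>\<^bsub>L\<^esub> inv\<^bsub>L\<^esub> (cl xv \<ominus>\<^bsub>L\<^esub> cl (const \<alpha>))"
    by (simp only: tv_def cl_simps(2) cl_diff) (simp add: L.m_comm)
  then show ?thesis
    unfolding projection_subfield_def Let_def ff_y_def ff_x_def ff_const_def by simp
qed

lemma F_subset: "F \<subseteq> carrier L"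
  unfolding F_eq by (rule L.generate_field_incl) (auto simp: carrier_L)

lemma F_gens: "cl tv \<in> F" "cl (const c) \<in> F"
  unfolding F_eq by (auto intro: generate_field.incl)

text \<open>Membership in K(s), with the denominator cleared.\<close>

definition rational_in_s :: "'a fls \<Rightarrow> bool" where
  "rational_in_s z \<longleftrightarrow> (\<exists>P Q. Q \<noteq> 0 \<and> z * fc.ev s Q = fc.ev s P)"

lemma F_rational: "c \<in> F \<Longrightarrow> \<exists>h. c = cl h \<and> rational_in_s (\<Theta> h)"
  unfolding F_eq
proof (induction rule: generate_field.induct)
  case one
  show ?case
    by (rule exI[of _ 1], unfold rational_in_s_def cl_simps T.hom_1)
      (auto intro!: exI[of _ 1])
next
  case (incl h)
  then consider "h = cl tv" | c where "h = cl (const c)" by auto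
  then show ?case
  proof cases
    case 1
    moreover have "rational_in_s (\<Theta> tv)"
      unfolding rational_in_s_def \<Theta>_tv
      by (intro exI[of _ "[:0, 1:]"] exI[of _ 1]) (simp add: fc.ev_1 fc.ev_pCons)
    ultimately show ?thesis by blast
  next
    case (2 c)
    moreover have "rational_in_s (\<Theta> (const c))"
      unfolding rational_in_s_def \<Theta>_const
      by (intro exI[of _ "[:c:]"] exI[of _ 1]) (simp add: fc.ev_1 fc.ev_pCons)
    ultimately show ?thesis by blast
  qed
next
  case (a_inv u)
  then obtain h P Q where h: "u = cl h" "Q \<noteq> 0" "\<Theta> h * fc.ev s Q = fc.ev s P" by (auto simp: rational_in_s_def)
  have "fc.ev s (- P) = - fc.ev s P" using type_ring_hom.hom_uminus[OF fc.ev_hom] .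
  then have "rational_in_s (\<Theta> (- h))"
    unfolding rational_in_s_def T.hom_uminus using h by (intro exI[of _ "- P"] exI[of _ Q]) simp
  then show ?case using h cl_uminus by metis
next
  case (m_inv u)
  then obtain h P Q where h: "u = cl h" "Q \<noteq> 0" "\<Theta> h * fc.ev s Q = fc.ev s P" by (auto simp: rational_in_s_def)
  have nd: "\<not> \<Phi> dvd h" using m_inv(2) h cl_eq_iff[of h 0] by (simp add: cl_simps)
  then obtain k where k: "\<Phi> dvd h * k - 1" using inverse_mod_\<Phi> by blast
  then have "\<Theta> (h * k - 1) = 0" by (simp add: \<Theta>_eq_0_iff)
  then have hk: "\<Theta> h * \<Theta> k = 1" by (simp add: T.hom_diff T.hom_mult T.hom_1)
  have "\<Theta> k * fc.ev s P = fc.ev s Q"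
    unfolding h(3)[symmetric] using hk by (metis mult.assoc mult.commute mult_1)
  moreover have "P \<noteq> 0"
    using h fc.transcendental[OF s, of Q] hk by auto
  ultimately have "rational_in_s (\<Theta> k)" by (auto simp: rational_in_s_def)
  moreover have "u \<otimes>\<^bsub>L\<^esub> cl k = \<one>\<^bsub>L\<^esub>"
    unfolding h cl_simps(2)[symmetric] cl_simps(3)[symmetric] cl_eq_iff by (rule k)
  then have "inv\<^bsub>L\<^esub> u = cl k" using L.comm_inv_char[of u "cl k"] h by simp
  ultimately show ?case by blast
next
  case (eng_add u v)
  then obtain h P Q k P' Q' where h: "u = cl h" "Q \<noteq> 0" "\<Theta> h * fc.ev s Q = fc.ev s P"
    "v = cl k" "Q' \<noteq> 0" "\<Theta> k * fc.ev s Q' = fc.ev s P'" by (auto simp: rational_in_s_def)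
  have "\<Theta> (h + k) * fc.ev s (Q * Q') = fc.ev s (P * Q' + P' * Q)"
    by (simp add: T.hom_add fc.ev_mult fc.ev_add flip: h(3,6)) (simp add: algebra_simps)
  then have "rational_in_s (\<Theta> (h + k))" unfolding rational_in_s_def using h(2,5) by (metis mult_eq_0_iff)
  then show ?case unfolding h(1,4) cl_simps(1)[symmetric] by blast
next
  case (eng_mult u v)
  then obtain h P Q k P' Q' where h: "u = cl h" "Q \<noteq> 0" "\<Theta> h * fc.ev s Q = fc.ev s P"
    "v = cl k" "Q' \<noteq> 0" "\<Theta> k * fc.ev s Q' = fc.ev s P'" by (auto simp: rational_in_s_def)
  have "\<Theta> (h * k) * fc.ev s (Q * Q') = fc.ev s (P * P')"
    by (simp add: T.hom_mult fc.ev_mult flip: h(3,6))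
  then have "rational_in_s (\<Theta> (h * k))" unfolding rational_in_s_def using h(2,5) by (metis mult_eq_0_iff)
  then show ?case unfolding h(1,4) cl_simps(2)[symmetric] by blast
qed

text \<open>The coefficients of \<open>x\<^sup>n (\<beta> + t (x - \<alpha>))\<^sup>2 - G(x)\<close> as a polynomial in \<open>t\<close>.\<close>

definition H0 :: "'a poly" where "H0 = Polynomial.monom 1 n * [:\<beta> ^ 2:] - G"
definition H1 :: "'a poly" where "H1 = Polynomial.monom 1 n * [:2 * \<beta>:] * [:- \<alpha>, 1:]"
definition H2 :: "'a poly" where "H2 = Polynomial.monom 1 n * [:- \<alpha>, 1:] ^ 2"
definition Ht :: "'a poly poly" where "Ht = [:H0, H1, H2:]"

lemma degree_H: "Polynomial.degree H0 = n + d" "Polynomial.degree H1 < n + d" "Polynomial.degree H2 < n + d"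
proof -
  have "Polynomial.degree (Polynomial.monom (1::'a) n * [:\<beta> ^ 2:]) \<le> n"
    using degree_mult_le[of "Polynomial.monom (1::'a) n" "[:\<beta> ^ 2:]"] by (simp add: degree_monom_eq)
  then have "Polynomial.degree (Polynomial.monom (1::'a) n * [:\<beta> ^ 2:]) < Polynomial.degree G"
    using degG d3 by linarith
  then show "Polynomial.degree H0 = n + d"
    unfolding H0_def diff_conv_add_uminus using degG by (subst degree_add_eq_right) auto
  have "Polynomial.degree (Polynomial.monom (1::'a) n * [:2 * \<beta>:] * [:- \<alpha>, 1:]) \<le> n + 1"
    using degree_mult_le[of "Polynomial.monom (1::'a) n * [:2 * \<beta>:]" "[:- \<alpha>, 1:]"]
      degree_mult_le[of "Polynomial.monom (1::'a) n" "[:2 * \<beta>:]"] by (simp add: degree_monom_eq)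
  then show "Polynomial.degree H1 < n + d" unfolding H1_def using d3 by linarith
  have "Polynomial.degree (Polynomial.monom (1::'a) n * [:- \<alpha>, 1:] ^ 2) \<le> n + 2"
    using degree_mult_le[of "Polynomial.monom (1::'a) n" "[:- \<alpha>, 1:] ^ 2"]
    by (simp add: degree_monom_eq degree_power_eq)
  then show "Polynomial.degree H2 < n + d" unfolding H2_def using d3 by linarith
qed

lemma H2_nonzero: "H2 \<noteq> 0"
  by (simp add: H2_def)

text \<open>A nonconstant common factor of the coefficients would share a root with H2, that is 0 or
  \<alpha>. There H0 takes the values -G(0) and \<alpha>^n \<beta>^2 - G(\<alpha>), both nonzero,
  the latter because (\<alpha>, \<beta>) is off the curve.\<close>

lemma content_Ht: "content Ht = 1"
proof -
  define c where "c = content Ht"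
  have dvd: "c dvd H0" "c dvd H2"
    unfolding c_def using content_dvd_coeff[of Ht 0] content_dvd_coeff[of Ht 2]
    by (simp_all add: Ht_def numeral_2_eq_2)
  have "c \<noteq> 0" unfolding c_def using H2_nonzero by (simp add: Ht_def)
  have "Polynomial.degree c = 0"
  proof (rule ccontr)
    assume "Polynomial.degree c \<noteq> 0"
    then obtain z where z: "poly c z = 0" using alg_closed_imp_poly_has_root[of c] by auto
    then have "poly H0 z = 0" "poly H2 z = 0" using dvd by (auto elim!: dvdE)
    then show False using n G0 G\<alpha> by (auto simp: H0_def H2_def poly_monom power_0_left mult.commute)
  qed
  then have "is_unit c" using \<open>c \<noteq> 0\<close> by (simp add: is_unit_iff_degree)
  then show ?thesis using is_unit_normalize[of c] by (simp add: c_def)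
qed

lemma ev_Ht: "E.ev s Ht = 0"
proof -
  have e0: "fc.ev U H0 = U ^ n * fls_const \<beta> ^ 2 - fc.ev U G"
    unfolding H0_def by (simp add: E.hom_diff fc.ev_smult fc.ev_monom fc.hom_power mult.commute)
  have e1: "fc.ev U H1 = U ^ n * (2 * fls_const \<beta>) * (U - fls_const \<alpha>)"
    unfolding H1_def fc.ev_mult fc.ev_monom
    by (simp add: fc.ev_pCons fc.hom_mult fc.hom_uminus algebra_simps flip: mult_2)
  have e2: "fc.ev U H2 = U ^ n * (U - fls_const \<alpha>) ^ 2"
    unfolding H2_def fc.ev_mult fc.ev_monom E.hom_power by (simp add: fc.ev_pCons fc.hom_uminus)
  have "E.ev s Ht = U ^ n * V ^ 2 - fc.ev U G"
    unfolding Ht_def E.ev_pCons e0 e1 e2 V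
    by (simp add: power2_eq_square algebra_simps del: fls_const_mult_const)
  then show ?thesis using UV by simp
qed

lemma Fe_ev_fract_poly: "Fe.ev z (map_poly to_fract p) = E.ev z p"
  by (induction p) (auto simp: map_poly_pCons Fe.ev_pCons E.ev_pCons)

text \<open>Ht generates the relations of s over K[x]. Over K(x) a relation u + v s = 0 of degree
  below 2 becomes, with s = (y - \<beta>) / (x - \<alpha>), a linear relation for y and is trivial;
  Gauss's lemma for content 1 leads back from K(x) to K[x].\<close>

lemma Ht_dvd:
  assumes "E.ev s B = 0"
  shows "Ht dvd B"
proof -
  let ?H = "map_poly to_fract Ht" and ?B = "map_poly to_fract B"
  have deg: "Polynomial.degree ?H = 2" using H2_nonzero by (simp add: Ht_def map_poly_pCons)
  then have H: "?H \<noteq> 0" by auto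
  have "Polynomial.degree (?B mod ?H) < 2"
    using degree_mod_less[OF H, of ?B] deg by auto
  then have "?B mod ?H = [:Polynomial.coeff (?B mod ?H) 0, Polynomial.coeff (?B mod ?H) 1:]"
    by (intro poly_eqI) (auto simp: coeff_pCons coeff_eq_0 split: nat.splits)
  then obtain u v where uv: "?B mod ?H = [:u, v:]" by blast
  have "?B = ?B div ?H * ?H + ?B mod ?H" by (rule div_mult_mod_eq[symmetric])
  then have "Fe.ev s ?B = Fe.ev s (?B div ?H) * Fe.ev s ?H + Fe.ev s (?B mod ?H)"
    by (metis Fe.ev_add Fe.ev_mult)
  then have "Fe.ev s [:u, v:] = 0"
    using assms ev_Ht uv by (simp add: Fe_ev_fract_poly)
  then have 1: "femb u + s * femb v = 0" by (simp add: Fe.ev_pCons)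
  have "femb (to_fract [:\<beta>:]) = fls_const \<beta>" by (simp add: fc.ev_pCons)
  then have "\<Theta> [:u * xa - v * to_fract [:\<beta>:], v:]
      = femb u * (U - fls_const \<alpha>) - femb v * fls_const \<beta> + V * femb v"
    by (simp only: \<Theta>_pCons T.hom_0 Fe.hom_diff Fe.hom_mult femb_xa mult_zero_right add_0_right)
  also have "\<dots> = (femb u + s * femb v) * (U - fls_const \<alpha>)"
    by (subst V) (simp add: algebra_simps)
  finally have "\<Phi> dvd [:u * xa - v * to_fract [:\<beta>:], v:]"
    using 1 by (simp add: \<Theta>_eq_0_iff[symmetric])
  then have "v = 0" "u * xa - v * to_fract [:\<beta>:] = 0" unfolding \<Phi>_dvd_linear by auto
  then have "u = 0" "v = 0" by auto
  then have "?H dvd ?B" using uv by (simp add: mod_eq_0_iff_dvd)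
  then show ?thesis using content_Ht by (rule fract_poly_dvdD)
qed

text \<open>Among the coefficients of Ht only H0 has degree n + d in x. At a power of t where the
  coefficient of C has the largest degree, the product with H0 therefore survives.\<close>

lemma Ht_multiple_degree:
  assumes "C \<noteq> 0"
  obtains j where "n + d \<le> Polynomial.degree (Polynomial.coeff (Ht * C) j)"
proof -
  define J where "J = {j. Polynomial.coeff C j \<noteq> 0}"
  have "J \<subseteq> {..Polynomial.degree C}" by (auto simp: J_def le_degree)
  then have fin: "finite J" by (rule finite_subset) simp
  have ne: "J \<noteq> {}" using assms by (auto simp: J_def poly_eq_iff)
  define D where "D = Max ((\<lambda>j. Polynomial.degree (Polynomial.coeff C j)) ` J)"
  have D: "Polynomial.degree (Polynomial.coeff C i) \<le> D" for i
  proof (cases "i \<in> J")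
    case True
    then show ?thesis unfolding D_def using fin by (intro Max_ge) auto
  qed (simp add: J_def)
  have "D \<in> (\<lambda>j. Polynomial.degree (Polynomial.coeff C j)) ` J"
    unfolding D_def using fin ne by (intro Max_in) auto
  then obtain j where j: "Polynomial.coeff C j \<noteq> 0" "Polynomial.degree (Polynomial.coeff C j) = D"
    by (auto simp: J_def)
  define c1 where "c1 = (case j of 0 \<Rightarrow> 0 | Suc i \<Rightarrow> Polynomial.coeff C i)"
  define c2 where "c2 = (case j of Suc (Suc i) \<Rightarrow> Polynomial.coeff C i | _ \<Rightarrow> 0)"
  have c: "Polynomial.degree c1 \<le> D" "Polynomial.degree c2 \<le> D"
    using D by (auto simp: c1_def c2_def split: nat.splits)
  have "Polynomial.coeff (Ht * C) j = H0 * Polynomial.coeff C j + (H1 * c1 + H2 * c2)"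
    by (simp add: Ht_def coeff_pCons c1_def c2_def split: nat.splits)
  moreover have "H0 \<noteq> 0" using degree_H(1) d3 by (auto simp: odd_d)
  then have "Polynomial.degree (H0 * Polynomial.coeff C j) = n + d + D"
    using j degree_H(1) by (simp add: degree_mult_eq)
  moreover have "Polynomial.degree (H1 * c1) < n + d + D" "Polynomial.degree (H2 * c2) < n + d + D"
    using degree_mult_le[of H1 c1] degree_mult_le[of H2 c2] degree_H c by linarith+
  then have "Polynomial.degree (H1 * c1 + H2 * c2) < n + d + D" by (rule degree_add_less)
  ultimately have "Polynomial.degree (Polynomial.coeff (Ht * C) j) = n + d + D"
    by (simp add: degree_add_eq_left)
  then show thesis using that[of j] by simp
qed

text \<open>So x has degree at least n + d over K(s). Cleared of denominators and read as a
  polynomial in t over K[x], a relation for x is a multiple of Ht, and such a multiple has degree at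
  least n + d in x.\<close>

lemma minimal_degree:
  fixes Q :: "'a fls poly"
  assumes Q: "\<And>i. rational_in_s (Polynomial.coeff Q i)" "Q \<noteq> 0" "poly Q U = 0"
  shows "n + d \<le> Polynomial.degree Q"
proof (rule ccontr)
  assume lt: "\<not> ?thesis"
  define k where "k = Polynomial.degree Q"
  obtain P R where PR: "\<And>i. R i \<noteq> 0 \<and> Polynomial.coeff Q i * fc.ev s (R i) = fc.ev s (P i)"
    using Q(1) unfolding rational_in_s_def by metis
  define M where "M = (\<Prod>i\<le>k. R i)"
  define p where "p i = P i * (\<Prod>j\<in>{..k} - {i}. R j)" for i
  have M: "M \<noteq> 0" using PR by (simp add: M_def)
  have p: "fc.ev s (p i) = fc.ev s M * Polynomial.coeff Q i" if "i \<le> k" for i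
  proof -
    have "M = R i * (\<Prod>j\<in>{..k} - {i}. R j)" unfolding M_def using that by (simp add: prod.remove)
    then show ?thesis using PR[of i] by (simp add: p_def fc.ev_mult mult_ac flip: PR)
  qed
  \<comment> \<open>The relation with the roles of the variables exchanged: the outer variable is t,
    the inner one x.\<close>
  define B where "B = (\<Sum>i\<le>k. map_poly (\<lambda>c. Polynomial.monom c i) (p i))"
  have ev1: "E.ev s (map_poly (\<lambda>c. Polynomial.monom c i) q) = U ^ i * fc.ev s q" for i q
    by (induction q) (auto simp: map_poly_pCons E.ev_pCons fc.ev_pCons fc.ev_monom algebra_simps)
  have "E.ev s B = (\<Sum>i\<le>k. U ^ i * fc.ev s (p i))"
    unfolding B_def by (simp add: type_ring_hom.hom_sum[OF E.ev_hom] ev1)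
  also have "\<dots> = fc.ev s M * (\<Sum>i\<le>k. Polynomial.coeff Q i * U ^ i)"
    by (simp add: p sum_distrib_left mult_ac)
  also have "\<dots> = 0" using Q(3) by (simp add: poly_altdef k_def)
  finally obtain C where C: "B = Ht * C" using Ht_dvd by (auto elim: dvdE)
  have cB: "Polynomial.coeff (Polynomial.coeff B j) l = (if l \<le> k then Polynomial.coeff (p l) j else 0)" for j l
    unfolding B_def by (simp add: coeff_sum coeff_map_poly)
  have "fc.ev s M * Polynomial.coeff Q k \<noteq> 0"
    using M Q(2) fc.transcendental[OF s, of M] by (simp add: k_def)
  then have "p k \<noteq> 0" using p[of k] by auto
  then obtain j where "Polynomial.coeff (p k) j \<noteq> 0" by (auto simp: poly_eq_iff)
  then have "B \<noteq> 0" using cB[of j k] by auto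
  then have "C \<noteq> 0" using C by auto
  then obtain j where "n + d \<le> Polynomial.degree (Polynomial.coeff B j)"
    using Ht_multiple_degree C by metis
  moreover have "Polynomial.degree (Polynomial.coeff B j) \<le> k"
    using cB by (intro degree_le) auto
  ultimately show False using lt by (simp add: k_def)
qed

end

section \<open>Homomorphisms applied to coefficients, and Hensel's lemma by reduction\<close>

context type_ring_hom
begin

lemma coeff_map_hom: "Polynomial.coeff (map_poly \<kappa> p) i = \<kappa> (Polynomial.coeff p i)"
  by (simp add: coeff_map_poly hom_0)

lemma hom_of_nat: "\<kappa> (of_nat k) = of_nat k"
  by (induction k) (auto simp: hom_0 hom_1 hom_add)

lemma map_poly_hom: "type_ring_hom (map_poly \<kappa>)"
proof
  fix p q
  show "map_poly \<kappa> (p + q) = map_poly \<kappa> p + map_poly \<kappa> q"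
    by (rule poly_eqI) (simp add: coeff_map_hom hom_add)
  show "map_poly \<kappa> (p * q) = map_poly \<kappa> p * map_poly \<kappa> q"
    by (rule poly_eqI) (simp add: coeff_map_hom coeff_mult hom_sum hom_mult)
  show "map_poly \<kappa> 1 = 1"
    by (rule poly_eqI) (simp add: coeff_map_hom hom_0 hom_1)
qed

lemma map_poly_hom_pCons: "map_poly \<kappa> (pCons a p) = pCons (\<kappa> a) (map_poly \<kappa> p)"
  by (rule poly_eqI) (auto simp: coeff_map_hom coeff_pCons split: nat.splits)

lemma map_poly_hom_monom: "map_poly \<kappa> (Polynomial.monom c k) = Polynomial.monom (\<kappa> c) k"
  by (rule poly_eqI) (auto simp: coeff_map_hom hom_0)

lemma map_poly_hom_pcompose: "map_poly \<kappa> (pcompose p q) = pcompose (map_poly \<kappa> p) (map_poly \<kappa> q)"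
proof -
  interpret M: type_ring_hom "map_poly \<kappa>" by (rule map_poly_hom)
  show ?thesis
    by (induction p) (auto simp: pcompose_pCons map_poly_hom_pCons M.hom_add M.hom_mult)
qed

lemma hom_poly: "\<kappa> (poly p z) = poly (map_poly \<kappa> p) (\<kappa> z)"
  by (induction p) (auto simp: hom_0 hom_add hom_mult map_poly_hom_pCons)

end

lemma map_poly_hom_pderiv:
  fixes \<kappa> :: "'a::idom \<Rightarrow> 'b::idom"
  assumes "type_ring_hom \<kappa>"
  shows "map_poly \<kappa> (pderiv p) = pderiv (map_poly \<kappa> p)"
proof -
  interpret type_ring_hom \<kappa> by (rule assms)
  show ?thesis
    by (rule poly_eqI)
      (simp only: coeff_map_hom coeff_pderiv hom_mult hom_of_nat)
qed

lemma nth0_hom: "type_ring_hom (\<lambda>f :: 'a::comm_ring_1 fps. fps_nth f 0)"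
  by unfold_locales auto

lemma fps_const_hom: "type_ring_hom (fps_const :: 'a::comm_ring_1 \<Rightarrow> 'a fps)"
  by unfold_locales (simp_all flip: fps_const_add)

lemma fps_to_fls_hom: "type_ring_hom (fps_to_fls :: 'a::comm_ring_1 fps \<Rightarrow> 'a fls)"
  by unfold_locales (simp_all add: fls_times_fps_to_fls)

lemma id_hom: "type_ring_hom (\<lambda>x :: 'a::comm_ring_1. x)"
  by unfold_locales simp_all

interpretation nth0: type_ring_hom "\<lambda>f :: 'a::comm_ring_1 fps. fps_nth f 0" by (rule nth0_hom)
interpretation fpc: type_ring_hom "fps_const :: 'a::comm_ring_1 \<Rightarrow> 'a fps" by (rule fps_const_hom)
interpretation f2l: type_ring_hom "fps_to_fls :: 'a::comm_ring_1 fps \<Rightarrow> 'a fls" by (rule fps_to_fls_hom)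

lemma f2l_fpc_ev: "fps_to_fls (fpc.ev z p) = fc.ev (fps_to_fls z) p"
  by (induction p) (auto simp: fpc.ev_pCons fc.ev_pCons f2l.hom_add f2l.hom_mult)

lemma hensel_fps:
  fixes P :: "'a::field fps poly"
  assumes "poly (map_poly (\<lambda>f. fps_nth f 0) P) c = 0" "poly (pderiv (map_poly (\<lambda>f. fps_nth f 0) P)) c \<noteq> 0"
  obtains z where "poly P z = 0" "fps_nth z 0 = c"
proof (rule hensel_fps_const[of P c])
  show "fps_nth (poly P (fps_const c)) 0 = 0"
    using assms(1) by (simp add: nth0.hom_poly)
  show "fps_nth (poly (pderiv P) (fps_const c)) 0 \<noteq> 0"
    using assms(2) by (simp add: nth0.hom_poly map_poly_hom_pderiv[OF nth0_hom])
qed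

lemma pcompose_const_right: "pcompose p [:c:] = [:poly p c:]"
  by (induction p) (auto simp: pcompose_pCons mult.commute)

lemma poly_pderiv_linear_mult:
  fixes q :: "'a::idom poly"
  shows "poly (pderiv ([:- c, 1:] * q)) c = poly q c"
  unfolding pderiv_mult by (simp add: pderiv_pCons)

text \<open>A root count: in degree N, with at least N - 1 distinct roots of which one is multiple,
  the multiplicities can only be 2, 1, ..., 1.\<close>

lemma one_double_root:
  fixes p :: "'a::field poly"
  assumes p: "p \<noteq> 0" and root: "poly p x0 = 0" "poly (pderiv p) x0 = 0"
    and card: "Polynomial.degree p - 1 \<le> card {x. poly p x = 0}"
  obtains q where "p = [:- x0, 1:] ^ 2 * q" "poly q x0 \<noteq> 0" "Suc (card {x. poly p x = 0}) = Polynomial.degree p"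
    "\<And>x. x \<noteq> x0 \<Longrightarrow> poly p x = 0 \<Longrightarrow> poly (pderiv p) x \<noteq> 0"
proof -
  obtain p1 where p1: "p = [:- x0, 1:] * p1" using root(1) by (auto simp: poly_eq_0_iff_dvd elim: dvdE)
  have "poly p1 x0 = 0" using root(2) unfolding p1 poly_pderiv_linear_mult .
  then obtain q where q: "p1 = [:- x0, 1:] * q" by (auto simp: poly_eq_0_iff_dvd elim: dvdE)
  have pq: "p = [:- x0, 1:] ^ 2 * q" unfolding p1 q by (simp only: power2_eq_square mult.assoc)
  then have q0: "q \<noteq> 0" using p by auto
  then have deg: "Polynomial.degree p = Polynomial.degree q + 2"
    unfolding pq by (simp add: degree_mult_eq degree_power_eq)
  let ?Z = "{x. poly p x = 0}" and ?Zq = "{x. poly q x = 0}"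
  have Z: "?Z = insert x0 ?Zq" unfolding pq by auto
  have fin: "finite ?Zq" using q0 by (rule poly_roots_finite)
  have le: "card ?Zq \<le> Polynomial.degree q" using q0 by (rule card_poly_roots_bound)
  have nr: "poly q x0 \<noteq> 0"
  proof
    assume "poly q x0 = 0"
    then have "?Z = ?Zq" using Z by auto
    then show False using le card deg by simp
  qed
  then have cZ: "card ?Z = Suc (card ?Zq)" unfolding Z using fin by simp
  then have cq: "card ?Zq = Polynomial.degree q" using le card deg by simp
  have simple: "poly (pderiv p) x \<noteq> 0" if x: "x \<noteq> x0" "poly p x = 0" for x
  proof
    assume d: "poly (pderiv p) x = 0"
    have qx: "poly q x = 0" using x unfolding pq by auto
    have "poly (pderiv p) x = (x - x0) ^ 2 * poly (pderiv q) x"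
      unfolding pq by (simp add: pderiv_mult qx)
    then have "poly (pderiv q) x = 0" using d x by simp
    obtain q1 where q1: "q = [:- x, 1:] * q1" using qx by (auto simp: poly_eq_0_iff_dvd elim: dvdE)
    have "poly q1 x = 0" using \<open>poly (pderiv q) x = 0\<close> unfolding q1 poly_pderiv_linear_mult .
    then have "?Zq = {x. poly q1 x = 0}" unfolding q1 by auto
    moreover have "q1 \<noteq> 0" using q0 q1 by auto
    then have "card {x. poly q1 x = 0} \<le> Polynomial.degree q1" "Polynomial.degree q = Suc (Polynomial.degree q1)"
    proof -
      show "card {x. poly q1 x = 0} \<le> Polynomial.degree q1" using \<open>q1 \<noteq> 0\<close> by (rule card_poly_roots_bound)
      have "[:- x, 1:] \<noteq> 0" by simp
      from degree_mult_eq[OF this \<open>q1 \<noteq> 0\<close>] show "Polynomial.degree q = Suc (Polynomial.degree q1)"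
        unfolding q1 by simp
    qed
    ultimately show False using cq by simp
  qed
  have "Suc (card ?Z) = Polynomial.degree p" unfolding cZ cq deg by simp
  then show thesis by (rule that[OF pq nr _ simple])
qed

text \<open>The equation for the x-coordinates of the points where the line of slope S through
  (\<alpha>, \<beta>) meets the curve. The map \<kappa> allows the slope to be a constant, a power
  series or an element of the closure of the Laurent series.\<close>

definition slope_poly :: "('a \<Rightarrow> 'b::comm_ring_1) \<Rightarrow> nat \<Rightarrow> 'a::comm_ring_1 poly \<Rightarrow> 'a \<Rightarrow> 'a \<Rightarrow> 'b \<Rightarrow> 'b poly" where
  "slope_poly \<kappa> n G \<alpha> \<beta> S = Polynomial.monom 1 n * [:\<kappa> \<beta> - S * \<kappa> \<alpha>, S:] ^ 2 - map_poly \<kappa> G"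

lemma poly_slope_poly:
  "poly (slope_poly \<kappa> n G \<alpha> \<beta> S) z = z ^ n * (\<kappa> \<beta> + S * (z - \<kappa> \<alpha>)) ^ 2 - poly (map_poly \<kappa> G) z"
  by (simp add: slope_poly_def poly_monom algebra_simps)

lemma degree_slope_poly:
  fixes S :: "'b::idom"
  assumes \<kappa>: "type_ring_hom \<kappa>" and inj: "\<kappa> (lead_coeff G) \<noteq> 0" and deg: "n + 2 < Polynomial.degree G"
  shows "Polynomial.degree (slope_poly \<kappa> n G \<alpha> \<beta> S) = Polynomial.degree G"
proof -
  interpret type_ring_hom \<kappa> by (rule \<kappa>)
  have "Polynomial.coeff (map_poly \<kappa> G) (Polynomial.degree G) \<noteq> 0"
    using inj by (simp add: coeff_map_hom)
  then have "Polynomial.degree G \<le> Polynomial.degree (map_poly \<kappa> G)" by (rule le_degree)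
  moreover have "Polynomial.degree (map_poly \<kappa> G) \<le> Polynomial.degree G"
    by (intro degree_le) (auto simp: coeff_map_hom coeff_eq_0 hom_0)
  ultimately have dG: "Polynomial.degree (map_poly \<kappa> G) = Polynomial.degree G" by simp
  have "Polynomial.degree (Polynomial.monom 1 n * [:\<kappa> \<beta> - S * \<kappa> \<alpha>, S:] ^ 2) \<le> n + 2"
    using degree_mult_le[of "Polynomial.monom 1 n" "[:\<kappa> \<beta> - S * \<kappa> \<alpha>, S:] ^ 2"]
      degree_power_le[of "[:\<kappa> \<beta> - S * \<kappa> \<alpha>, S:]" 2] by (auto simp: degree_monom_eq split: if_splits)
  then show ?thesis
    unfolding slope_poly_def diff_conv_add_uminus using dG deg by (subst degree_add_eq_right) auto
qed

text \<open>The lines through a point (\<alpha>, \<beta>) off the curve and off the line x = 0. With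
  d = r + 2 the condition \<open>char_d\<close> says that p does not divide r.\<close>

locale pencil = odd_curve n G d
  for n :: nat and G :: "'a::{alg_closed_field,field_gcd} poly" and d :: nat +
  fixes \<alpha> \<beta> :: 'a
  assumes n: "n \<noteq> 0" and d3: "3 \<le> d" and G0: "poly G 0 \<noteq> 0" and G\<alpha>: "\<alpha> ^ n * \<beta> ^ 2 \<noteq> poly G \<alpha>"
    and \<alpha>: "\<alpha> \<noteq> 0" and char_n: "of_nat n \<noteq> (0 :: 'a)" and char_2: "(2 :: 'a) \<noteq> 0"
    and char_d: "of_nat (d - 2) \<noteq> (0 :: 'a)"
    and sqfree: "poly G z = 0 \<Longrightarrow> poly (pderiv G) z \<noteq> 0"
begin

abbreviation Hs :: "'a \<Rightarrow> 'a poly" where "Hs \<equiv> slope_poly (\<lambda>x. x) n G \<alpha> \<beta>"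

lemma degG2: "n + 2 < Polynomial.degree G"
  using degG d3 by simp

lemma degree_Hs: "Polynomial.degree (Hs t) = n + d"
  using degree_slope_poly[OF id_hom _ degG2] degG leading_coeff_neq_0[OF G_nonzero] by simp

text \<open>Eliminating the slope from the equations of the curve and of its tangent line leaves
  \<open>W\<^sup>2 = 4 \<beta>\<^sup>2 x\<^bsup>n+2\<^esup> G\<close>, which has a solution other than \<open>\<alpha>\<close> for degree reasons.\<close>

lemma branch_point:
  obtains x0 y0 where "x0 \<noteq> \<alpha>" "y0 \<noteq> 0" "x0 \<noteq> 0" "x0 ^ n * y0 ^ 2 = poly G x0"
    "poly (pderiv (Hs ((y0 - \<beta>) / (x0 - \<alpha>)))) x0 = 0"
proof -
  \<comment> \<open>W comes from the derivative of \<open>Hs t\<close>: multiplied by x (x -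
    \<alpha>), with t (x - \<alpha>) = y - \<beta> and x^n y^2 = G, it becomes W - 2 \<beta> x^(n+1)
    y. Squaring and eliminating y leaves N.\<close>
  define W where "W = [:- (of_nat n * \<alpha>), of_nat (n + 2):] * G - [:0, 1:] * ([:- \<alpha>, 1:] * pderiv G)"
  define N where "N = W ^ 2 - [:4 * \<beta> ^ 2:] * (Polynomial.monom 1 (n + 2) * G)"
  define g where "g = lead_coeff G"
  have g: "g \<noteq> 0" using G_nonzero by (simp add: g_def)
  have pd: "pderiv (Polynomial.monom 1 k :: 'a poly) = Polynomial.monom (of_nat k) (k - 1)" for k
    by (simp add: pderiv_monom)
  \<comment> \<open>The top terms leave the factor (n + 2) - (n + d), so W^2 has degree at least 2
    (n + d + 1), above the bound 2n + d + 2 for the other term of N.\<close>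
  have "Polynomial.coeff W (n + d + 1) = of_nat (n + 2) * g - of_nat (n + d) * g"
  proof -
    obtain k where k: "n + d = Suc k" using d3 by (cases "n + d") auto
    have "Polynomial.coeff G (Suc (n + d)) = 0" by (simp add: coeff_eq_0 degG)
    then show ?thesis
      unfolding W_def using degG by (simp add: coeff_pCons coeff_pderiv k g_def)
  qed
  also have "\<dots> = - of_nat (d - 2) * g"
  proof -
    obtain k where "d = k + 2" using d3 by (metis add.commute le_Suc_ex numeral_le_iff le_trans one_le_numeral
      semiring_norm(69) numeral_2_eq_2 numeral_3_eq_3 Suc_leD)
    then show ?thesis by (simp add: algebra_simps)
  qed
  also have "\<dots> \<noteq> 0" using char_d g by simp
  finally have cW: "Polynomial.coeff W (n + d + 1) \<noteq> 0" .
  then have W0: "W \<noteq> 0" and degW: "n + d + 1 \<le> Polynomial.degree W" by (auto intro: le_degree)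
  have "Polynomial.degree ([:4 * \<beta> ^ 2:] * (Polynomial.monom 1 (n + 2) * G)) \<le> 0 + ((n + 2) + (n + d))"
    using degree_mult_le[of "[:4 * \<beta> ^ 2:]" "Polynomial.monom 1 (n + 2) * G"]
      degree_mult_le[of "Polynomial.monom 1 (n + 2)" G] degG by (simp add: degree_monom_eq)
  also have "\<dots> < Polynomial.degree (W ^ 2)"
    using degW W0 d3 by (simp add: degree_power_eq)
  finally have "Polynomial.degree N = Polynomial.degree (W ^ 2)"
    unfolding N_def diff_conv_add_uminus by (subst degree_add_eq_left) auto
  then have degN: "2 \<le> Polynomial.degree N"
    using degW W0 by (simp add: degree_power_eq)
  have polyW: "poly W z = (of_nat (n + 2) * z - of_nat n * \<alpha>) * poly G z - z * (z - \<alpha>) * poly (pderiv G) z" for z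
    by (simp add: W_def algebra_simps)
  have polyN: "poly N z = poly W z ^ 2 - 4 * \<beta> ^ 2 * (z ^ (n + 2) * poly G z)" for z
    by (simp add: N_def poly_monom algebra_simps)
  have W\<alpha>: "poly W \<alpha> = 2 * \<alpha> * poly G \<alpha>" by (simp add: polyW algebra_simps)
  \<comment> \<open>If \<alpha> were the only root of N it would be a multiple one. Then N(\<alpha>)
    = 0 forces G(\<alpha>) = 0, and the derivative of N at \<alpha> is a nonzero multiple of
    G'(\<alpha>); here \<beta> is nonzero because (\<alpha>, \<beta>) is off the curve.\<close>
  have "\<exists>x0. poly N x0 = 0 \<and> x0 \<noteq> \<alpha>"
  proof (rule ccontr)
    assume *: "\<not> ?thesis"
    obtain z where "poly N z = 0" using alg_closed_imp_poly_has_root[of N] degN by auto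
    then have N\<alpha>: "poly N \<alpha> = 0" using * by auto
    then obtain N1 where N1: "N = [:- \<alpha>, 1:] * N1" by (auto simp: poly_eq_0_iff_dvd elim: dvdE)
    then have "N1 \<noteq> 0" using degN by auto
    then have "Polynomial.degree N = Suc (Polynomial.degree N1)" unfolding N1 by (subst degree_mult_eq) auto
    then obtain z where "poly N1 z = 0" using alg_closed_imp_poly_has_root[of N1] degN by auto
    then have "poly N1 \<alpha> = 0" using * unfolding N1 by auto
    then have dN: "poly (pderiv N) \<alpha> = 0" unfolding N1 poly_pderiv_linear_mult .
    have char_4: "(4 :: 'a) \<noteq> 0"
    proof -
      have "(4 :: 'a) = 2 * 2" by simp
      then show ?thesis using char_2 by (metis mult_eq_0_iff)
    qed
    have "poly N \<alpha> = 4 * \<alpha> ^ 2 * poly G \<alpha> * (poly G \<alpha> - \<alpha> ^ n * \<beta> ^ 2)"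
      unfolding polyN W\<alpha> by (simp add: power2_eq_square algebra_simps power_add)
    then have GA: "poly G \<alpha> = 0" using N\<alpha> \<alpha> char_4 G\<alpha> by simp
    then have "poly W \<alpha> = 0" by (simp add: W\<alpha>)
    then have "poly (pderiv N) \<alpha> = - (4 * \<beta> ^ 2 * \<alpha> ^ (n + 2) * poly (pderiv G) \<alpha>)"
      unfolding N_def using GA
      by (simp add: pderiv_diff pderiv_mult pderiv_power poly_monom pderiv_pCons power2_eq_square pderiv_smult)
    then show False
      using dN \<alpha> char_4 sqfree[OF GA] G\<alpha> GA by simp
  qed
  then obtain x0 where x0: "poly N x0 = 0" "x0 \<noteq> \<alpha>" by blast
  \<comment> \<open>At 0 the value of W is -n \<alpha> G(0), a product of nonzero factors.\<close>
  have x00: "x0 \<noteq> 0"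
  proof
    assume "x0 = 0"
    then have "poly W 0 = 0" using x0 by (simp add: polyN)
    then show False using char_n \<alpha> G0 by (simp add: polyW)
  qed
  obtain y where y: "y ^ 2 = poly G x0 / x0 ^ n"
    using nth_root_exists[of 2 "poly G x0 / x0 ^ n"] by auto
  then have curve: "x0 ^ n * y ^ 2 = poly G x0" using x00 by simp
  have "poly W x0 ^ 2 = (2 * \<beta> * x0 ^ (n + 1) * y) ^ 2"
    using x0(1) unfolding polyN curve[symmetric]
    by (simp add: power_mult_distrib power2_eq_square algebra_simps)
  then have "poly W x0 = 2 * \<beta> * x0 ^ (n + 1) * y \<or> poly W x0 = - (2 * \<beta> * x0 ^ (n + 1) * y)"
    by (simp add: power2_eq_iff)
  \<comment> \<open>The sign of the square root is chosen so that the tangency equation holds before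
    squaring.\<close>
  then obtain y0 where y0: "y0 ^ 2 = y ^ 2" "poly W x0 = 2 * \<beta> * x0 ^ (n + 1) * y0"
    by (metis power2_minus mult_minus_right)
  have curve0: "x0 ^ n * y0 ^ 2 = poly G x0" using curve y0 by simp
  \<comment> \<open>With y = 0 the tangency equation would make x0 a double root of G.\<close>
  have y00: "y0 \<noteq> 0"
  proof
    assume "y0 = 0"
    then have "poly G x0 = 0" "poly W x0 = 0" using curve0 y0 by auto
    then show False using sqfree[of x0] x00 x0(2) by (simp add: polyW)
  qed
  define t where "t = (y0 - \<beta>) / (x0 - \<alpha>)"
  have t: "\<beta> + t * (x0 - \<alpha>) = y0" using x0(2) by (simp add: t_def)
  have "poly (pderiv (Hs t)) x0 = of_nat n * x0 ^ (n - 1) * y0 ^ 2 + x0 ^ n * (2 * y0 * t) - poly (pderiv G) x0"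
  proof -
    have l: "poly [:\<beta> - t * \<alpha>, t:] x0 = y0" using t by (simp add: algebra_simps)
    have "poly (pderiv ([:\<beta> - t * \<alpha>, t:] ^ 2)) x0 = y0 * t + y0 * t"
      by (simp only: power2_eq_square pderiv_mult poly_add poly_mult l) (simp add: pderiv_pCons)
    then show ?thesis
      unfolding slope_poly_def pderiv_diff pderiv_mult pd
      by (simp only: poly_diff poly_add poly_mult poly_power l) (simp add: poly_monom algebra_simps)
  qed
  also have "x0 * (x0 - \<alpha>) * \<dots> = of_nat n * (x0 - \<alpha>) * (x0 ^ n * y0 ^ 2) + 2 * x0 ^ (n + 1) * y0 * (t * (x0 - \<alpha>))
      - x0 * (x0 - \<alpha>) * poly (pderiv G) x0"
    using n by (cases n) (auto simp: algebra_simps)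
  also have "t * (x0 - \<alpha>) = y0 - \<beta>" using t by (simp add: algebra_simps)
  also have "of_nat n * (x0 - \<alpha>) * (x0 ^ n * y0 ^ 2) + 2 * x0 ^ (n + 1) * y0 * (y0 - \<beta>) - x0 * (x0 - \<alpha>) * poly (pderiv G) x0
      = of_nat n * (x0 - \<alpha>) * (x0 ^ n * y0 ^ 2) + 2 * x0 * (x0 ^ n * y0 ^ 2) - x0 * (x0 - \<alpha>) * poly (pderiv G) x0
        - 2 * \<beta> * x0 ^ (n + 1) * y0"
    by (simp add: algebra_simps power2_eq_square)
  also have "\<dots> = poly W x0 - 2 * \<beta> * x0 ^ (n + 1) * y0"
    unfolding curve0 polyW by (simp add: algebra_simps)
  also have "\<dots> = 0" using y0 by simp
  finally have "poly (pderiv (Hs t)) x0 = 0" using x00 x0(2) by simp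
  then show thesis using that[OF x0(2) y00 x00 curve0] by (simp add: t_def)
qed

section \<open>Branches at the tangency and the point at infinity\<close>

abbreviation refl :: "'a fps \<Rightarrow> 'a fps" where "refl f \<equiv> fps_compose f (- fps_X)"

lemma refl_hom: "type_ring_hom refl"
  by unfold_locales (auto simp: fps_compose_add_distrib fps_compose_mult_distrib)

lemma refl_nth: "fps_nth (refl f) i = (- 1) ^ i * fps_nth f i"
  by (simp add: fps_compose_uminus')

lemma refl_ev: "refl (fpc.ev z p) = fpc.ev (refl z) p"
proof -
  interpret r: type_ring_hom refl by (rule refl_hom)
  show ?thesis by (induction p) (auto simp: fpc.ev_pCons r.hom_add r.hom_mult)
qed

abbreviation on_pencil :: "'a fps \<Rightarrow> 'a fps \<Rightarrow> bool" where
  "on_pencil S f \<equiv> f ^ n * (fps_const \<beta> + S * (f - fps_const \<alpha>)) ^ 2 = fpc.ev f G"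

lemma on_pencil_iff: "on_pencil S f \<longleftrightarrow> poly (slope_poly fps_const n G \<alpha> \<beta> S) f = 0"
  by (simp add: poly_slope_poly fpc.ev_def)

lemma refl_on_pencil:
  assumes "on_pencil S f" "refl S = S"
  shows "on_pencil S (refl f)"
proof -
  interpret r: type_ring_hom refl by (rule refl_hom)
  show ?thesis
    using arg_cong[OF assms(1), of refl] assms(2)
    by (simp add: r.hom_add r.hom_mult r.hom_power r.hom_diff refl_ev)
qed

lemma map_nth0_slope_poly: "map_poly (\<lambda>f. fps_nth f 0) (slope_poly fps_const n G \<alpha> \<beta> S) = Hs (fps_nth S 0)"
proof -
  interpret M: type_ring_hom "map_poly (\<lambda>f :: 'a fps. fps_nth f 0)" by (rule nth0.map_poly_hom)
  have "map_poly (\<lambda>f. fps_nth f 0) (map_poly fps_const G) = map_poly (\<lambda>x. x) G"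
    by (rule poly_eqI) (simp add: coeff_map_poly)
  then show ?thesis
    by (simp add: slope_poly_def M.hom_diff M.hom_mult M.hom_power nth0.map_poly_hom_pCons nth0.map_poly_hom_monom)
qed

text \<open>Near a double root \<open>x0\<close> of the member with slope \<open>t0\<close>, put \<open>t = t0 + u\<^sup>2\<close> and \<open>x = x0 + u z\<close>; then the
  equation becomes divisible by \<open>u\<^sup>2\<close>, and the quotient has two simple roots \<open>\<plusminus>c\<close> at \<open>u = 0\<close>.\<close>

lemma branches_at_double_root:
  assumes q: "Hs t0 = [:- x0, 1:] ^ 2 * q" "poly q x0 \<noteq> 0"
    and y0: "\<beta> + t0 * (x0 - \<alpha>) = y0" "y0 \<noteq> 0" "x0 \<noteq> 0" "x0 \<noteq> \<alpha>"
  obtains w c where "on_pencil (fps_const t0 + fps_X ^ 2) w" "fps_nth w 0 = x0" "fps_nth w 1 = c" "c \<noteq> 0"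
proof -
  define l where "l = [:fps_const x0, fps_X:]"
  \<comment> \<open>The equation divided by u^2, as a polynomial in z. The three terms come from
    \<open>Hs t0\<close>, which has the factor (x - x0)^2 = u^2 z^2, and from the parts linear and
    quadratic in u^2 of the squared ordinate.\<close>
  define P where "P = [:0, 1:] ^ 2 * pcompose (map_poly fps_const q) l
      + [:2:] * l ^ n * ([:fps_const \<beta>:] + [:fps_const t0:] * (l - [:fps_const \<alpha>:])) * (l - [:fps_const \<alpha>:])
      + [:fps_X ^ 2:] * (l ^ n * (l - [:fps_const \<alpha>:]) ^ 2)"
  \<comment> \<open>The derivative of the equation with respect to the slope at (x0, t0). At u = 0
    the polynomial P reduces to q(x0) z^2 + e, whose roots are simple since e is nonzero and 2 is
    invertible.\<close>
  define e where "e = 2 * x0 ^ n * y0 * (x0 - \<alpha>)"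
  have e: "e \<noteq> 0" using y0 char_2 by (simp add: e_def)
  obtain c where c: "c ^ 2 = - e / poly q x0" using nth_root_exists[of 2 "- e / poly q x0"] by auto
  then have c0: "c \<noteq> 0" using e q(2) by auto
  interpret M: type_ring_hom "map_poly (\<lambda>f :: 'a fps. fps_nth f 0)" by (rule nth0.map_poly_hom)
  have "map_poly (\<lambda>f. fps_nth f 0) (map_poly fps_const q) = q"
    by (rule poly_eqI) (simp add: coeff_map_poly)
  moreover have l0: "map_poly (\<lambda>f. fps_nth f 0) l = [:x0:]"
    by (simp add: l_def nth0.map_poly_hom_pCons)
  moreover have two: "map_poly (\<lambda>f. fps_nth f 0) [:2 :: 'a fps:] = [:2:]"
    by (simp add: nth0.map_poly_hom_pCons)
  ultimately have P0: "map_poly (\<lambda>f. fps_nth f 0) P = [:e, 0, poly q x0:]"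
    unfolding P_def using y0(1)
    by (simp only: M.hom_add M.hom_mult M.hom_diff M.hom_power nth0.map_poly_hom_pcompose nth0.map_poly_hom_pCons
        map_poly_0) (simp add: pcompose_const_right poly_const_pow power2_eq_square e_def mult_ac algebra_simps)
  have "poly (map_poly (\<lambda>f. fps_nth f 0) P) c = 0"
    using c q(2) unfolding P0 by (simp add: power2_eq_square field_simps)
  moreover have "poly (pderiv (map_poly (\<lambda>f. fps_nth f 0) P)) c \<noteq> 0"
    using c0 q(2) char_2 unfolding P0 by (simp add: pderiv_pCons flip: mult_2)
  ultimately obtain z where z: "poly P z = 0" "fps_nth z 0 = c" by (rule hensel_fps)
  define w where "w = fps_const x0 + fps_X * z"
  have lz: "poly l z = w" by (simp add: l_def w_def mult.commute)
  have "poly (map_poly fps_const (Hs t0)) w = (w - fps_const x0) ^ 2 * poly (map_poly fps_const q) w"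
  proof -
    interpret Mc: type_ring_hom "map_poly (fps_const :: 'a \<Rightarrow> 'a fps)" by (rule fpc.map_poly_hom)
    show ?thesis unfolding q(1)
      by (simp add: Mc.hom_mult Mc.hom_power fpc.map_poly_hom_pCons fpc.hom_uminus del: fps_const_neg)
  qed
  moreover have "poly (map_poly fps_const (Hs t0)) w =
      w ^ n * (fps_const \<beta> + fps_const t0 * (w - fps_const \<alpha>)) ^ 2 - fpc.ev w G"
  proof -
    interpret Mc: type_ring_hom "map_poly (fps_const :: 'a \<Rightarrow> 'a fps)" by (rule fpc.map_poly_hom)
    have "map_poly fps_const (Hs t0) = slope_poly fps_const n G \<alpha> \<beta> (fps_const t0)"
      unfolding slope_poly_def
      by (simp add: Mc.hom_diff Mc.hom_mult Mc.hom_power fpc.map_poly_hom_pCons fpc.map_poly_hom_monom)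
    then show ?thesis by (simp add: poly_slope_poly fpc.ev_def)
  qed
  ultimately have 1: "w ^ n * (fps_const \<beta> + fps_const t0 * (w - fps_const \<alpha>)) ^ 2 - fpc.ev w G
      = fps_X ^ 2 * (z ^ 2 * poly (map_poly fps_const q) w)"
    by (simp add: w_def power_mult_distrib mult.assoc)
  define A where "A = fps_const \<beta> + fps_const t0 * (w - fps_const \<alpha>)"
  define D where "D = w - fps_const \<alpha>"
  have "z ^ 2 * poly (map_poly fps_const q) w + 2 * w ^ n * A * D + fps_X ^ 2 * (w ^ n * D ^ 2) = 0"
    using z(1) unfolding P_def by (simp add: poly_pcompose lz A_def D_def mult.assoc)
  then have 2: "z ^ 2 * poly (map_poly fps_const q) w = - (2 * w ^ n * A * D + fps_X ^ 2 * (w ^ n * D ^ 2))"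
    by (simp only: eq_neg_iff_add_eq_0 add.assoc)
  have "w ^ n * (A + fps_X ^ 2 * D) ^ 2 - fpc.ev w G
      = (w ^ n * A ^ 2 - fpc.ev w G) + fps_X ^ 2 * (2 * w ^ n * A * D + fps_X ^ 2 * (w ^ n * D ^ 2))"
    by (simp add: power2_eq_square algebra_simps)
  also have "\<dots> = 0" using 1 unfolding A_def[symmetric] 2 mult_minus_right by simp
  finally have "w ^ n * (A + fps_X ^ 2 * D) ^ 2 = fpc.ev w G" by simp
  moreover have "A + fps_X ^ 2 * D = fps_const \<beta> + (fps_const t0 + fps_X ^ 2) * (w - fps_const \<alpha>)"
    unfolding A_def D_def by (simp add: algebra_simps)
  ultimately have "on_pencil (fps_const t0 + fps_X ^ 2) w" by simp
  moreover have "fps_nth w 0 = x0" "fps_nth w 1 = c"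
    unfolding w_def using z(2) by simp_all
  ultimately show thesis using that c0 by blast
qed

text \<open>The simple roots at t0 lift by Hensel's lemma and the double root supplies w and its
  reflection; by degree there are no others. A lifted root is determined by its constant term, which
  the reflection preserves, so only the pair is moved.\<close>

lemma branch_roots:
  assumes x0: "x0 \<noteq> \<alpha>" "y0 \<noteq> 0" "x0 \<noteq> 0" "x0 ^ n * y0 ^ 2 = poly G x0"
    and t0: "t0 = (y0 - \<beta>) / (x0 - \<alpha>)" "poly (pderiv (Hs t0)) x0 = 0"
    and card: "n + d - 1 \<le> card {x. poly (Hs t0) x = 0}"
  obtains R :: "'a fps set" and w where "finite R" "card R = n + d" "\<And>f. f \<in> R \<longleftrightarrow> on_pencil (fps_const t0 + fps_X ^ 2) f"
    "w \<in> R" "refl w \<noteq> w" "\<And>f. f \<in> R - {w, refl w} \<Longrightarrow> refl f = f" "fps_nth w 1 \<noteq> 0"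
proof -
  let ?S = "fps_const t0 + fps_X ^ 2 :: 'a fps"
  have y0: "\<beta> + t0 * (x0 - \<alpha>) = y0" using x0 by (simp add: t0)
  have H: "Hs t0 \<noteq> 0" using degree_Hs[of t0] d3 by auto
  have root: "poly (Hs t0) x0 = 0" using x0(4) y0 by (simp add: poly_slope_poly)
  have card': "Polynomial.degree (Hs t0) - 1 \<le> card {x. poly (Hs t0) x = 0}" using card degree_Hs by simp
  obtain q where q: "Hs t0 = [:- x0, 1:] ^ 2 * q" "poly q x0 \<noteq> 0"
    and cZ: "Suc (card {x. poly (Hs t0) x = 0}) = n + d"
    and simple: "\<And>x. x \<noteq> x0 \<Longrightarrow> poly (Hs t0) x = 0 \<Longrightarrow> poly (pderiv (Hs t0)) x \<noteq> 0"
    using one_double_root[OF H root t0(2) card'] degree_Hs by metis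
  obtain w c where w: "on_pencil ?S w" "fps_nth w 0 = x0" "fps_nth w 1 = c" "c \<noteq> 0"
    using branches_at_double_root[OF q y0 x0(2,3,1)] by blast
  define Z where "Z = {x. poly (Hs t0) x = 0} - {x0}"
  have "\<exists>f. on_pencil ?S f \<and> fps_nth f 0 = x" if "x \<in> Z" for x
  proof -
    have "poly (map_poly (\<lambda>f. fps_nth f 0) (slope_poly fps_const n G \<alpha> \<beta> ?S)) x = 0"
      "poly (pderiv (map_poly (\<lambda>f. fps_nth f 0) (slope_poly fps_const n G \<alpha> \<beta> ?S))) x \<noteq> 0"
      using that simple unfolding map_nth0_slope_poly by (auto simp: Z_def)
    from hensel_fps[OF this] show ?thesis unfolding on_pencil_iff by metis
  qed
  then obtain h where h: "\<And>x. x \<in> Z \<Longrightarrow> on_pencil ?S (h x) \<and> fps_nth (h x) 0 = x" by metis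
  have reflS: "refl ?S = ?S"
    by (rule fps_ext) (auto simp: refl_nth fps_X_power_nth)
  have w': "on_pencil ?S (refl w)" using w(1) reflS by (rule refl_on_pencil)
  have w'1: "fps_nth (refl w) 1 = - c" "fps_nth (refl w) 0 = x0" using w by (simp_all add: refl_nth)
  have "c \<noteq> - c"
  proof
    assume "c = - c"
    then have "2 * c = 0" by (metis mult_2 add.right_inverse)
    then show False using w(4) char_2 by simp
  qed
  then have ww': "refl w \<noteq> w" using w(3) w'1 by metis
  have finZ: "finite Z" unfolding Z_def using poly_roots_finite[OF H] by simp
  have cardZ: "card Z + 2 = n + d"
  proof -
    have "0 < card {x. poly (Hs t0) x = 0}"
      using root poly_roots_finite[OF H] by (auto simp: card_gt_0_iff)
    then show ?thesis using cZ root unfolding Z_def by (subst card_Diff_singleton) auto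
  qed
  define R where "R = insert w (insert (refl w) (h ` Z))"
  have nin: "f \<notin> h ` Z" if "fps_nth f 0 = x0" for f
  proof
    assume "f \<in> h ` Z"
    then obtain x where "x \<in> Z" "f = h x" by blast
    then have "x = x0" using h[of x] that by simp
    then show False using \<open>x \<in> Z\<close> by (simp add: Z_def)
  qed
  have injh: "inj_on h Z" using h by (metis inj_onI)
  have cardR: "card R = n + d"
    unfolding R_def using finZ ww' nin[OF w(2)] nin[OF w'1(2)] cardZ card_image[OF injh] by simp
  have lc: "(fps_const (lead_coeff G) :: 'a fps) \<noteq> 0" using G_nonzero by simp
  have deg: "Polynomial.degree (slope_poly fps_const n G \<alpha> \<beta> ?S) = n + d"
    using degree_slope_poly[OF fps_const_hom lc degG2] degG by simp
  then have SP: "slope_poly fps_const n G \<alpha> \<beta> ?S \<noteq> 0" using d3 by auto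
  have sub: "R \<subseteq> {f. poly (slope_poly fps_const n G \<alpha> \<beta> ?S) f = 0}"
    using w(1) w' h unfolding R_def on_pencil_iff by auto
  have eq: "R = {f. poly (slope_poly fps_const n G \<alpha> \<beta> ?S) f = 0}"
    using card_poly_roots_bound[OF SP] cardR deg sub poly_roots_finite[OF SP]
    by (intro card_seteq) auto
  have iff: "f \<in> R \<longleftrightarrow> on_pencil ?S f" for f
    unfolding eq on_pencil_iff by simp
  have fixed: "refl f = f" if f: "f \<in> R - {w, refl w}" for f
  proof -
    obtain x where x: "x \<in> Z" "f = h x" using f by (auto simp: R_def)
    have "refl f \<in> R" using f refl_on_pencil[OF _ reflS] by (simp add: iff)
    moreover have "fps_nth (refl f) 0 = x" using h[OF x(1)] x(2) by (simp add: refl_nth)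
    moreover have "x \<noteq> x0" using x(1) by (simp add: Z_def)
    ultimately have "refl f \<in> R" "refl f \<noteq> w" "refl f \<noteq> refl w" using w(2) w'1(2) by metis+
    then obtain x' where x': "x' \<in> Z" "refl f = h x'" by (auto simp: R_def)
    then have "x' = x" using h[OF x'(1)] \<open>fps_nth (refl f) 0 = x\<close> by metis
    then show ?thesis using x x' by simp
  qed
  have finR: "finite R" using finZ by (simp add: R_def)
  have wR: "w \<in> R" by (simp add: R_def)
  show thesis by (rule that[OF finR cardR iff wR ww' fixed]) (use w(3,4) in simp_all)
qed

text \<open>The substitution x = C / u^2, t = u^(-r) with r = d - 2, multiplied by u^(2 (n + d)),
  gives an equation over power series. At u = 0 it reads z^(n+2) = g z^(n+d), so a root with g z^r =
  1 is simple because r is nonzero in K, and Hensel's lemma provides C.\<close>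

lemma point_at_infinity:
  obtains U s :: "'a fls" where "U ^ n * (fls_const \<beta> + s * (U - fls_const \<alpha>)) ^ 2 = fc.ev U G"
    "fls_subdegree U = - 2" "s = fls_X_inv ^ (d - 2)"
proof -
  define g where "g = lead_coeff G"
  define r where "r = d - 2"
  have d: "d = r + 2" and r0: "r \<noteq> 0" using d3 by (auto simp: r_def)
  have g: "g \<noteq> 0" using G_nonzero by (simp add: g_def)
  obtain c0 where c0: "c0 ^ r = 1 / g" using nth_root_exists[of r "1 / g"] r0 by auto
  then have c00: "c0 \<noteq> 0" using g r0 by (auto simp: power_0_left)
  define P where "P = Polynomial.monom 1 n * [:fps_const \<beta> * fps_X ^ d - fps_const \<alpha> * fps_X ^ 2, 1:] ^ 2
    - (\<Sum>i\<le>n + d. Polynomial.monom (fps_const (Polynomial.coeff G i) * fps_X ^ (2 * (n + d - i))) i)"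
  interpret M: type_ring_hom "map_poly (\<lambda>f :: 'a fps. fps_nth f 0)" by (rule nth0.map_poly_hom)
  have lin: "map_poly (\<lambda>f. fps_nth f 0) [:fps_const \<beta> * fps_X ^ d - fps_const \<alpha> * fps_X ^ 2, 1:] = [:0, 1:]"
    using d by (simp add: nth0.map_poly_hom_pCons fps_mult_nth_0)
  have sum: "(\<Sum>i\<le>n + d. Polynomial.monom (fps_nth (fps_const (Polynomial.coeff G i) * fps_X ^ (2 * (n + d - i))) 0) i)
      = Polynomial.monom g (n + d)"
  proof -
    have "(\<Sum>i\<le>n + d. Polynomial.monom (fps_nth (fps_const (Polynomial.coeff G i) * fps_X ^ (2 * (n + d - i))) 0) i)
      = (\<Sum>i\<in>{n + d}. Polynomial.monom (fps_nth (fps_const (Polynomial.coeff G i) * fps_X ^ (2 * (n + d - i))) 0) i)"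
      by (rule sum.mono_neutral_right) (auto simp: fps_mult_nth_0)
    then show ?thesis by (simp add: g_def degG)
  qed
  have "map_poly (\<lambda>f. fps_nth f 0) P = Polynomial.monom 1 n * [:0, 1:] ^ 2 - Polynomial.monom g (n + d)"
    unfolding P_def M.hom_diff M.hom_mult M.hom_power M.hom_sum lin nth0.map_poly_hom_monom sum by simp
  also have "\<dots> = Polynomial.monom 1 (n + 2) - Polynomial.monom g (n + d)"
    by (simp add: power2_eq_square monom_Suc numeral_2_eq_2)
  finally have P0: "map_poly (\<lambda>f. fps_nth f 0) P = Polynomial.monom 1 (n + 2) - Polynomial.monom g (n + d)" .
  have gc: "g * c0 ^ r = 1" using c0 g by simp
  have "poly (map_poly (\<lambda>f. fps_nth f 0) P) c0 = c0 ^ (n + 2) * (1 - g * c0 ^ r)"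
    unfolding P0 by (simp add: poly_monom d power_add algebra_simps)
  then have root: "poly (map_poly (\<lambda>f. fps_nth f 0) P) c0 = 0" by (simp add: gc)
  have "poly (pderiv (map_poly (\<lambda>f. fps_nth f 0) P)) c0
      = of_nat (n + 2) * c0 ^ (n + 1) - of_nat (n + 2 + r) * (g * c0 ^ r) * c0 ^ (n + 1)"
    unfolding P0 by (simp add: pderiv_diff pderiv_monom poly_monom d power_add algebra_simps)
  also have "\<dots> = - of_nat r * c0 ^ (n + 1)" unfolding gc by (simp add: algebra_simps)
  also have "\<dots> \<noteq> 0" using char_d c00 by (simp add: r_def)
  finally obtain c where c: "poly P c = 0" "fps_nth c 0 = c0" using hensel_fps[OF root] by blast
  define C where "C = fps_to_fls c"
  let ?x = "fls_X :: 'a fls"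
  have x0: "?x \<noteq> 0" by simp
  define U where "U = C / ?x ^ 2"
  define s where "s = inverse (?x ^ r)"
  have CU: "C = ?x ^ 2 * U"
    unfolding U_def using power_not_zero[OF x0] by (metis nonzero_mult_div_cancel_left times_divide_eq_right)
  have eqC: "C ^ n * (fls_const \<beta> * ?x ^ d - fls_const \<alpha> * ?x ^ 2 + C) ^ 2
      = (\<Sum>i\<le>n + d. fls_const (Polynomial.coeff G i) * ?x ^ (2 * (n + d - i)) * C ^ i)"
    using arg_cong[OF c(1), of fps_to_fls] unfolding P_def C_def
    by (simp add: poly_monom poly_sum f2l.hom_diff f2l.hom_add f2l.hom_mult f2l.hom_power f2l.hom_sum add.commute)
  have "?x ^ (2 * (n + d)) * fc.ev U G = (\<Sum>i\<le>n + d. fls_const (Polynomial.coeff G i) * ?x ^ (2 * (n + d - i)) * C ^ i)"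
  proof -
    have evG: "fc.ev U G = (\<Sum>i\<le>n + d. fls_const (Polynomial.coeff G i) * U ^ i)"
      unfolding fc.ev_def poly_altdef
      using degree_map_poly[of fls_const G] by (simp add: coeff_map_poly degG)
    have summand: "?x ^ (2 * (n + d)) * (fls_const (Polynomial.coeff G i) * U ^ i)
        = fls_const (Polynomial.coeff G i) * ?x ^ (2 * (n + d - i)) * C ^ i" if "i \<le> n + d" for i
    proof -
      have "?x ^ (2 * (n + d)) = ?x ^ (2 * (n + d - i)) * (?x ^ 2) ^ i"
      proof -
        have "2 * (n + d) = 2 * (n + d - i) + 2 * i" using that by simp
        then show ?thesis by (simp only: power_add power_mult)
      qed
      then show ?thesis unfolding CU by (simp only: power_mult_distrib mult_ac)
    qed
    show ?thesis unfolding evG sum_distrib_left using summand by (intro sum.cong) simp_all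
  qed
  also have "\<dots> = C ^ n * (fls_const \<beta> * ?x ^ d - fls_const \<alpha> * ?x ^ 2 + C) ^ 2" using eqC by simp
  also note CU
  also have "fls_const \<beta> * ?x ^ d - fls_const \<alpha> * ?x ^ 2 + ?x ^ 2 * U = ?x ^ d * (fls_const \<beta> + s * (U - fls_const \<alpha>))"
  proof -
    have "?x ^ r * s = 1" unfolding s_def using power_not_zero[OF x0] by (rule right_inverse)
    then have "?x ^ d * s = ?x ^ 2" unfolding d power_add by (simp add: mult.assoc mult.left_commute)
    then have "?x ^ d * (s * (U - fls_const \<alpha>)) = ?x ^ 2 * (U - fls_const \<alpha>)" by (simp flip: mult.assoc)
    then show ?thesis by (simp add: algebra_simps)
  qed
  also have "(?x ^ 2 * U) ^ n * (?x ^ d * (fls_const \<beta> + s * (U - fls_const \<alpha>))) ^ 2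
      = ?x ^ (2 * (n + d)) * (U ^ n * (fls_const \<beta> + s * (U - fls_const \<alpha>)) ^ 2)"
    by (simp add: power_mult_distrib power_add power_mult mult_ac)
      (simp add: power_mult[symmetric] mult.commute)
  finally have "U ^ n * (fls_const \<beta> + s * (U - fls_const \<alpha>)) ^ 2 = fc.ev U G" using x0 by simp
  moreover have "fls_subdegree U = - 2"
  proof -
    have "subdegree c = 0" using c(2) c00 by (simp add: subdegree_eq_0_iff)
    then have "fls_subdegree C = 0" by (simp add: C_def fls_subdegree_fls_to_fps)
    moreover have "C \<noteq> 0" using c(2) c00 by (auto simp: C_def)
    ultimately show ?thesis
      unfolding U_def divide_inverse by (simp add: fls_subdegree_pow)
  qed
  moreover have "s = fls_X_inv ^ (d - 2)"
    unfolding s_def r_def by (metis fls_inverse_X power_inverse)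
  ultimately show thesis using that by blast
qed

end

text \<open>The leading term dominates at a pole. Consequently all nonzero elements of the field
  generated over K by \<open>fls_X_inv ^ r\<close> have order divisible by r.\<close>

lemma fls_subdegree_ev_X_inv:
  assumes r: "r \<noteq> 0" and p: "p \<noteq> 0"
  shows "fls_subdegree (fc.ev (fls_X_inv ^ r) p) = - int (r * Polynomial.degree p)"
  using p
proof (induction p)
  case (pCons a p)
  show ?case
  proof (cases "p = 0")
    case True
    then show ?thesis by (simp add: fc.ev_pCons)
  next
    case False
    let ?s = "fls_X_inv ^ r :: 'a fls"
    have sub_s: "fls_subdegree ?s = - int r" by (simp add: fls_subdegree_pow)
    have "?s \<notin> range fls_const"
    proof
      assume "?s \<in> range fls_const"
      then obtain b where "?s = fls_const b" by blast
      then have "fls_subdegree ?s = 0" by (simp only: fls_const_subdegree)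
      then show False using sub_s r by simp
    qed
    then have nz: "fc.ev ?s p \<noteq> 0" using fc.transcendental[of ?s p] False by auto
    have e: "fls_subdegree (?s * fc.ev ?s p) = - int (r * Polynomial.degree (pCons a p))"
      using nz False pCons.IH sub_s by (simp add: algebra_simps)
    have "0 < r * Polynomial.degree (pCons a p)" using r False by simp
    then have "fls_subdegree (?s * fc.ev ?s p) < fls_subdegree (fls_const a)"
      unfolding e fls_const_subdegree by linarith
    with e show ?thesis
      using fls_subdegree_add_eq2[of "?s * fc.ev ?s p" "fls_const a"] nz by (simp add: fc.ev_pCons)
  qed
qed simp

no_notation fps_nth (infixl \<open>$\<close> 75)

section \<open>Special tangents of the curve\<close>

locale curve_shape =
  fixes n :: nat and G :: "'a::{alg_closed_field,field_gcd} poly" and d :: nat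
  assumes degG: "Polynomial.degree G = n + d" and n: "n \<noteq> 0" and d3: "3 \<le> d" and G0: "poly G 0 \<noteq> 0"
begin

abbreviation f where "f \<equiv> curve_poly n G"

lemma lcG: "Polynomial.coeff G (n + d) \<noteq> 0"
proof -
  have "G \<noteq> 0" using G0 by auto
  then show ?thesis using degG by (metis leading_coeff_neq_0)
qed

lemma coeff_f: "Polynomial.coeff f 0 = - G" "Polynomial.coeff f 1 = 0" "Polynomial.coeff f 2 = Polynomial.monom 1 n"
  "Polynomial.degree f = 2"
  by (simp_all add: curve_poly_altdef numeral_2_eq_2)

lemma total_degree_f: "total_degree f = n + d"
proof -
  let ?S = "{i + j |i j. Polynomial.coeff (Polynomial.coeff f j) i \<noteq> 0}"
  have le: "k \<le> n + d" if k: "k \<in> ?S" for k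
  proof -
    obtain i j where ij: "k = i + j" "Polynomial.coeff (Polynomial.coeff f j) i \<noteq> 0" using k by blast
    then have "Polynomial.coeff f j \<noteq> 0" by auto
    then have "j \<le> 2" using le_degree[of f j] coeff_f(4) by simp
    then consider "j = 0" | "j = 1" | "j = 2" by linarith
    then show ?thesis
    proof cases
      case 1
      then show ?thesis using ij le_degree[of G i] degG by (simp add: coeff_f)
    next
      case 2
      then show ?thesis using ij by (simp add: coeff_f(2)[simplified])
    next
      case 3
      then show ?thesis using ij d3 by (simp add: coeff_f split: if_splits)
    qed
  qed
  then have fin: "finite ?S" by (meson finite_nat_set_iff_bounded_le)
  have "n + d = (n + d) + 0 \<and> Polynomial.coeff (Polynomial.coeff f 0) (n + d) \<noteq> 0"
    using lcG by (simp add: coeff_f)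
  then have "n + d \<in> ?S" by blast
  then show ?thesis unfolding total_degree_def using le fin by (intro Max_eqI) auto
qed

lemma homog_eval_f:
  fixes h :: "'a \<Rightarrow> 'b::comm_ring_1"
  assumes h: "type_ring_hom h"
  shows "homog_eval h f x y z = x ^ n * y ^ 2 * z ^ (d - 2) - (\<Sum>i\<le>n + d. h (Polynomial.coeff G i) * x ^ i * z ^ (n + d - i))"
proof -
  interpret type_ring_hom h by (rule h)
  have "homog_eval h f x y z = (\<Sum>j\<in>{0, 1, 2}. \<Sum>i\<le>Polynomial.degree (Polynomial.coeff f j).
      h (Polynomial.coeff (Polynomial.coeff f j) i) * x ^ i * y ^ j * z ^ (n + d - i - j))"
    unfolding homog_eval_def total_degree_f coeff_f(4) by (intro sum.cong) auto
  also have "\<dots> = (\<Sum>i\<le>n + d. h (- Polynomial.coeff G i) * x ^ i * z ^ (n + d - i))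
      + (\<Sum>i\<le>n. h (Polynomial.coeff (Polynomial.monom 1 n) i) * x ^ i * y ^ 2 * z ^ (n + d - i - 2))"
    by (simp add: coeff_f coeff_f(2)[simplified] degG hom_0 degree_monom_eq)
  also have "(\<Sum>i\<le>n. h (Polynomial.coeff (Polynomial.monom 1 n) i) * x ^ i * y ^ 2 * z ^ (n + d - i - 2))
      = (\<Sum>i\<in>{n}. h (Polynomial.coeff (Polynomial.monom 1 n) i) * x ^ i * y ^ 2 * z ^ (n + d - i - 2))"
    by (rule sum.mono_neutral_right) (auto simp: hom_0)
  finally show ?thesis by (simp add: hom_uminus hom_1 sum_negf)
qed

lemmas homog_id = homog_eval_f[OF id_hom[folded id_def]]

lemma const_poly_hom: "type_ring_hom (\<lambda>c :: 'a. [:c:])"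
  by unfold_locales (auto simp: one_pCons)

lemmas homog_poly = homog_eval_f[OF const_poly_hom]

lemma homog_scale: "homog_eval id f (c * x) (c * y) (c * z) = c ^ (n + d) * homog_eval id f x y z"
proof -
  have "n + d = n + 2 + (d - 2)" using d3 by simp
  then have 1: "(c * x) ^ n * (c * y) ^ 2 * (c * z) ^ (d - 2) = c ^ (n + d) * (x ^ n * y ^ 2 * z ^ (d - 2))"
  proof -
    have "c ^ (n + d) = c ^ n * c ^ 2 * c ^ (d - 2)"
      using \<open>n + d = n + 2 + (d - 2)\<close> by (metis power_add)
    then show ?thesis by (simp add: power_mult_distrib mult_ac)
  qed
  have 2: "id (Polynomial.coeff G i) * (c * x) ^ i * (c * z) ^ (n + d - i)
      = c ^ (n + d) * (id (Polynomial.coeff G i) * x ^ i * z ^ (n + d - i))" if "i \<le> n + d" for i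
  proof -
    have "c ^ (n + d) = c ^ i * c ^ (n + d - i)" using that by (simp flip: power_add)
    then show ?thesis by (simp add: power_mult_distrib mult_ac)
  qed
  have "(\<Sum>i\<le>n + d. id (Polynomial.coeff G i) * (c * x) ^ i * (c * z) ^ (n + d - i))
      = c ^ (n + d) * (\<Sum>i\<le>n + d. id (Polynomial.coeff G i) * x ^ i * z ^ (n + d - i))"
    unfolding sum_distrib_left using 2 by (intro sum.cong) auto
  then show ?thesis unfolding homog_id 1 by (simp add: right_diff_distrib)
qed

lemma proj_point_eq_iff: "proj_point u = proj_point v \<longleftrightarrow> (\<exists>c. c \<noteq> 0 \<and> u = c *s (v :: 'a ^ 3))"
proof
  assume eq: "proj_point u = proj_point v"
  have "u \<in> proj_point u" unfolding proj_point_def by (auto intro!: exI[of _ 1])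
  then show "\<exists>c. c \<noteq> 0 \<and> u = c *s v" unfolding eq by (auto simp: proj_point_def)
next
  assume "\<exists>c. c \<noteq> 0 \<and> u = c *s v"
  then obtain c where c: "c \<noteq> 0" "u = c *s v" by blast
  have "x \<in> proj_point u \<longleftrightarrow> x \<in> proj_point v" for x
  proof
    assume "x \<in> proj_point u"
    then obtain e where "e \<noteq> 0" "x = e *s u" by (auto simp: proj_point_def)
    then show "x \<in> proj_point v" using c by (auto simp: proj_point_def vector_smult_assoc intro!: exI[of _ "e * c"])
  next
    assume "x \<in> proj_point v"
    then obtain e where "e \<noteq> 0" "x = e *s v" by (auto simp: proj_point_def)
    then show "x \<in> proj_point u"
      using c by (auto simp: proj_point_def vector_smult_assoc intro!: exI[of _ "e / c"])
  qed
  then show "proj_point u = proj_point v" by blast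
qed

lemma proj_point_in_curve:
  assumes v: "v \<noteq> 0"
  shows "proj_point v \<in> proj_curve f \<longleftrightarrow> homog_eval id f (v$1) (v$2) (v$3) = 0"
proof
  assume "proj_point v \<in> proj_curve f"
  then obtain w where w: "proj_point v = proj_point w" "homog_eval id f (w$1) (w$2) (w$3) = 0"
    by (auto simp: proj_curve_def)
  then obtain c where "c \<noteq> 0" "v = c *s w" by (auto simp: proj_point_eq_iff)
  then show "homog_eval id f (v$1) (v$2) (v$3) = 0" using w(2) homog_scale by simp
qed (use v in \<open>auto simp: proj_curve_def\<close>)

lemma vector3_eq_iff: "(u :: 'a ^ 3) = v \<longleftrightarrow> u$1 = v$1 \<and> u$2 = v$2 \<and> u$3 = v$3"
  by (simp add: vec_eq_iff forall_3)

lemma affine_homog: "homog_eval id f x y 1 = x ^ n * y ^ 2 - poly G x"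
  unfolding homog_id by (simp add: poly_altdef degG)

lemma affine_point_in_curve: "affine_point x y \<in> proj_curve f \<longleftrightarrow> x ^ n * y ^ 2 = poly G x"
  unfolding affine_point_def
  by (subst proj_point_in_curve) (auto simp: vector3_eq_iff affine_homog)

text \<open>Stated with vanishing coefficients, the bound also covers the infinite multiplicity of a
  line contained in the curve.\<close>

lemma line_mult_ge_iff:
  fixes u w :: "'a ^ 3"
  shows "enat k \<le> line_mult f u w \<longleftrightarrow>
    (\<forall>i<k. Polynomial.coeff (homog_eval (\<lambda>c. [:c:]) f [:u$1, w$1:] [:u$2, w$2:] [:u$3, w$3:]) i = 0)"
proof -
  define e where "e = homog_eval (\<lambda>c. [:c:]) f [:u$1, w$1:] [:u$2, w$2:] [:u$3, w$3:]"
  have "enat k \<le> line_mult f u w \<longleftrightarrow> e = 0 \<or> k \<le> Polynomial.order 0 e"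
    unfolding line_mult_def e_def[symmetric] Let_def by auto
  also have "\<dots> \<longleftrightarrow> [:- 0, 1:] ^ k dvd e" by (rule order_divides[symmetric])
  also have "[:- 0, 1:] ^ k = Polynomial.monom (1 :: 'a) k" by (simp add: monom_altdef)
  also have "Polynomial.monom 1 k dvd e \<longleftrightarrow> (\<forall>i<k. Polynomial.coeff e i = 0)" by (rule monom_1_dvd_iff')
  finally show ?thesis unfolding e_def .
qed

text \<open>The multiplicity of the point is a minimum over the lines through it, so a single line
  w' of smaller contact bounds it.\<close>

lemma tangent_lineI:
  fixes u w w' :: "'a ^ 3"
  assumes "proj_point u \<in> proj_curve f" "distinct_points u w" "distinct_points u w'"
    "enat k \<le> line_mult f u w" "\<not> enat k \<le> line_mult f u w'"
  shows "tangent_line_at f (proj_point u) (proj_line u w)"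
proof -
  have "point_mult f u \<le> line_mult f u w'"
    unfolding point_mult_def using assms(3) by (intro INF_lower) simp
  also have "\<dots> < line_mult f u w" using assms(4,5) by (meson not_le order_less_le_trans)
  finally show ?thesis unfolding tangent_line_at_def using assms(1,2) by blast
qed

lemma distinct_pointsI:
  "u \<noteq> 0 \<Longrightarrow> w \<noteq> 0 \<Longrightarrow> (\<And>c. u \<noteq> c *s w) \<Longrightarrow> distinct_points u (w :: 'a ^ 3)"
  by (auto simp: distinct_points_def proj_point_eq_iff)

lemma proj_lineI: "v = c *s u + b *s w \<Longrightarrow> c \<noteq> 0 \<or> b \<noteq> 0 \<Longrightarrow> proj_point v \<in> proj_line u w"
  unfolding proj_line_def by blast

text \<open>This excludes \<alpha> = 0. On x = 0 the homogeneous equation reduces to G(0) z^(n+d) =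
  0, so the line meets the curve only at (0 : 1 : 0). Its contact there is n + d, against n + d - 2
  for the line in direction w', so it is a tangent with a single point on the curve.\<close>

lemma y_axis_special:
  "\<exists>l\<in>special_tangents f (n + d). affine_point 0 \<beta> \<in> l"
proof -
  define u :: "'a ^ 3" where "u = vector [0, 1, 0]"
  define w :: "'a ^ 3" where "w = vector [0, 0, 1]"
  define w' :: "'a ^ 3" where "w' = vector [1, 0, 1]"
  have u [simp]: "u$1 = 0" "u$2 = 1" "u$3 = 0" by (simp_all add: u_def)
  have w [simp]: "w$1 = 0" "w$2 = 0" "w$3 = 1" by (simp_all add: w_def)
  have w' [simp]: "w'$1 = 1" "w'$2 = 0" "w'$3 = 1" by (simp_all add: w'_def)
  have ne: "u \<noteq> 0" "w \<noteq> 0" "w' \<noteq> 0" by (auto simp: vector3_eq_iff)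
  have on0: "homog_eval id f 0 y z = 0 ^ n * y ^ 2 * z ^ (d - 2) - poly G 0 * z ^ (n + d)" for y z
  proof -
    have "(\<Sum>i\<le>n + d. id (Polynomial.coeff G i) * 0 ^ i * z ^ (n + d - i))
        = (\<Sum>i\<in>{0}. id (Polynomial.coeff G i) * 0 ^ i * z ^ (n + d - i))"
      by (rule sum.mono_neutral_right) auto
    then show ?thesis unfolding homog_id by (simp add: poly_0_coeff_0)
  qed
  have X_pow: "[:0, 1 :: 'a:] ^ k = Polynomial.monom 1 k" for k by (simp add: monom_altdef)
  then have X_pow': "pCons 0 (1 :: 'a poly) ^ k = Polynomial.monom 1 k" for k by (simp add: one_pCons)
  have e1: "homog_eval (\<lambda>c. [:c:]) f [:u$1, w$1:] [:u$2, w$2:] [:u$3, w$3:] = - Polynomial.monom (poly G 0) (n + d)"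
  proof -
    have "(\<Sum>i\<le>n + d. [:Polynomial.coeff G i:] * 0 ^ i * [:0, 1:] ^ (n + d - i))
        = (\<Sum>i\<in>{0}. [:Polynomial.coeff G i:] * 0 ^ i * [:0, 1:] ^ (n + d - i))"
      by (rule sum.mono_neutral_right) auto
    then show ?thesis
      unfolding homog_poly using n by (simp add: X_pow poly_0_coeff_0 smult_monom)
  qed
  have e2: "homog_eval (\<lambda>c. [:c:]) f [:u$1, w'$1:] [:u$2, w'$2:] [:u$3, w'$3:]
      = Polynomial.monom 1 (n + d - 2) - (\<Sum>i\<le>n + d. Polynomial.monom (Polynomial.coeff G i) (n + d))"
  proof -
    have "(\<Sum>i\<le>n + d. [:Polynomial.coeff G i:] * [:0, 1:] ^ i * [:0, 1:] ^ (n + d - i))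
        = (\<Sum>i\<le>n + d. Polynomial.monom (Polynomial.coeff G i) (n + d))"
      by (intro sum.cong) (auto simp: X_pow smult_monom mult_monom)
    moreover have "n + (d - 2) = n + d - 2" using d3 by simp
    ultimately show ?thesis
      unfolding homog_poly by (simp add: X_pow' mult_monom smult_monom flip: one_pCons)
  qed
  have curve: "proj_point u \<in> proj_curve f"
    using n d3 by (subst proj_point_in_curve[OF ne(1)]) (simp add: on0 power_0_left)
  have uw: "distinct_points u w" "distinct_points u w'"
    using ne by (auto intro!: distinct_pointsI simp: vector3_eq_iff)
  have "tangent_line_at f (proj_point u) (proj_line u w)"
  proof (rule tangent_lineI[OF curve uw])
    show "enat (n + d - 1) \<le> line_mult f u w"
      unfolding line_mult_ge_iff e1 by auto
    have "Polynomial.coeff (homog_eval (\<lambda>c. [:c:]) f [:u$1, w'$1:] [:u$2, w'$2:] [:u$3, w'$3:]) (n + d - 2) = 1"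
    proof -
      have "n + d \<noteq> n + d - 2" using d3 by simp
      then show ?thesis unfolding e2 by (simp add: coeff_sum)
    qed
    moreover have "n + d - 2 < n + d - 1" using d3 by simp
    ultimately show "\<not> enat (n + d - 1) \<le> line_mult f u w'"
      unfolding line_mult_ge_iff by (metis zero_neq_one)
  qed
  moreover have sub: "proj_line u w \<inter> proj_curve f \<subseteq> {proj_point u}"
  proof
    fix p assume p: "p \<in> proj_line u w \<inter> proj_curve f"
    then obtain c b where cb: "p = proj_point (c *s u + b *s w)" "c \<noteq> 0 \<or> b \<noteq> 0"
      by (auto simp: proj_line_def)
    have nz: "c *s u + b *s w \<noteq> 0" using cb(2) by (auto simp: vector3_eq_iff)
    have "homog_eval id f 0 c b = 0"
      using p proj_point_in_curve[OF nz] unfolding cb(1) by simp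
    then have "b = 0" using n G0 by (simp add: on0 power_0_left)
    then show "p \<in> {proj_point u}" using cb by (auto simp: proj_point_eq_iff)
  qed
  have "finite (proj_line u w \<inter> proj_curve f)" "card (proj_line u w \<inter> proj_curve f) < n + d - 1"
    using finite_subset[OF sub] card_mono[OF _ sub] n d3 by auto
  ultimately have "proj_line u w \<in> special_tangents f (n + d)"
    unfolding special_tangents_def by blast
  moreover have "affine_point 0 \<beta> \<in> proj_line u w"
  proof -
    have "vector [0, \<beta>, 1] = \<beta> *s u + 1 *s w" by (simp add: vector3_eq_iff)
    then show ?thesis unfolding affine_point_def by (rule proj_lineI) simp
  qed
  ultimately show ?thesis by blast
qed

text \<open>The line of slope t0 meets the curve at (x0, y0) to order at least 2, the vertical line
  only to order 1, so the former is tangent. Passing through (\<alpha>, \<beta>), it is not special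
  and has at least n + d - 1 points on the curve; all are affine, and their x-coordinates are roots
  of the slope equation.\<close>

lemma tangent_through_point:
  assumes x0: "x0 \<noteq> \<alpha>" "x0 \<noteq> 0" "y0 \<noteq> 0" "(2 :: 'a) \<noteq> 0" "x0 ^ n * y0 ^ 2 = poly G x0"
    and t0: "t0 = (y0 - \<beta>) / (x0 - \<alpha>)" "poly (pderiv (slope_poly (\<lambda>x. x) n G \<alpha> \<beta> t0)) x0 = 0"
    and nin: "affine_point \<alpha> \<beta> \<notin> \<Union> (special_tangents f (n + d))"
  shows "n + d - 1 \<le> card {x. poly (slope_poly (\<lambda>x. x) n G \<alpha> \<beta> t0) x = 0}"
proof -
  let ?H = "slope_poly (\<lambda>x. x) n G \<alpha> \<beta> t0"
  have y0: "y0 = \<beta> + t0 * (x0 - \<alpha>)" using x0(1) by (simp add: t0(1))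
  define u :: "'a ^ 3" where "u = vector [x0, y0, 1]"
  define w :: "'a ^ 3" where "w = vector [1, t0, 0]"
  define w' :: "'a ^ 3" where "w' = vector [0, 1, 0]"
  have u [simp]: "u$1 = x0" "u$2 = y0" "u$3 = 1" by (simp_all add: u_def)
  have w [simp]: "w$1 = 1" "w$2 = t0" "w$3 = 0" by (simp_all add: w_def)
  have w' [simp]: "w'$1 = 0" "w'$2 = 1" "w'$3 = 0" by (simp_all add: w'_def)
  have ne: "u \<noteq> 0" "w \<noteq> 0" "w' \<noteq> 0" by (auto simp: vector3_eq_iff)
  have polyH: "poly ?H x = x ^ n * (\<beta> + t0 * (x - \<alpha>)) ^ 2 - poly G x" for x
    by (simp add: poly_slope_poly)
  have H: "?H \<noteq> 0"
  proof
    assume "?H = 0"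
    then have "Polynomial.degree ?H = 0" by simp
    then show False
      using degree_slope_poly[OF id_hom, of G n \<alpha> \<beta> t0] lcG degG d3 by simp
  qed
  define e where "e = homog_eval (\<lambda>c. [:c:]) f [:u$1, w$1:] [:u$2, w$2:] [:u$3, w$3:]"
  define l where "l = [:x0, 1:]"
  \<comment> \<open>Along the line, parametrized by (x0 + X, y0 + t0 X), the curve equation is the
    slope polynomial shifted by x0.\<close>
  have e: "e = pcompose ?H l"
  proof -
    have 1: "pcompose G l = (\<Sum>i\<le>n + d. [:Polynomial.coeff G i:] * l ^ i)"
      unfolding pcompose_altdef poly_altdef using degree_map_poly[of "\<lambda>a. [:a:]" G] degG
      by (simp add: coeff_map_poly)
    have 2: "pcompose (Polynomial.monom 1 n) l = l ^ n"
      unfolding pcompose_altdef by (simp add: map_poly_monom poly_monom flip: one_pCons)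
    have 3: "pcompose [:\<beta> - t0 * \<alpha>, t0:] l = [:y0, t0:]" by (simp add: l_def pcompose_pCons y0 algebra_simps)
    have 4: "map_poly (\<lambda>x. x) G = G" by (rule poly_eqI) (simp add: coeff_map_poly)
    have "pcompose ?H l = l ^ n * [:y0, t0:] ^ 2 - (\<Sum>i\<le>n + d. [:Polynomial.coeff G i:] * l ^ i)"
      unfolding slope_poly_def 4 power2_eq_square pcompose_diff pcompose_mult 1 2 3 ..
    moreover have "[:1, 0 :: 'a:] = 1" by (simp add: one_pCons)
    ultimately show ?thesis
      unfolding e_def homog_poly u w l_def[symmetric] by (simp only: power_one mult_1_right)
  qed
  have e0: "Polynomial.coeff e 0 = 0"
    using x0(5) polyH[of x0] y0 by (simp add: e l_def poly_pcompose flip: poly_0_coeff_0)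
  have e1: "Polynomial.coeff e 1 = 0"
  proof -
    have "poly (pderiv e) 0 = 0"
      unfolding e using t0(2) by (simp add: l_def pderiv_pcompose poly_pcompose pderiv_pCons)
    then show ?thesis by (simp add: poly_0_coeff_0 coeff_pderiv)
  qed
  define e' where "e' = homog_eval (\<lambda>c. [:c:]) f [:u$1, w'$1:] [:u$2, w'$2:] [:u$3, w'$3:]"
  have "e' = [:x0 ^ n:] * [:y0, 1:] ^ 2 - [:poly G x0:]"
  proof -
    have "(\<Sum>i\<le>n + d. [:Polynomial.coeff G i:] * [:x0:] ^ i) = [:poly G x0:]"
      unfolding poly_altdef[of G] degG type_ring_hom.hom_sum[OF const_poly_hom] by (simp add: poly_const_pow mult.commute)
    then show ?thesis
      unfolding e'_def homog_poly by (simp add: poly_const_pow flip: one_pCons)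
  qed
  then have "Polynomial.coeff e' 1 = x0 ^ n * (2 * y0)" by (simp add: power2_eq_square)
  then have e'1: "Polynomial.coeff e' 1 \<noteq> 0" using x0 by simp
  have in_curve: "proj_point u \<in> proj_curve f"
    using affine_point_in_curve[of x0 y0] x0(5) by (simp add: affine_point_def u_def)
  have uw: "distinct_points u w" "distinct_points u w'"
    using ne by (auto intro!: distinct_pointsI simp: vector3_eq_iff)
  have tangent: "tangent_line_at f (proj_point u) (proj_line u w)"
  proof (rule tangent_lineI[OF in_curve uw])
    show "enat 2 \<le> line_mult f u w"
      unfolding line_mult_ge_iff e_def[symmetric] using e0 e1 by (auto simp: less_2_cases_iff)
    show "\<not> enat 2 \<le> line_mult f u w'"
      unfolding line_mult_ge_iff e'_def[symmetric] using e'1 by (auto intro!: exI[of _ 1])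
  qed
  define Z where "Z = {x. poly ?H x = 0}"
  define \<phi> where "\<phi> x = affine_point x (\<beta> + t0 * (x - \<alpha>))" for x
  have finZ: "finite Z" unfolding Z_def using H by (rule poly_roots_finite)
  have sub: "proj_line u w \<inter> proj_curve f \<subseteq> \<phi> ` Z"
  proof
    fix p assume p: "p \<in> proj_line u w \<inter> proj_curve f"
    then obtain c b where cb: "p = proj_point (c *s u + b *s w)" "c \<noteq> 0 \<or> b \<noteq> 0"
      by (auto simp: proj_line_def)
    have nz: "c *s u + b *s w \<noteq> 0"
    proof
      assume 0: "c *s u + b *s w = 0"
      have "(c *s u + b *s w) $ 3 = 0" "(c *s u + b *s w) $ 1 = 0" unfolding 0 by simp_all
      then show False using cb(2) by simp
    qed
    have "homog_eval id f (c * x0 + b) (c * y0 + b * t0) c = 0"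
      using p proj_point_in_curve[OF nz] unfolding cb(1) by simp
    then have hc: "homog_eval id f (c * x0 + b) (c * y0 + b * t0) (c * 1) = 0" by simp
    \<comment> \<open>At infinity the equation becomes minus the leading coefficient of G times
      b^(n+d), so the line meets the curve in no point there.\<close>
    have c: "c \<noteq> 0"
    proof
      assume c: "c = 0"
      have "(\<Sum>i\<le>n + d. id (Polynomial.coeff G i) * b ^ i * 0 ^ (n + d - i))
          = (\<Sum>i\<in>{n + d}. id (Polynomial.coeff G i) * b ^ i * 0 ^ (n + d - i))"
        by (rule sum.mono_neutral_right) auto
      then have "homog_eval id f b (b * t0) 0 = - (Polynomial.coeff G (n + d) * b ^ (n + d))"
        unfolding homog_id using d3 by simp
      then show False using hc c cb(2) lcG by simp
    qed
    define x where "x = x0 + b / c"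
    have 1: "c * x0 + b = c * x" using c by (simp add: x_def algebra_simps)
    have 2: "c * y0 + b * t0 = c * (\<beta> + t0 * (x - \<alpha>))" using c by (simp add: x_def y0 algebra_simps)
    have "homog_eval id f x (\<beta> + t0 * (x - \<alpha>)) 1 = 0"
      using hc c unfolding 1 2 homog_scale by simp
    then have "x \<in> Z" by (simp add: Z_def polyH affine_homog)
    moreover have "p = \<phi> x"
      unfolding cb(1) \<phi>_def affine_point_def proj_point_eq_iff using c 1 2
      by (intro exI[of _ c]) (simp add: vector3_eq_iff)
    ultimately show "p \<in> \<phi> ` Z" by blast
  qed
  have in_line: "\<phi> x \<in> proj_line u w" for x
  proof -
    have "vector [x, \<beta> + t0 * (x - \<alpha>), 1] = 1 *s u + (x - x0) *s w"
      by (simp add: vector3_eq_iff y0 algebra_simps)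
    then show ?thesis unfolding \<phi>_def affine_point_def by (rule proj_lineI) simp
  qed
  have "affine_point \<alpha> \<beta> \<in> proj_line u w" using in_line[of \<alpha>] by (simp add: \<phi>_def)
  then have "proj_line u w \<notin> special_tangents f (n + d)" using nin by blast
  moreover have fin: "finite (proj_line u w \<inter> proj_curve f)" using sub finZ finite_subset by blast
  ultimately have "n + d - 1 \<le> card (proj_line u w \<inter> proj_curve f)"
    using tangent unfolding special_tangents_def by auto
  also have "\<dots> \<le> card Z"
    using sub finZ by (meson card_image_le card_mono finite_imageI le_trans)
  finally show ?thesis unfolding Z_def .
qed

end

section \<open>The Galois group\<close>

lemma (in field) subfield_preimage:
  assumes h: "type_hom (carrier R) h" and S: "subfld S"
  shows "subfield {x \<in> carrier R. h x \<in> S} R"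
proof -
  note hs = type_hom_subfield[OF carrier_is_subfield h]
  note hD = type_homD[OF h]
  note SD = subfldD[OF S]
  show ?thesis
  proof (rule subfieldI')
    show "subring {x \<in> carrier R. h x \<in> S} R"
      by (rule subringI) (use hD hs(1,2) SD in auto)
    show "inv k \<in> {x \<in> carrier R. h x \<in> S}" if "k \<in> {x \<in> carrier R. h x \<in> S} - {\<zero>}" for k
      using that hs(5)[of k] SD field_Units by auto
  qed
qed

text \<open>P0 is the point near the tangency, P1 the one at infinity; they embed the same function
  field into Laurent series in two ways. R0 collects the n + d power series solutions of the slope
  equation with slope S, and w is the one that gives the x-coordinate of P0.\<close>

locale pencil_galois_closure =
  P0: projected_curve_point n G d U V \<alpha> \<beta> s + P1: projected_curve_point n G d U1 V1 \<alpha> \<beta> s1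
  for n d :: nat and G :: "'a::{alg_closed_field,field_gcd} poly" and U V \<alpha> \<beta> s U1 V1 s1 +
  fixes R0 :: "'a fps set" and w :: "'a fps" and S :: "'a fps" and r :: nat
    and M :: "'m ring" and \<sigma> :: "'a poly fract poly set \<Rightarrow> 'm"
  assumes U: "U = fps_to_fls w" and s_def: "s = fps_to_fls S" and reflS: "fps_compose S (- fps_X) = S"
    and R0: "finite R0" "card R0 = n + d"
      "\<And>f. f \<in> R0 \<longleftrightarrow> f ^ n * (fps_const \<beta> + S * (f - fps_const \<alpha>)) ^ 2 = fpc.ev f G"
    and w: "w \<in> R0" "fps_compose w (- fps_X) \<in> R0" "fps_compose w (- fps_X) \<noteq> w"
      "\<And>f. f \<in> R0 - {w, fps_compose w (- fps_X)} \<Longrightarrow> fps_compose f (- fps_X) = f"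
    and U1: "fls_subdegree U1 = - 2" and s1: "s1 = fls_X_inv ^ r"
    and r: "Factorial_Ring.prime r" "odd r" "n + d < 2 * r"
    and closure: "galois_closure P0.L P0.F M \<sigma>"
begin

abbreviation F' where "F' \<equiv> \<sigma> ` P0.F"

lemma galois_M: "galois_extension M F'" and \<sigma>_hom: "\<sigma> \<in> ring_hom P0.L M"
  using closure by (auto simp: galois_closure_def)

sublocale M: galois_ext M F'
proof -
  have "field M" using galois_M by (simp add: galois_extension_def)
  then show "galois_ext M F'" using galois_M by (simp add: galois_ext_def galois_ext_axioms_def)
qed

sublocale sig: ring_hom_ring P0.L M \<sigma>
  by (rule ring_hom_ringI2[OF P0.L.ring_axioms M.ring_axioms \<sigma>_hom])

abbreviation E0 where "E0 \<equiv> \<sigma> ` carrier P0.L"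

lemma E0: "subfield E0 M" "inj_on \<sigma> (carrier P0.L)"
  using sig.img_is_subfield[OF P0.L.carrier_is_subfield] M.one_not_zero by auto

definition cm :: "'a poly fract poly \<Rightarrow> 'm" where "cm h = \<sigma> (P0.cl h)"

lemma cm_closed [simp]: "cm h \<in> carrier M"
  unfolding cm_def using sig.hom_closed P0.cl_closed by blast

lemma cm_eq_iff: "cm h = cm k \<longleftrightarrow> P0.cl h = P0.cl k"
  using E0(2) P0.cl_closed unfolding cm_def by (auto dest: inj_onD)

lemma cm_simps: "cm (h + k) = cm h \<oplus>\<^bsub>M\<^esub> cm k" "cm (h * k) = cm h \<otimes>\<^bsub>M\<^esub> cm k" "cm 1 = \<one>\<^bsub>M\<^esub>"
  unfolding cm_def P0.cl_simps by (simp_all add: sig.hom_add sig.hom_mult sig.hom_one)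

lemma E0_eq: "E0 = range cm"
  unfolding cm_def P0.carrier_L by auto

lemma F'_E0: "F' \<subseteq> E0"
  using P0.F_subset by auto

text \<open>Through P0 the copy of the function field in M embeds into Laurent series; M is
  algebraic over this copy, so the embedding extends to M with values in the algebraic
  closure.\<close>

lemma ex_psi: "\<exists>\<psi> :: 'm \<Rightarrow> 'a fls alg_closure. M.type_hom (carrier M) \<psi> \<and> (\<forall>h. \<psi> (cm h) = to_ac (P0.\<Theta> h))"
proof -
  define h0 :: "'m \<Rightarrow> 'a fls alg_closure" where "h0 z = to_ac (P0.\<Theta> (SOME h. cm h = z))" for z
  have h0: "h0 (cm h) = to_ac (P0.\<Theta> h)" for h
  proof -
    have "cm (SOME k. cm k = cm h) = cm h" by (rule someI) simp
    then show ?thesis unfolding h0_def by (simp add: cm_eq_iff P0.\<Theta>_eq_iff)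
  qed
  have hom: "M.type_hom E0 h0"
    unfolding M.type_hom_def E0_eq
  proof (intro conjI ballI)
    show "h0 \<one>\<^bsub>M\<^esub> = 1" using h0[of 1] by (simp add: cm_simps P0.T.hom_1)
    fix x y assume "x \<in> range cm" "y \<in> range cm"
    then obtain h k where "x = cm h" "y = cm k" by blast
    then show "h0 (x \<oplus>\<^bsub>M\<^esub> y) = h0 x + h0 y" "h0 (x \<otimes>\<^bsub>M\<^esub> y) = h0 x * h0 y"
      using h0[of "h + k"] h0[of "h * k"] h0 by (simp_all add: cm_simps P0.T.hom_add P0.T.hom_mult)
  qed
  have alg: "\<not> M.transcendental E0 z" if "z \<in> carrier M" for z
    using M.algebraic_mono[OF F'_E0, of z] M.algebraic_F[OF that] by (simp add: over_def)
  from M.extend_embedding[OF E0(1) hom alg] obtain \<psi> where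
    "M.type_hom (carrier M) \<psi>" "\<And>x. x \<in> E0 \<Longrightarrow> \<psi> x = h0 x" by blast
  then show ?thesis using h0 unfolding E0_eq by auto
qed

definition \<psi> :: "'m \<Rightarrow> 'a fls alg_closure" where
  "\<psi> = (SOME \<psi>. M.type_hom (carrier M) \<psi> \<and> (\<forall>h. \<psi> (cm h) = to_ac (P0.\<Theta> h)))"

lemma \<psi>: "M.type_hom (carrier M) \<psi>" and \<psi>_cm: "\<psi> (cm h) = to_ac (P0.\<Theta> h)"
  using someI_ex[OF ex_psi] unfolding \<psi>_def by auto

lemmas \<psi>D = M.type_homD[OF \<psi>]
lemmas \<psi>_field = M.type_hom_subfield[OF M.carrier_is_subfield \<psi>]

lemma \<psi>_F: "M.type_hom F' \<psi>"
  using \<psi> M.F_carrier unfolding M.type_hom_def by auto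

section \<open>The Galois group acting on the image of M\<close>

definition N where "N = \<psi> ` carrier M"
definition F0 where "F0 = \<psi> ` F'"
definition GG where "GG = carrier (galois_group M F')"
text \<open>Automorphisms of M read through \<psi>. Only the values on N are prescribed, which
  admits maps given by a formula on a larger field, such as the reflection.\<close>

definition A where "A = {h. \<exists>\<phi>\<in>GG. \<forall>x\<in>carrier M. h (\<psi> x) = \<psi> (\<phi> x)}"

lemma GG_closed: "\<phi> \<in> GG \<Longrightarrow> x \<in> carrier M \<Longrightarrow> \<phi> x \<in> carrier M"
  using M.galois_groupD(2) unfolding GG_def bij_betw_def by blast

lemma GG_hom:
  assumes "\<phi> \<in> GG"
  shows "x \<in> carrier M \<Longrightarrow> y \<in> carrier M \<Longrightarrow> \<phi> (x \<oplus>\<^bsub>M\<^esub> y) = \<phi> x \<oplus>\<^bsub>M\<^esub> \<phi> y"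
    "x \<in> carrier M \<Longrightarrow> y \<in> carrier M \<Longrightarrow> \<phi> (x \<otimes>\<^bsub>M\<^esub> y) = \<phi> x \<otimes>\<^bsub>M\<^esub> \<phi> y" "\<phi> \<one>\<^bsub>M\<^esub> = \<one>\<^bsub>M\<^esub>"
  using M.galois_groupD(1)[OF assms[unfolded GG_def]] by (auto simp: ring_hom_def)

lemma GG_memI:
  assumes h: "M.type_hom (carrier M) h" and F: "\<And>x. x \<in> F' \<Longrightarrow> h x = \<psi> x"
  obtains \<phi> where "\<phi> \<in> GG" "\<And>x. x \<in> carrier M \<Longrightarrow> \<psi> (\<phi> x) = h x"
  using M.galois_group_memI[OF \<psi> h] F unfolding GG_def by metis

lemma \<psi>_GG: "\<phi> \<in> GG \<Longrightarrow> M.type_hom (carrier M) h \<Longrightarrow> M.type_hom (carrier M) (\<lambda>x. h (\<phi> x))"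
proof -
  assume \<phi>: "\<phi> \<in> GG" and h: "M.type_hom (carrier M) h"
  show ?thesis
    unfolding M.type_hom_def
    using M.type_homD[OF h] GG_hom[OF \<phi>] GG_closed[OF \<phi>] by simp
qed

lemma GG_fix: "\<phi> \<in> GG \<Longrightarrow> x \<in> F' \<Longrightarrow> \<phi> x = x"
  using M.galois_groupD(4) unfolding GG_def by blast

lemma AI: "\<phi> \<in> GG \<Longrightarrow> (\<And>x. x \<in> carrier M \<Longrightarrow> h (\<psi> x) = \<psi> (\<phi> x)) \<Longrightarrow> h \<in> A"
  unfolding A_def by blast

lemma ex_A:
  assumes "\<phi> \<in> GG"
  shows "\<exists>h\<in>A. \<forall>x\<in>carrier M. h (\<psi> x) = \<psi> (\<phi> x)"
proof -
  define h where "h z = \<psi> (\<phi> (inv_into (carrier M) \<psi> z))" for z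
  have "h (\<psi> x) = \<psi> (\<phi> x)" if "x \<in> carrier M" for x
    unfolding h_def using \<psi>_field(4) that by (simp add: inv_into_f_f)
  then show ?thesis using AI[OF assms] by blast
qed

sublocale N: galois_set N F0 A
proof
  show "subfld N" unfolding N_def by (rule \<psi>_field(6))
  show "subfld F0" unfolding F0_def by (rule M.type_hom_subfield(6)[OF M.F_subfield \<psi>_F])
  show "F0 \<subseteq> N" unfolding F0_def N_def using M.F_carrier by blast
  fix h assume "h \<in> A"
  then obtain \<phi> where \<phi>: "\<phi> \<in> GG" "\<And>x. x \<in> carrier M \<Longrightarrow> h (\<psi> x) = \<psi> (\<phi> x)" unfolding A_def by blast
  show "h x \<in> N" if "x \<in> N" for x
    using that \<phi> GG_closed[OF \<phi>(1)] unfolding N_def by auto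
  show "h (x + y) = h x + h y" "h (x * y) = h x * h y" if "x \<in> N" "y \<in> N" for x y
  proof -
    obtain u v where uv: "u \<in> carrier M" "x = \<psi> u" "v \<in> carrier M" "y = \<psi> v" using \<open>x \<in> N\<close> \<open>y \<in> N\<close> unfolding N_def by blast
    show "h (x + y) = h x + h y"
      using \<phi>(2)[of "u \<oplus>\<^bsub>M\<^esub> v"] \<phi>(2) uv GG_hom[OF \<phi>(1)] GG_closed[OF \<phi>(1)] by (simp add: \<psi>D)
    show "h (x * y) = h x * h y"
      using \<phi>(2)[of "u \<otimes>\<^bsub>M\<^esub> v"] \<phi>(2) uv GG_hom[OF \<phi>(1)] GG_closed[OF \<phi>(1)] by (simp add: \<psi>D)
  qed
  show "h x = x" if "x \<in> F0" for x
  proof -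
    obtain u where u: "u \<in> F'" "x = \<psi> u" using \<open>x \<in> F0\<close> unfolding F0_def by blast
    then show ?thesis using \<phi>(2)[of u] GG_fix[OF \<phi>(1)] M.F_carrier by auto
  qed
  show "\<exists>k\<in>A. \<forall>x\<in>N. k (h x) = x \<and> h (k x) = x"
  proof -
    define g where "g = inv_into (carrier M) \<phi>"
    have bij: "bij_betw \<phi> (carrier M) (carrier M)" using M.galois_groupD(2) \<phi>(1) unfolding GG_def by blast
    have g: "g x \<in> carrier M" "\<phi> (g x) = x" "g (\<phi> x) = x" if "x \<in> carrier M" for x
      unfolding g_def using bij that
      by (auto simp: bij_betw_def f_inv_into_f inv_into_f_f intro: inv_into_into)
    have "M.type_hom (carrier M) (\<lambda>x. \<psi> (g x))"
      unfolding M.type_hom_def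
    proof (intro conjI ballI)
      show "\<psi> (g \<one>\<^bsub>M\<^esub>) = 1" using g(3)[of "\<one>\<^bsub>M\<^esub>"] GG_hom(3)[OF \<phi>(1)] \<psi>D(1) by simp
      fix x y assume xy: "x \<in> carrier M" "y \<in> carrier M"
      have "g (x \<oplus>\<^bsub>M\<^esub> y) = g x \<oplus>\<^bsub>M\<^esub> g y"
        using g(3)[of "g x \<oplus>\<^bsub>M\<^esub> g y"] GG_hom(1)[OF \<phi>(1), of "g x" "g y"] g xy by simp
      then show "\<psi> (g (x \<oplus>\<^bsub>M\<^esub> y)) = \<psi> (g x) + \<psi> (g y)" using \<psi>D g(1) xy by simp
      have "g (x \<otimes>\<^bsub>M\<^esub> y) = g x \<otimes>\<^bsub>M\<^esub> g y"
        using g(3)[of "g x \<otimes>\<^bsub>M\<^esub> g y"] GG_hom(2)[OF \<phi>(1), of "g x" "g y"] g xy by simp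
      then show "\<psi> (g (x \<otimes>\<^bsub>M\<^esub> y)) = \<psi> (g x) * \<psi> (g y)" using \<psi>D g(1) xy by simp
    qed
    moreover have "\<psi> (g x) = \<psi> x" if "x \<in> F'" for x
      using that g(3)[of x] GG_fix[OF \<phi>(1) that] M.F_carrier by auto
    ultimately obtain \<phi>' where \<phi>': "\<phi>' \<in> GG" "\<And>x. x \<in> carrier M \<Longrightarrow> \<psi> (\<phi>' x) = \<psi> (g x)"
      using GG_memI by metis
    obtain k where k: "k \<in> A" "\<And>x. x \<in> carrier M \<Longrightarrow> k (\<psi> x) = \<psi> (\<phi>' x)" using ex_A[OF \<phi>'(1)] by blast
    have "k (h x) = x \<and> h (k x) = x" if "x \<in> N" for x
    proof -
      obtain u where u: "u \<in> carrier M" "x = \<psi> u" using \<open>x \<in> N\<close> unfolding N_def by blast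
      then show ?thesis using \<phi> \<phi>' k g GG_closed[OF \<phi>(1)] by simp
    qed
    then show ?thesis using k(1) by blast
  qed
  fix k assume "k \<in> A"
  then obtain \<phi>' where \<phi>': "\<phi>' \<in> GG" "\<And>x. x \<in> carrier M \<Longrightarrow> k (\<psi> x) = \<psi> (\<phi>' x)" unfolding A_def by blast
  obtain \<phi>2 where \<phi>2: "\<phi>2 \<in> GG" "\<And>x. x \<in> carrier M \<Longrightarrow> \<psi> (\<phi>2 x) = \<psi> (\<phi> (\<phi>' x))"
    using GG_memI[OF \<psi>_GG[OF \<phi>'(1) \<psi>_GG[OF \<phi>(1) \<psi>]]] GG_fix[OF \<phi>(1)] GG_fix[OF \<phi>'(1)] by metis
  obtain l where "l \<in> A" "\<And>x. x \<in> carrier M \<Longrightarrow> l (\<psi> x) = \<psi> (\<phi>2 x)" using ex_A[OF \<phi>2(1)] by blast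
  then show "\<exists>l\<in>A. \<forall>x\<in>N. l x = h (k x)"
    using \<phi> \<phi>' \<phi>2 GG_closed[OF \<phi>'(1)] unfolding N_def by (intro bexI[of _ l]) auto
next
  obtain \<phi> where \<phi>: "\<phi> \<in> GG" "\<And>x. x \<in> carrier M \<Longrightarrow> \<psi> (\<phi> x) = \<psi> x"
    using GG_memI[OF \<psi>] by metis
  then have "(\<lambda>x. x) \<in> A" by (intro AI[of \<phi>]) auto
  then show "\<exists>k\<in>A. \<forall>x\<in>N. k x = x" by (rule bexI[rotated]) simp
next
  fix z assume z: "z \<in> N" and fixed: "\<And>h. h \<in> A \<Longrightarrow> h z = z"
  obtain x where x: "x \<in> carrier M" "z = \<psi> x" using z unfolding N_def by blast
  have "\<phi> x = x" if "\<phi> \<in> GG" for \<phi>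
  proof -
    obtain h where "h \<in> A" "\<forall>x\<in>carrier M. h (\<psi> x) = \<psi> (\<phi> x)" using ex_A[OF \<open>\<phi> \<in> GG\<close>] by blast
    then have "\<psi> (\<phi> x) = \<psi> x" using fixed x by metis
    then show ?thesis using \<psi>_field(4) GG_closed[OF \<open>\<phi> \<in> GG\<close> x(1)] x(1) by (auto dest: inj_onD)
  qed
  then have "x \<in> F'" using M.fixed_by_galois_group[OF \<psi>_F x(1)] unfolding GG_def by blast
  then show "z \<in> F0" using x unfolding F0_def by blast
qed

lemma \<Theta>_N: "to_ac (P0.\<Theta> h) \<in> N"
proof -
  have "\<psi> (cm h) \<in> N" unfolding N_def by (rule imageI) (rule cm_closed)
  then show ?thesis unfolding \<psi>_cm .
qed

lemma F0_\<Theta>: "c \<in> F0 \<longleftrightarrow> (\<exists>h. P0.cl h \<in> P0.F \<and> c = to_ac (P0.\<Theta> h))"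
proof
  assume "c \<in> F0"
  then obtain y where y: "y \<in> P0.F" "c = \<psi> (\<sigma> y)" unfolding F0_def by blast
  then obtain h where "y = P0.cl h" using P0.F_subset P0.carrier_L by blast
  then show "\<exists>h. P0.cl h \<in> P0.F \<and> c = to_ac (P0.\<Theta> h)" using y \<psi>_cm unfolding cm_def by auto
next
  assume "\<exists>h. P0.cl h \<in> P0.F \<and> c = to_ac (P0.\<Theta> h)"
  then obtain h where h: "P0.cl h \<in> P0.F" "c = to_ac (P0.\<Theta> h)" by blast
  have "c = \<psi> (cm h)" using h(2) \<psi>_cm[of h] by (rule trans[OF _ sym])
  then show "c \<in> F0" using h(1) unfolding F0_def cm_def by blast
qed

definition \<kappa> :: "'a \<Rightarrow> 'a fls alg_closure" where "\<kappa> c = to_ac (fls_const c)"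

sublocale K: type_ring_hom \<kappa>
  by unfold_locales (simp_all add: \<kappa>_def flip: fls_plus_const to_ac_mult)

lemma F0_gens: "\<kappa> c \<in> F0" "to_ac s \<in> F0"
  using P0.F_gens P0.\<Theta>_const P0.\<Theta>_tv unfolding F0_\<Theta> \<kappa>_def by metis+

lemma F0_rational: "c \<in> F0 \<Longrightarrow> \<exists>z. c = to_ac z \<and> P0.rational_in_s z"
  unfolding F0_\<Theta> using P0.F_rational P0.\<Theta>_eq_iff by metis

section \<open>The roots of the slope equation inside N\<close>

definition Hx :: "'a fls alg_closure poly" where
  "Hx = slope_poly \<kappa> n G \<alpha> \<beta> (to_ac s)"

lemma poly_over_Hx: "poly_over F0 Hx"
proof -
  have "poly_over F0 (map_poly \<kappa> G)" using F0_gens by (simp add: poly_over_def K.coeff_map_hom)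
  moreover have "poly_over F0 [:\<kappa> \<beta> - to_ac s * \<kappa> \<alpha>, to_ac s:]"
    using F0_gens subfldD[OF N.F0] by simp
  ultimately show ?thesis
    unfolding Hx_def slope_poly_def using subfldD(1)[OF N.F0]
    by (intro poly_over_diff[OF N.F0] poly_over_mult[OF N.F0] poly_over_power[OF N.F0] poly_over_monom[OF N.F0])
qed

lemma K_ev_to_ac: "K.ev (to_ac z) p = to_ac (fc.ev z p)"
proof (induction p)
  case (pCons a p)
  then show ?case using \<kappa>_def[of a] by (simp add: K.ev_pCons fc.ev_pCons)
qed simp

lemma degree_Hx: "Polynomial.degree Hx = n + d" "Hx \<noteq> 0"
proof -
  have "\<kappa> (lead_coeff G) \<noteq> 0" using P0.G_nonzero by (simp add: \<kappa>_def)
  moreover have "n + 2 < Polynomial.degree G" using P0.degG P0.d3 by simp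
  ultimately show "Polynomial.degree Hx = n + d"
    unfolding Hx_def using degree_slope_poly[OF K.type_ring_hom_axioms] P0.degG by metis
  then show "Hx \<noteq> 0" using P0.d3 by auto
qed

definition iota :: "'a fps \<Rightarrow> 'a fls alg_closure" where "iota f = to_ac (fps_to_fls f)"

lemma inj_iota: "inj iota"
  by (auto simp: inj_def iota_def)

definition Rts where "Rts = iota ` R0"

text \<open>The members of R0 give n + d distinct roots of a polynomial of degree n + d.\<close>

lemma Rts_eq: "Rts = {x. poly Hx x = 0}"
proof -
  have "poly Hx (iota f) = 0" if "f \<in> R0" for f
  proof -
    have "fps_to_fls (f ^ n * (fps_const \<beta> + S * (f - fps_const \<alpha>)) ^ 2) = fc.ev (fps_to_fls f) G"
      using that R0(3) by (simp flip: f2l_fpc_ev)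
    then have "fps_to_fls f ^ n * (fls_const \<beta> + s * (fps_to_fls f - fls_const \<alpha>)) ^ 2 = fc.ev (fps_to_fls f) G"
      by (simp add: f2l.hom_mult f2l.hom_power f2l.hom_add f2l.hom_diff s_def)
    then have "to_ac (fps_to_fls f ^ n * (fls_const \<beta> + s * (fps_to_fls f - fls_const \<alpha>)) ^ 2) = K.ev (iota f) G"
      by (simp add: iota_def K_ev_to_ac)
    then show ?thesis
      unfolding Hx_def poly_slope_poly by (simp add: iota_def \<kappa>_def K.ev_def)
  qed
  then have "Rts \<subseteq> {x. poly Hx x = 0}" by (auto simp: Rts_def)
  moreover have "card Rts = n + d"
    unfolding Rts_def using R0(2) inj_iota by (subst card_image) (auto intro: inj_on_subset)
  ultimately show ?thesis
    using card_poly_roots_bound[OF degree_Hx(2)] poly_roots_finite[OF degree_Hx(2)] degree_Hx(1)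
    by (intro card_seteq) auto
qed

lemma card_Rts: "card Rts = n + d" "finite Rts"
  unfolding Rts_def using R0(1,2) inj_iota by (auto simp: card_image inj_on_subset)

definition \<xi> where "\<xi> = to_ac U"

lemma \<xi>_Rts: "\<xi> \<in> Rts"
proof -
  have "\<xi> = iota w" unfolding \<xi>_def iota_def by (rule arg_cong[OF U])
  then show ?thesis using w(1) unfolding Rts_def by blast
qed

lemma \<xi>_N: "\<xi> \<in> N"
  using \<Theta>_N[of P0.xv] by (simp add: P0.\<Theta>_xv \<xi>_def)

lemma A_poly: "h \<in> A \<Longrightarrow> poly_over F0 p \<Longrightarrow> z \<in> N \<Longrightarrow> h (poly p z) = poly p (h z)"
proof (induction p)
  case (pCons a p)
  have p: "poly_over F0 p" "a \<in> F0" using pCons.prems(2) by simp_all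
  then have "poly_over N p" using N.F0N unfolding poly_over_def by blast
  then have "poly p z \<in> N" using pCons.prems(3) by (rule poly_over_poly[OF N.N])
  moreover have "a \<in> N" "h a = a" using p(2) N.F0N N.A_fix[OF pCons.prems(1)] by auto
  ultimately show ?case using pCons p(1) by (simp add: N.A_add N.A_mult N.N_closed)
qed (simp add: N.A_0)

text \<open>Elements of F0 are rational functions of s inside K((u)), so a relation over F0 descends
  to K((u)), where the degree bound is known.\<close>

lemma irreducible_\<xi>:
  assumes Q: "poly_over F0 Q" "Q \<noteq> 0" "poly Q \<xi> = 0"
  shows "n + d \<le> Polynomial.degree Q"
proof -
  have "\<exists>z. Polynomial.coeff Q i = to_ac z \<and> P0.rational_in_s z" for i
    using Q(1) F0_rational unfolding poly_over_def by blast
  then have *: "to_ac (of_ac (Polynomial.coeff Q i)) = Polynomial.coeff Q i" "P0.rational_in_s (of_ac (Polynomial.coeff Q i))" for i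
    by (metis of_ac_to_ac)+
  define Q' where "Q' = map_poly of_ac Q"
  have c: "Polynomial.coeff Q' i = of_ac (Polynomial.coeff Q i)" for i
    by (simp add: Q'_def coeff_map_poly)
  have QQ': "Q = map_poly to_ac Q'"
    by (rule poly_eqI) (simp add: coeff_map_poly c *)
  interpret ac: type_ring_hom "to_ac :: 'a fls \<Rightarrow> _" by unfold_locales auto
  have "to_ac (poly Q' U) = 0" using Q(3) unfolding \<xi>_def by (simp add: ac.hom_poly flip: QQ')
  moreover have "Q' \<noteq> 0" using Q(2) QQ' by auto
  ultimately have "n + d \<le> Polynomial.degree Q'" using *(2) by (intro P0.minimal_degree) (auto simp: c)
  also have "\<dots> = Polynomial.degree Q" unfolding QQ' by (rule degree_map_poly[symmetric]) simp
  finally show ?thesis .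
qed

text \<open>The orbit argument, applied to those roots that lie in N, already produces n + d of
  them, that is all.\<close>

lemma Rts_N: "Rts \<subseteq> N"
proof -
  interpret X: galois_roots N F0 A "Rts \<inter> N" \<xi> "n + d"
  proof
    show "card (Rts \<inter> N) \<le> n + d" using card_mono[OF card_Rts(2), of "Rts \<inter> N"] card_Rts(1) by simp
    show "h ` (Rts \<inter> N) \<subseteq> Rts \<inter> N" if "h \<in> A" for h
      using that A_poly[OF that poly_over_Hx] N.A_closed N.A_0 by (auto simp: Rts_eq) metis
  qed (use card_Rts \<xi>_Rts \<xi>_N irreducible_\<xi> in auto)
  have "Rts \<inter> N = Rts" using X.card_R card_Rts by (intro card_subset_eq) auto
  then show ?thesis by blast
qed

sublocale R: galois_roots N F0 A Rts \<xi> "n + d"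
proof
  show "h ` Rts \<subseteq> Rts" if "h \<in> A" for h
  proof
    fix y assume "y \<in> h ` Rts"
    then obtain x where x: "x \<in> Rts" "y = h x" by blast
    then have "poly Hx (h x) = h 0" using A_poly[OF that poly_over_Hx, of x] Rts_N by (auto simp: Rts_eq)
    then show "y \<in> Rts" using x N.A_0[OF that] by (simp add: Rts_eq)
  qed
qed (use card_Rts \<xi>_Rts Rts_N irreducible_\<xi> in auto)

text \<open>The splitting field of Hx over F0.\<close>

definition gen where "gen = \<Inter>{T. subfld T \<and> F0 \<subseteq> T \<and> Rts \<subseteq> T}"

lemma genD: "subfld T \<Longrightarrow> F0 \<subseteq> T \<Longrightarrow> Rts \<subseteq> T \<Longrightarrow> gen \<subseteq> T"
  by (auto simp: gen_def)

lemma gen: "subfld gen" "F0 \<subseteq> gen" "Rts \<subseteq> gen"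
  unfolding gen_def subfld_def by auto

lemma \<Theta>_gen: "to_ac (P0.\<Theta> h) \<in> gen"
proof -
  note gD = subfldD[OF gen(1)]
  have kc: "\<kappa> c \<in> gen" for c using F0_gens gen(2) by auto
  have ev: "to_ac (fc.ev U p) \<in> gen" for p
  proof -
    have "K.ev \<xi> p \<in> gen" for p
      by (induction p) (use kc \<xi>_Rts gen(3) gD in \<open>auto simp: K.ev_pCons\<close>)
    then show ?thesis by (simp add: \<xi>_def flip: K_ev_to_ac)
  qed
  have femb: "to_ac (P0.femb q) \<in> gen" for q
  proof -
    obtain a b where "q = to_fract a / to_fract b" "b \<noteq> 0" using fract_as_quot by blast
    then show ?thesis using ev gD(8) by (simp add: P0.Fe.hom_divide)
  qed
  have V: "to_ac V \<in> gen"
  proof -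
    have "to_ac V = \<kappa> \<beta> + to_ac s * (\<xi> - \<kappa> \<alpha>)" by (simp add: P0.V \<kappa>_def \<xi>_def)
    also have "\<dots> \<in> gen"
      using F0_gens(2) gen(2,3) \<xi>_Rts by (intro gD(3,4,7) kc) auto
    finally show ?thesis .
  qed
  show ?thesis
    by (induction h) (use femb V gD in \<open>auto simp: P0.\<Theta>_pCons P0.T.hom_0\<close>)
qed

lemma gen_stable:
  assumes h: "h \<in> A" and x: "x \<in> gen"
  shows "h x \<in> gen"
proof -
  have "gen \<subseteq> {x \<in> N. h x \<in> gen}"
  proof (rule genD)
    show "subfld {x \<in> N. h x \<in> gen}"
      unfolding subfld_def using subfldD[OF gen(1)]
      by (auto simp: N.A_1[OF h] N.A_add[OF h] N.A_mult[OF h] N.A_uminus[OF h] N.A_inverse[OF h] N.N_closed)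
    show "F0 \<subseteq> {x \<in> N. h x \<in> gen}" using N.F0N N.A_fix[OF h] gen(2) by auto
    show "Rts \<subseteq> {x \<in> N. h x \<in> gen}" using Rts_N R.stable[OF h] gen(3) by auto
  qed
  then show ?thesis using x by blast
qed

text \<open>By minimality of the Galois closure: the preimage of \<open>gen\<close> in M contains
  the function field and is stable under automorphisms, hence is Galois over the base field and
  equal to M.\<close>

lemma N_gen: "N \<subseteq> gen"
proof -
  define E where "E = {x \<in> carrier M. \<psi> x \<in> gen}"
  have E: "subfield E M" unfolding E_def by (rule M.subfield_preimage[OF \<psi> gen(1)])
  have E0E: "E0 \<subseteq> E" unfolding E0_eq E_def using \<psi>_cm \<Theta>_gen by auto
  have "galois_extension (M\<lparr>carrier := E\<rparr>) F'"
  proof (rule M.galois_subextension[OF \<psi>_F E])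
    show "F' \<subseteq> E" using F'_E0 E0E by blast
    fix \<phi> assume \<phi>: "\<phi> \<in> carrier (galois_group M F')"
    then obtain h where h: "h \<in> A" "\<forall>x\<in>carrier M. h (\<psi> x) = \<psi> (\<phi> x)" using ex_A unfolding GG_def by blast
    show "\<phi> ` E \<subseteq> E"
      using gen_stable[OF h(1)] h(2) GG_closed \<phi> unfolding E_def GG_def by (auto simp flip: h(2))
  qed
  then have "E = carrier M"
    using closure E E0E unfolding galois_closure_def by blast
  then show ?thesis unfolding E_def N_def by auto
qed

section \<open>The reflection acts as a transposition\<close>

abbreviation rfl :: "'a fls \<Rightarrow> 'a fls" where "rfl z \<equiv> fls_compose_fps z (- fps_X)"

lemma rfl_hom: "type_ring_hom rfl"
  by unfold_locales (auto simp: fls_compose_fps_add fls_compose_fps_mult)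

text \<open>The roots are power series, so N lies in K((u)) itself and substitutions for u act on
  it.\<close>

lemma N_range: "N \<subseteq> range to_ac"
proof -
  have "gen \<subseteq> range to_ac"
  proof (rule genD)
    show "subfld (range (to_ac :: 'a fls \<Rightarrow> _))"
      unfolding subfld_def by (auto simp flip: to_ac_1 to_ac_add to_ac_mult to_ac_minus to_ac_inverse)
    show "F0 \<subseteq> range to_ac" using F0_rational by blast
    show "Rts \<subseteq> range to_ac" by (auto simp: Rts_def iota_def)
  qed
  then show ?thesis using N_gen by blast
qed

text \<open>The reflection fixes S, hence all of K(s), so \<psi> followed by the reflection is a
  second embedding of M that agrees with \<psi> on the base field.\<close>

lemma reflection_in_A: "(\<lambda>z. to_ac (rfl (of_ac z))) \<in> A"
proof -
  interpret r: type_ring_hom rfl by (rule rfl_hom)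
  define h where "h x = to_ac (rfl (of_ac (\<psi> x)))" for x
  have ac: "\<exists>z. \<psi> x = to_ac z" if "x \<in> carrier M" for x
    using N_range that unfolding N_def by blast
  have "M.type_hom (carrier M) h"
    unfolding M.type_hom_def
  proof (intro conjI ballI)
    show "h \<one>\<^bsub>M\<^esub> = 1" using of_ac_to_ac[of "1 :: 'a fls"] by (simp add: h_def \<psi>D(1))
    fix x y assume "x \<in> carrier M" "y \<in> carrier M"
    moreover obtain u v where "\<psi> x = to_ac u" "\<psi> y = to_ac v" using ac \<open>x \<in> carrier M\<close> \<open>y \<in> carrier M\<close> by blast
    ultimately show "h (x \<oplus>\<^bsub>M\<^esub> y) = h x + h y" "h (x \<otimes>\<^bsub>M\<^esub> y) = h x * h y"
      using of_ac_to_ac[of "u + v"] of_ac_to_ac[of "u * v"]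
      by (simp_all add: h_def \<psi>D r.hom_add r.hom_mult)
  qed
  moreover have "h x = \<psi> x" if x: "x \<in> F'" for x
  proof -
    obtain z P Q where z: "\<psi> x = to_ac z" "Q \<noteq> 0" "z * fc.ev s Q = fc.ev s P"
      using F0_rational x unfolding F0_def P0.rational_in_s_def by blast
    have s: "rfl s = s" unfolding s_def using reflS by simp
    have ev: "rfl (fc.ev s p) = fc.ev s p" for p
      by (induction p) (auto simp: fc.ev_pCons r.hom_add r.hom_mult s)
    have "rfl z * fc.ev s Q = z * fc.ev s Q"
    proof -
      have "rfl z * fc.ev s Q = rfl (z * fc.ev s Q)" by (simp only: r.hom_mult ev)
      also have "\<dots> = z * fc.ev s Q" unfolding z(3) by (rule ev)
      finally show ?thesis .
    qed
    then have "rfl z = z" using fc.transcendental[OF P0.s, of Q] z(2) by simp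
    then show ?thesis by (simp add: h_def z(1))
  qed
  ultimately obtain \<phi> where "\<phi> \<in> GG" "\<And>x. x \<in> carrier M \<Longrightarrow> \<psi> (\<phi> x) = h x" using GG_memI by metis
  then show ?thesis by (intro AI) (auto simp: h_def)
qed

lemma swap: "R.swappable (iota w) (iota (fps_compose w (- fps_X)))"
  unfolding R.swappable_def
proof (intro bexI[OF _ reflection_in_A] ballI)
  fix x assume "x \<in> Rts"
  then obtain f where f: "f \<in> R0" "x = iota f" by (auto simp: Rts_def)
  have 1: "to_ac (rfl (of_ac x)) = iota (fps_compose f (- fps_X))"
    by (simp add: f(2) iota_def)
  have ww: "fps_compose (fps_compose w (- fps_X)) (- fps_X) = w"
    by (rule fps_ext) (simp add: fps_compose_uminus' flip: mult.assoc power_add mult_2)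
  consider "f = w" | "f = fps_compose w (- fps_X)" | "f \<in> R0 - {w, fps_compose w (- fps_X)}" using f(1) by blast
  then show "to_ac (rfl (of_ac x)) = Transposition.transpose (iota w) (iota (fps_compose w (- fps_X))) x"
  proof cases
    case 1
    then show ?thesis using \<open>to_ac (rfl (of_ac x)) = _\<close> f(2) by simp
  next
    case 2
    then show ?thesis using \<open>to_ac (rfl (of_ac x)) = _\<close> f(2) ww by simp
  next
    case 3
    then have "x \<noteq> iota w" "x \<noteq> iota (fps_compose w (- fps_X))" using f(2) inj_iota by (auto dest: injD)
    then show ?thesis using \<open>to_ac (rfl (of_ac x)) = _\<close> w(4)[OF 3] f(2) by simp
  qed
qed

text \<open>Passage from the embedding at P0 to the one at P1, on the image of the function field.
  Both have the same kernel, so the choice of h is immaterial. The order of \<nu> z is the order of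
  z at the point at infinity.\<close>

definition \<nu> :: "'a fls alg_closure \<Rightarrow> 'a fls" where
  "\<nu> z = P1.\<Theta> (SOME h. to_ac (P0.\<Theta> h) = z)"

lemma \<nu>: "\<nu> (to_ac (P0.\<Theta> h)) = P1.\<Theta> h"
proof -
  have "to_ac (P0.\<Theta> (SOME k. to_ac (P0.\<Theta> k) = to_ac (P0.\<Theta> h))) = to_ac (P0.\<Theta> h)" by (rule someI) simp
  then show ?thesis unfolding \<nu>_def by (simp add: P0.\<Theta>_eq_iff P1.\<Theta>_eq_iff)
qed

lemma generated_\<Theta>:
  assumes "z \<in> R.generated"
  obtains h where "z = to_ac (P0.\<Theta> h)"
proof -
  obtain P where P: "poly_over F0 P" "z = poly P \<xi>" using assms by (auto simp: R.generated_def)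
  have "\<exists>h. poly P \<xi> = to_ac (P0.\<Theta> h)" using P(1)
  proof (induction P)
    case 0
    show ?case by (rule exI[of _ 0]) (simp add: P0.T.hom_0)
  next
    case (pCons a P)
    then obtain h k where "poly P \<xi> = to_ac (P0.\<Theta> h)" "a = to_ac (P0.\<Theta> k)" using F0_\<Theta> by auto
    then have "poly (pCons a P) \<xi> = to_ac (P0.\<Theta> (k + P0.xv * h))"
      by (simp only: poly_pCons P0.T.hom_add P0.T.hom_mult P0.\<Theta>_xv \<xi>_def to_ac_add to_ac_mult)
    then show ?case by blast
  qed
  then show thesis using that P(2) by blast
qed

lemma r3: "3 \<le> r"
  using r(1,2) prime_ge_2_nat[OF r(1)] by (cases "r = 2") auto

lemma one_class: "R.cls \<xi> = Rts"
proof (rule R.large_class[of "iota w" "iota (fps_compose w (- fps_X))" r \<nu>])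
  show "iota w \<in> Rts" "iota (fps_compose w (- fps_X)) \<in> Rts" using w(1,2) by (auto simp: Rts_def)
  show "iota w \<noteq> iota (fps_compose w (- fps_X))" using w(3) inj_iota by (auto dest: injD)
  show "R.swappable (iota w) (iota (fps_compose w (- fps_X)))" by (rule swap)
  show "Factorial_Ring.prime r" "n + d < 2 * r" by (rule r)+
  show "\<nu> (x + y) = \<nu> x + \<nu> y" "\<nu> (x * y) = \<nu> x * \<nu> y" if "x \<in> R.generated" "y \<in> R.generated" for x y
  proof -
    obtain h k where hk: "x = to_ac (P0.\<Theta> h)" "y = to_ac (P0.\<Theta> k)"
      using generated_\<Theta>[OF \<open>x \<in> R.generated\<close>] generated_\<Theta>[OF \<open>y \<in> R.generated\<close>] by metis
    show "\<nu> (x + y) = \<nu> x + \<nu> y"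
      using \<nu>[of "h + k"] by (simp add: hk P0.T.hom_add P1.T.hom_add \<nu>)
    show "\<nu> (x * y) = \<nu> x * \<nu> y"
      using \<nu>[of "h * k"] by (simp add: hk P0.T.hom_mult P1.T.hom_mult \<nu>)
  qed
  show "\<nu> x = 0 \<longleftrightarrow> x = 0" if x: "x \<in> R.generated" for x
    using generated_\<Theta>[OF x] by (metis P0.\<Theta>_eq_0_iff P1.\<Theta>_eq_0_iff \<nu> to_ac_eq_0_iff)
  \<comment> \<open>For a nonzero c = P(s) / Q(s) the order at infinity is r (deg Q - deg
    P).\<close>
  show "int r dvd fls_subdegree (\<nu> c)" if "c \<in> F0" for c
  proof -
    obtain h where h: "P0.cl h \<in> P0.F" "c = to_ac (P0.\<Theta> h)" using \<open>c \<in> F0\<close> F0_\<Theta> by blast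
    obtain k where k: "P0.cl h = P0.cl k" "P1.rational_in_s (P1.\<Theta> k)" using P1.F_rational[OF h(1)] by blast
    have "\<nu> c = P1.\<Theta> k" using h(2) k(1) \<nu> P1.\<Theta>_eq_iff by metis
    moreover obtain P Q where PQ: "Q \<noteq> 0" "P1.\<Theta> k * fc.ev s1 Q = fc.ev s1 P"
      using k(2) unfolding P1.rational_in_s_def by blast
    ultimately have e: "\<nu> c * fc.ev s1 Q = fc.ev s1 P" by simp
    show ?thesis
    proof (cases "\<nu> c = 0")
      case False
      have Q0: "fc.ev s1 Q \<noteq> 0" using fc.transcendental[OF P1.s] PQ(1) by simp
      then have "fc.ev s1 P \<noteq> 0" using e False by (metis mult_eq_0_iff)
      then have "P \<noteq> 0" by auto
      have r0: "r \<noteq> 0" using r3 by simp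
      have "fls_subdegree (\<nu> c) + fls_subdegree (fc.ev s1 Q) = fls_subdegree (fc.ev s1 P)"
        using False Q0 e by (metis fls_subdegree_mult)
      then have "fls_subdegree (\<nu> c) = int r * (int (Polynomial.degree Q) - int (Polynomial.degree P))"
        unfolding s1 fls_subdegree_ev_X_inv[OF r0 PQ(1)] fls_subdegree_ev_X_inv[OF r0 \<open>P \<noteq> 0\<close>]
        by (simp add: algebra_simps)
      then show ?thesis by simp
    qed simp
  qed
  have "\<nu> \<xi> = U1" using \<nu>[of P0.xv] by (simp add: P0.\<Theta>_xv P1.\<Theta>_xv \<xi>_def)
  \<comment> \<open>The pole order 2 of x is not divisible by the odd prime r.\<close>
  moreover have "\<not> int r dvd - 2"
    using r3 zdvd_imp_le[of "int r" 2] by auto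
  ultimately show "\<not> int r dvd fls_subdegree (\<nu> \<xi>)" using U1 by simp
qed

text \<open>Automorphisms act on the n + d roots, numbered by e. The action is faithful because the
  roots generate N over F0, and onto because all roots form one class under transpositions.\<close>

theorem galois_group_iso: "galois_group M F' \<cong> sym_group (n + d)"
proof -
  obtain e where e: "bij_betw e {1..n + d} Rts"
    using card_Rts by (metis card_atLeastAtMost diff_Suc_1 finite_atLeastAtMost finite_same_card_bij)
  define e' where "e' = inv_into {1..n + d} e"
  have e': "e' (e i) = i" "e i \<in> Rts" if "i \<in> {1..n + d}" for i
    using e that by (auto simp: e'_def bij_betw_def inv_into_f_f)
  have e'2: "e (e' x) = x" "e' x \<in> {1..n + d}" if "x \<in> Rts" for x
    using e that f_inv_into_f[of x e "{1..n + d}"] inv_into_into[of x e "{1..n + d}"]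
    unfolding e'_def bij_betw_def by auto
  define p where "p = inv_into (carrier M) \<psi>"
  have p: "p (\<psi> x) = x" if "x \<in> carrier M" for x
    unfolding p_def using \<psi>_field(4) that by (rule inv_into_f_f)
  have p2: "\<psi> (p z) = z" "p z \<in> carrier M" if "z \<in> N" for z
    using that p unfolding N_def by auto
  define act where "act \<phi> z = \<psi> (\<phi> (p z))" for \<phi> z
  have actA: "act \<phi> \<in> A" if "\<phi> \<in> GG" for \<phi>
    using that p by (intro AI[of \<phi>]) (auto simp: act_def)
  have act_R: "act \<phi> z \<in> Rts" if "\<phi> \<in> GG" "z \<in> Rts" for \<phi> z
    using R.stable[OF actA[OF that(1)]] that(2) by blast
  define T where "T \<phi> i = (if i \<in> {1..n + d} then e' (act \<phi> (e i)) else i)" for \<phi> i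
  have T_perm: "T \<phi> permutes {1..n + d}" if \<phi>: "\<phi> \<in> GG" for \<phi>
  proof (rule bij_imp_permutes)
    have "inj_on (T \<phi>) {1..n + d}"
    proof (rule inj_onI)
      fix i j assume ij: "i \<in> {1..n + d}" "j \<in> {1..n + d}" "T \<phi> i = T \<phi> j"
      then have "act \<phi> (e i) = act \<phi> (e j)" using e'2(1) act_R[OF \<phi>] e'(2) unfolding T_def by metis
      then have "e i = e j" using R.A_inj_R[OF actA[OF \<phi>]] e'(2) ij(1,2) by (auto dest: inj_onD)
      then show "i = j" using e'(1) ij by metis
    qed
    moreover have "T \<phi> ` {1..n + d} \<subseteq> {1..n + d}"
      using e'2(2) act_R[OF \<phi>] e'(2) by (auto simp: T_def)
    ultimately show "bij_betw (T \<phi>) {1..n + d} {1..n + d}"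
      unfolding bij_betw_def by (simp add: endo_inj_surj)
  qed (auto simp: T_def)
  let ?G = "galois_group M F'"
  have car: "carrier ?G = GG" by (simp add: GG_def)
  have Bij: "\<phi> \<in> Bij (carrier M)" if "\<phi> \<in> GG" for \<phi>
    using that unfolding GG_def galois_group_def by simp
  have mult: "\<phi>1 \<otimes>\<^bsub>?G\<^esub> \<phi>2 = compose (carrier M) \<phi>1 \<phi>2" if "\<phi>1 \<in> GG" "\<phi>2 \<in> GG" for \<phi>1 \<phi>2
    using Bij[OF that(1)] Bij[OF that(2)] by (simp add: galois_group_def BijGroup_def)
  have "T \<in> hom ?G (sym_group (n + d))"
  proof (rule homI)
    show "T \<phi> \<in> carrier (sym_group (n + d))" if "\<phi> \<in> carrier ?G" for \<phi>
      using T_perm that by (simp add: car sym_group_def)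
    fix \<phi>1 \<phi>2 assume "\<phi>1 \<in> carrier ?G" "\<phi>2 \<in> carrier ?G"
    then have \<phi>: "\<phi>1 \<in> GG" "\<phi>2 \<in> GG" by (simp_all add: car)
    have "T (\<phi>1 \<otimes>\<^bsub>?G\<^esub> \<phi>2) i = T \<phi>1 (T \<phi>2 i)" for i
    proof (cases "i \<in> {1..n + d}")
      case True
      define z where "z = e i"
      have z: "z \<in> Rts" "z \<in> N" "act \<phi>2 z \<in> Rts" using e'(2)[OF True] Rts_N act_R[OF \<phi>(2)] by (auto simp: z_def)
      have "act (\<phi>1 \<otimes>\<^bsub>?G\<^esub> \<phi>2) z = act \<phi>1 (act \<phi>2 z)"
        using p2(2)[OF z(2)] p GG_closed[OF \<phi>(2)] by (simp add: act_def mult[OF \<phi>] compose_def)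
      then show ?thesis
        using True z e'2[OF z(3)] by (simp add: T_def flip: z_def)
    qed (auto simp: T_def)
    then show "T (\<phi>1 \<otimes>\<^bsub>?G\<^esub> \<phi>2) = T \<phi>1 \<otimes>\<^bsub>sym_group (n + d)\<^esub> T \<phi>2"
      by (auto simp: sym_group_def)
  qed
  moreover have "inj_on T GG"
  proof (rule inj_onI)
    fix \<phi>1 \<phi>2 assume \<phi>: "\<phi>1 \<in> GG" "\<phi>2 \<in> GG" "T \<phi>1 = T \<phi>2"
    have eqR: "act \<phi>1 z = act \<phi>2 z" if z: "z \<in> Rts" for z
    proof -
      have "T \<phi>1 (e' z) = T \<phi>2 (e' z)" using \<phi>(3) by simp
      then have "e' (act \<phi>1 z) = e' (act \<phi>2 z)" using e'2[OF z] by (simp add: T_def)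
      then show ?thesis using e'2(1) act_R[OF \<phi>(1) z] act_R[OF \<phi>(2) z] by metis
    qed
    note A1 = actA[OF \<phi>(1)] and A2 = actA[OF \<phi>(2)]
    have "gen \<subseteq> {z \<in> N. act \<phi>1 z = act \<phi>2 z}"
    proof (rule genD)
      show "subfld {z \<in> N. act \<phi>1 z = act \<phi>2 z}"
        unfolding subfld_def
        by (auto simp: N.A_1[OF A1] N.A_add[OF A1] N.A_mult[OF A1] N.A_uminus[OF A1] N.A_inverse[OF A1]
            N.A_1[OF A2] N.A_add[OF A2] N.A_mult[OF A2] N.A_uminus[OF A2] N.A_inverse[OF A2] N.N_closed)
      show "F0 \<subseteq> {z \<in> N. act \<phi>1 z = act \<phi>2 z}" using N.F0N N.A_fix[OF A1] N.A_fix[OF A2] by auto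
      show "Rts \<subseteq> {z \<in> N. act \<phi>1 z = act \<phi>2 z}" using Rts_N eqR by auto
    qed
    then have eqN: "act \<phi>1 z = act \<phi>2 z" if "z \<in> N" for z using N_gen that by blast
    have "\<phi>1 x = \<phi>2 x" if x: "x \<in> carrier M" for x
    proof -
      have "\<psi> (\<phi>1 x) = \<psi> (\<phi>2 x)" using eqN[of "\<psi> x"] x p[OF x] by (simp add: act_def N_def)
      then show ?thesis using \<psi>_field(4) GG_closed[OF \<phi>(1) x] GG_closed[OF \<phi>(2) x] by (auto dest: inj_onD)
    qed
    then show "\<phi>1 = \<phi>2"
      using M.galois_groupD(3) \<phi>(1,2) unfolding GG_def by (blast intro: extensionalityI)
  qed
  moreover have "T ` GG = carrier (sym_group (n + d))"
  proof
    show "T ` GG \<subseteq> carrier (sym_group (n + d))" using T_perm by (auto simp: sym_group_def)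
    show "carrier (sym_group (n + d)) \<subseteq> T ` GG"
    proof
      fix \<pi> assume "\<pi> \<in> carrier (sym_group (n + d))"
      then have \<pi>: "\<pi> permutes {1..n + d}" by (simp add: sym_group_def)
      define \<pi>' where "\<pi>' z = (if z \<in> Rts then e (\<pi> (e' z)) else z)" for z
      have in1: "\<pi> i \<in> {1..n + d}" if "i \<in> {1..n + d}" for i using permutes_in_image[OF \<pi>] that by blast
      have "\<pi>' permutes Rts"
      proof (rule bij_imp_permutes)
        have "inj_on \<pi>' Rts"
        proof (rule inj_onI)
          fix y z assume yz: "y \<in> Rts" "z \<in> Rts" "\<pi>' y = \<pi>' z"
          then have "e (\<pi> (e' y)) = e (\<pi> (e' z))" by (simp add: \<pi>'_def)
          then have "\<pi> (e' y) = \<pi> (e' z)" using e'(1) in1 e'2(2) yz(1,2) by metis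
          then have "e' y = e' z" using permutes_inj[OF \<pi>] by (auto dest: injD)
          then show "y = z" using e'2(1) yz by metis
        qed
        moreover have "\<pi>' ` Rts \<subseteq> Rts" using e'(2) in1 e'2(2) by (auto simp: \<pi>'_def)
        ultimately show "bij_betw \<pi>' Rts Rts"
          unfolding bij_betw_def using card_Rts(2) by (simp add: endo_inj_surj)
      qed (auto simp: \<pi>'_def)
      from R.all_permutations[OF one_class this] obtain h where h: "h \<in> A" "\<forall>x\<in>Rts. h x = \<pi>' x" by blast
      then obtain \<phi> where \<phi>: "\<phi> \<in> GG" "\<forall>x\<in>carrier M. h (\<psi> x) = \<psi> (\<phi> x)" unfolding A_def by blast
      have "T \<phi> i = \<pi> i" for i
      proof (cases "i \<in> {1..n + d}")
        case True
        define z where "z = e i"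
        have z: "z \<in> Rts" "z \<in> N" using e'(2)[OF True] Rts_N by (auto simp: z_def)
        have "act \<phi> z = h z" using \<phi>(2) p2[OF z(2)] unfolding act_def by metis
        also have "\<dots> = e (\<pi> i)" using h(2) z(1) e'(1)[OF True] by (simp add: \<pi>'_def z_def)
        finally show ?thesis using True e'(1)[OF in1[OF True]] by (simp add: T_def flip: z_def)
      next
        case False
        have "T \<phi> i = i" unfolding T_def by (rule if_not_P[OF False])
        then show ?thesis by (simp only: permutes_not_in[OF \<pi> False])
      qed
      then show "\<pi> \<in> T ` GG" using \<phi>(1) by (metis ext imageI)
    qed
  qed
  ultimately have "T \<in> iso ?G (sym_group (n + d))"
    unfolding iso_def bij_betw_def car by simp
  then show ?thesis by (auto simp: is_iso_def)
qed

end

instance alg_closure :: (field) field_gcd ..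

section \<open>Finite fields\<close>

lemma CHAR_eq_of_card:
  assumes "Factorial_Ring.prime p" "CARD('k::{field,finite}) = p ^ e"
  shows "CHAR('k) = p"
proof -
  have "CHAR('k) > 0" by (rule finite_imp_CHAR_pos) simp
  then have pr: "Factorial_Ring.prime CHAR('k)" by (rule prime_CHAR_semidom)
  have "CHAR('k) dvd p ^ e" using CHAR_dvd_CARD[where 'a = 'k] assms(2) by simp
  then have "CHAR('k) dvd p" using pr by (rule prime_dvd_power[rotated])
  then show ?thesis using primes_dvd_imp_eq[OF pr assms(1)] by simp
qed

text \<open>The Frobenius map is injective, hence surjective on a finite field.\<close>

lemma ex_CHAR_root:
  fixes c :: "'k::{field,finite}"
  shows "\<exists>x. x ^ CHAR('k) = c"
proof -
  have pr: "Factorial_Ring.prime CHAR('k)"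
    by (intro prime_CHAR_semidom finite_imp_CHAR_pos) simp
  have "inj (\<lambda>x :: 'k. x ^ CHAR('k))"
  proof (rule injI)
    fix x y :: 'k assume xy: "x ^ CHAR('k) = y ^ CHAR('k)"
    have "(x - y + y) ^ CHAR('k) = (x - y) ^ CHAR('k) + y ^ CHAR('k)"
      by (rule freshmans_dream[OF pr]) simp
    then have "(x - y) ^ CHAR('k) = 0" using xy by simp
    then show "x = y" by simp
  qed
  then have "surj (\<lambda>x :: 'k. x ^ CHAR('k))" by (intro finite_UNIV_inj_surj) simp_all
  then show ?thesis by (metis surjD)
qed

text \<open>Finite fields are perfect: a polynomial with zero derivative is a \<open>p\<close>-th power.\<close>

lemma squarefree_simple_root:
  fixes g :: "'k::{field,finite} poly"
  assumes g: "squarefree g" and z: "poly (map_poly to_ac g) z = 0"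
  shows "poly (pderiv (map_poly to_ac g)) z \<noteq> 0"
proof
  interpret ac: type_field_hom "to_ac :: 'k \<Rightarrow> 'k alg_closure" by unfold_locales auto
  assume "poly (pderiv (map_poly to_ac g)) z = 0"
  then have dz: "ac.ev z (pderiv g) = 0"
    by (simp add: ac.ev_def map_poly_hom_pderiv[OF ac.type_ring_hom_axioms])
  have gz: "ac.ev z g = 0" using z by (simp add: ac.ev_def)
  have "\<not> squarefree (0 :: 'k poly)" unfolding squarefree_def
    by (auto intro!: exI[of _ "[:0, 1:]"] simp: is_unit_poly_iff)
  then have g0: "g \<noteq> 0" using g by auto
  \<comment> \<open>q plays the part of the minimal polynomial of z: having least degree, it divides
    every polynomial that vanishes at z.\<close>
  obtain q where q: "q \<noteq> 0" "ac.ev z q = 0"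
    and min: "\<And>p. p \<noteq> 0 \<Longrightarrow> ac.ev z p = 0 \<Longrightarrow> Polynomial.degree q \<le> Polynomial.degree p"
    using ex_has_least_nat[of "\<lambda>p. p \<noteq> 0 \<and> ac.ev z p = 0" g Polynomial.degree] g0 gz by blast
  have dvd: "q dvd p" if "ac.ev z p = 0" for p
  proof -
    have "p = p div q * q + p mod q" by (rule div_mult_mod_eq[symmetric])
    then have "ac.ev z (p mod q) = 0" using that q(2) by (metis ac.ev_add ac.ev_mult add_0 mult_zero_right)
    then have "p mod q = 0" using min[of "p mod q"] degree_mod_less[OF q(1), of p] by (meson not_le)
    then show ?thesis by (simp add: mod_eq_0_iff_dvd)
  qed
  have degq: "Polynomial.degree q \<noteq> 0"
  proof
    assume "Polynomial.degree q = 0"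
    then obtain c where "q = [:c:]" by (auto elim: degree_eq_zeroE)
    then show False using q by (simp add: ac.ev_pCons)
  qed
  obtain c where c: "g = q * c" using dvd[OF gz] by (auto elim: dvdE)
  \<comment> \<open>As g is squarefree, q divides it only once. A double root z of g must then be a
    root of q', and by least degree q' = 0.\<close>
  have "ac.ev z c \<noteq> 0"
  proof
    assume "ac.ev z c = 0"
    then obtain b where "c = q * b" using dvd by (auto elim: dvdE)
    then have "q ^ 2 dvd g" by (simp add: c power2_eq_square)
    then have "q dvd 1" using g by (simp add: squarefree_def)
    then show False using degq by (simp add: is_unit_iff_degree q(1))
  qed
  moreover have "ac.ev z (pderiv q) * ac.ev z c = 0"
    using dz q(2) unfolding c pderiv_mult ac.ev_add ac.ev_mult by (simp add: mult.commute)
  ultimately have "ac.ev z (pderiv q) = 0" by simp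
  moreover have "Polynomial.degree (pderiv q) < Polynomial.degree q"
    using degq by (intro le_less_trans[OF degree_le[of "Polynomial.degree q - 1"]])
      (auto simp: coeff_pderiv coeff_eq_0)
  ultimately have pd: "pderiv q = 0" using min[of "pderiv q"] by auto
  define p where "p = CHAR('k)"
  have pr: "Factorial_Ring.prime p"
    unfolding p_def by (intro prime_CHAR_semidom finite_imp_CHAR_pos) simp
  then have p0: "p > 1" by (rule prime_gt_1_nat)
  have zero: "Polynomial.coeff q i = 0" if "\<not> p dvd i" for i
  proof (cases i)
    case (Suc j)
    then have "of_nat i * Polynomial.coeff q i = 0"
      using arg_cong[OF pd, of "\<lambda>u. Polynomial.coeff u j"] by (simp add: coeff_pderiv)
    moreover have "of_nat i \<noteq> (0 :: 'k)" using that by (simp add: of_nat_eq_0_iff_char_dvd p_def)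
    ultimately show ?thesis by simp
  qed (use that in simp)
  obtain rt :: "'k \<Rightarrow> 'k" where rt: "\<And>c. rt c ^ p = c" using ex_CHAR_root unfolding p_def by metis
  define D where "D = Polynomial.degree q div p"
  \<comment> \<open>A p-th root of q: only exponents divisible by p occur in q, and every
    coefficient has a p-th root. It would vanish at z together with q, in smaller degree.\<close>
  define u where "u = (\<Sum>j\<le>D. Polynomial.monom (rt (Polynomial.coeff q (p * j))) j)"
  have "p dvd Polynomial.degree q" using zero q(1) by (metis leading_coeff_neq_0)
  then have pD: "p * D = Polynomial.degree q" by (simp add: D_def)
  have cu: "Polynomial.coeff u D = rt (lead_coeff q)"
    unfolding u_def by (simp add: coeff_sum pD)
  have "rt (lead_coeff q) \<noteq> 0" using rt[of "lead_coeff q"] q(1) p0 by (auto simp: power_0_left)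
  then have u0: "u \<noteq> 0" using cu by auto
  have "Polynomial.degree u \<le> D"
    unfolding u_def by (intro degree_sum_le) (auto intro: order_trans[OF degree_monom_le])
  also have "D < Polynomial.degree q" unfolding D_def using degq p0 by simp
  finally have "ac.ev z u \<noteq> 0" using min[OF u0] by auto
  moreover have "ac.ev z u ^ p = ac.ev z q"
  proof -
    have "ac.ev z u = (\<Sum>j\<le>D. to_ac (rt (Polynomial.coeff q (p * j))) * z ^ j)"
      unfolding u_def type_ring_hom.hom_sum[OF ac.ev_hom] by (simp add: ac.ev_monom)
    then have "ac.ev z u ^ p = (\<Sum>j\<le>D. (to_ac (rt (Polynomial.coeff q (p * j))) * z ^ j) ^ p)"
      using pr by (simp add: freshmans_dream_sum p_def)
    also have "\<dots> = (\<Sum>j\<le>D. to_ac (Polynomial.coeff q (p * j)) * z ^ (p * j))"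
      by (simp add: power_mult_distrib rt mult.commute flip: to_ac_power power_mult)
    also have "\<dots> = (\<Sum>i\<in>(\<lambda>j. p * j) ` {..D}. to_ac (Polynomial.coeff q i) * z ^ i)"
      using p0 by (subst sum.reindex) (auto simp: inj_on_def)
    also have "\<dots> = (\<Sum>i\<le>Polynomial.degree q. to_ac (Polynomial.coeff q i) * z ^ i)"
    proof (rule sum.mono_neutral_left)
      show "(\<lambda>j. p * j) ` {..D} \<subseteq> {..Polynomial.degree q}" unfolding pD[symmetric] by auto
      show "\<forall>i\<in>{..Polynomial.degree q} - (\<lambda>j. p * j) ` {..D}. to_ac (Polynomial.coeff q i) * z ^ i = 0"
      proof
        fix i assume i: "i \<in> {..Polynomial.degree q} - (\<lambda>j. p * j) ` {..D}"
        have "\<not> p dvd i"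
        proof
          assume "p dvd i"
          then obtain j where "i = p * j" by blast
          then show False using i p0 unfolding pD[symmetric] by auto
        qed
        then show "to_ac (Polynomial.coeff q i) * z ^ i = 0" using zero by simp
      qed
    qed simp
    also have "\<dots> = ac.ev z q"
      unfolding ac.ev_def poly_altdef by (simp add: degree_map_poly coeff_map_poly)
    finally show ?thesis .
  qed
  ultimately show False using q(2) by simp
qed

section \<open>The theorem\<close>

theorem (in pencil) galois_group_symmetric:
  fixes M :: "'m ring"
  assumes nin: "affine_point \<alpha> \<beta> \<notin> \<Union> (special_tangents (curve_poly n G) (n + d))"
    and r: "Factorial_Ring.prime r" "d = r + 2" "n + d < 2 * r"
    and closure: "galois_closure (function_field (curve_poly n G)) (projection_subfield (curve_poly n G) \<alpha> \<beta>) M \<sigma>"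
  shows "galois_group M (\<sigma> ` projection_subfield (curve_poly n G) \<alpha> \<beta>) \<cong> sym_group (n + d)"
proof -
  interpret C: curve_shape n G d
    by unfold_locales (use degG n d3 G0 in auto)
  obtain x0 y0 where x0: "x0 \<noteq> \<alpha>" "y0 \<noteq> 0" "x0 \<noteq> 0" "x0 ^ n * y0 ^ 2 = poly G x0"
    "poly (pderiv (Hs ((y0 - \<beta>) / (x0 - \<alpha>)))) x0 = 0" by (rule branch_point)
  define t0 where "t0 = (y0 - \<beta>) / (x0 - \<alpha>)"
  have card: "n + d - 1 \<le> card {x. poly (Hs t0) x = 0}"
    by (rule C.tangent_through_point[OF x0(1,3,2) char_2 x0(4) t0_def _ nin]) (use x0(5) in \<open>simp add: t0_def\<close>)
  have t0': "poly (pderiv (Hs t0)) x0 = 0" using x0(5) by (simp add: t0_def)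
  define S :: "'a fps" where "S = fps_const t0 + fps_X ^ 2"
  obtain R0 :: "'a fps set" and w where R: "finite R0" "card R0 = n + d" "\<And>f. f \<in> R0 \<longleftrightarrow> on_pencil S f"
    "w \<in> R0" "refl w \<noteq> w" "\<And>f. f \<in> R0 - {w, refl w} \<Longrightarrow> refl f = f" "fps_nth w 1 \<noteq> 0"
    unfolding S_def by (rule branch_roots[OF x0(1-4) t0_def t0' card]) blast
  have reflS: "refl S = S"
    unfolding S_def by (rule fps_ext) (auto simp: refl_nth fps_X_power_nth)
  have refl_w: "refl w \<in> R0" using R(3,4) refl_on_pencil[OF _ reflS] by simp
  define U where "U = fps_to_fls w"
  define s where "s = fps_to_fls S"
  define V where "V = fls_const \<beta> + s * (U - fls_const \<alpha>)"
  have const_nth: "fps_nth f i = 0" if "fps_to_fls f \<in> range fls_const" "i \<noteq> 0" for f :: "'a fps" and i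
  proof -
    obtain c where "fps_to_fls f = fps_to_fls (fps_const c)" using \<open>fps_to_fls f \<in> range fls_const\<close> by auto
    then have "f = fps_const c" by (simp only: fps_to_fls_eq_iff)
    then show ?thesis using \<open>i \<noteq> 0\<close> by simp
  qed
  \<comment> \<open>Non-constancy is visible in single coefficients: w has a nonzero one at u, and S
    at u^2.\<close>
  have U_nc: "U \<notin> range fls_const" using const_nth[of w 1] R(7) by (auto simp: U_def)
  have s_nc: "s \<notin> range fls_const"
    using const_nth[of S 2] by (auto simp: s_def S_def fps_X_power_nth)
  have UV: "U ^ n * V ^ 2 = fc.ev U G"
  proof -
    have "on_pencil S w" using R(3,4) by blast
    then have "fps_to_fls (w ^ n * (fps_const \<beta> + S * (w - fps_const \<alpha>)) ^ 2) = fc.ev U G"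
      by (simp add: U_def flip: f2l_fpc_ev)
    then show ?thesis by (simp add: V_def U_def s_def f2l.hom_mult f2l.hom_power f2l.hom_add f2l.hom_diff)
  qed
  obtain U1 s1 :: "'a fls" where U1: "U1 ^ n * (fls_const \<beta> + s1 * (U1 - fls_const \<alpha>)) ^ 2 = fc.ev U1 G"
    "fls_subdegree U1 = - 2" "s1 = fls_X_inv ^ (d - 2)" by (rule point_at_infinity)
  define V1 where "V1 = fls_const \<beta> + s1 * (U1 - fls_const \<alpha>)"
  have subdeg_nc: "z \<notin> range fls_const" if "fls_subdegree z \<noteq> 0" for z :: "'a fls"
    using that by auto
  have U1_nc: "U1 \<notin> range fls_const" using U1(2) by (intro subdeg_nc) simp
  have s1_nc: "s1 \<notin> range fls_const" using U1(3) d3 by (intro subdeg_nc) (simp add: fls_subdegree_pow)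
  have P0: "projected_curve_point n G d U V \<alpha> \<beta> s"
    by unfold_locales (use UV U_nc s_nc n d3 G0 G\<alpha> V_def in auto)
  have P1: "projected_curve_point n G d U1 V1 \<alpha> \<beta> s1"
    by unfold_locales (use U1(1) U1_nc s1_nc n d3 G0 G\<alpha> V1_def in auto)
  have oddr: "odd r" using odd_d r(2) by simp
  interpret pencil_galois_closure n d G U V \<alpha> \<beta> s U1 V1 s1 R0 w S r M \<sigma>
  proof (rule pencil_galois_closure.intro[OF P0 P1], unfold_locales)
    show "s1 = fls_X_inv ^ r" using U1(3) r(2) by simp
  qed (use R refl_w reflS U_def s_def U1(2) r(1,3) oddr closure in auto)
  show ?thesis by (rule galois_group_iso)
qed

theorem theorem4p6:
  fixes p q m r e :: nat
    and g :: "'k::{field, finite} poly"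
    and f :: "'k alg_closure poly poly"
    and a b :: 'k
    and L :: "'k alg_closure poly fract poly set ring"
    and F :: "'k alg_closure poly fract poly set set"
    and \<Lambda> :: "('k alg_closure ^ 3) set set set"
    and \<Gamma> :: "('k alg_closure ^ 3) set set"
    and M :: "'m ring"
    and \<sigma> :: "'k alg_closure poly fract poly set \<Rightarrow> 'm"
  assumes "Factorial_Ring.prime p" and "odd p"
    and "e \<ge> 1" and "q = p ^ e" and "CARD('k) = q"
    and "m > 0" and "Factorial_Ring.prime r" and "real m / 2 < real r" and "r \<le> m - 2"
    and "\<not> p dvd r * (r + 2) * (m - r - 2)"
    and "squarefree g" and "Polynomial.degree g = m" and "poly g 0 \<noteq> 0"
    and "f = Polynomial.monom (Polynomial.monom 1 (m - r - 2)) 2 - [:map_poly to_ac g:]"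
    and "L = function_field f"
    and "\<Lambda> = special_tangents f m"
    and "\<Gamma> = \<Union> \<Lambda>"
    and "affine_point (to_ac a) (to_ac b) \<notin> proj_curve f \<union> \<Gamma>"
    and "F = projection_subfield f (to_ac a) (to_ac b)"
    and "galois_closure L F M \<sigma>"
  shows "galois_group M (\<sigma> ` F) \<cong> sym_group m"
proof -
  define n where "n = m - r - 2"
  define d where "d = r + 2"
  define G where "G = map_poly to_ac g"
  define \<alpha> \<beta> where "\<alpha> = to_ac a" and "\<beta> = to_ac b"
  have char: "of_nat k = (0 :: 'k alg_closure) \<longleftrightarrow> p dvd k" for k
    using CHAR_eq_of_card[OF assms(1), where 'k = 'k and e = e] assms(4,5)
    by (simp add: of_nat_eq_0_iff_char_dvd)
  \<comment> \<open>For n = 0 the product in the hypothesis would be 0 and divisible by p.\<close>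
  have n0: "n \<noteq> 0" and pn: "\<not> p dvd n" and pr: "\<not> p dvd r"
    using assms(10) by (auto simp: n_def)
  have m: "m = n + d" using n0 by (simp add: n_def d_def)
  have m2r: "m < 2 * r" using assms(8) by linarith
  \<comment> \<open>Since n is positive, m \<ge> r + 3, whereas r = 2 would give m < 4.\<close>
  have "r \<noteq> 2" using m2r n0 m by (simp add: d_def)
  then have oddr: "odd r" using assms(7) by (metis primes_dvd_imp_eq two_is_prime_nat)
  then have r3: "3 \<le> r" using prime_ge_2_nat[OF assms(7)] \<open>r \<noteq> 2\<close> by linarith
  have f: "f = curve_poly n G"
    using assms(14) by (simp add: curve_poly_def n_def G_def)
  have degG: "Polynomial.degree G = n + d"
    using assms(12) m by (simp add: G_def degree_map_poly)
  have G0: "poly G 0 \<noteq> 0"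
    using assms(13) by (simp add: G_def poly_0_coeff_0 coeff_map_poly)
  have p2: "\<not> p dvd 2"
    using assms(1,2) by (metis even_numeral primes_dvd_imp_eq two_is_prime_nat dvd_refl)
  interpret C: curve_shape n G d
    by unfold_locales (use degG n0 G0 in \<open>auto simp: d_def\<close>, use r3 in simp)
  have G\<alpha>: "\<alpha> ^ n * \<beta> ^ 2 \<noteq> poly G \<alpha>"
    using assms(18) C.affine_point_in_curve[of \<alpha> \<beta>] by (simp add: f \<alpha>_def \<beta>_def)
  have nin: "affine_point \<alpha> \<beta> \<notin> \<Union> (special_tangents (curve_poly n G) (n + d))"
    using assms(16-18) m by (simp add: f \<alpha>_def \<beta>_def)
  \<comment> \<open>For \<alpha> = 0 the point would lie on x = 0, which is a special
    tangent.\<close>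
  have \<alpha>0: "\<alpha> \<noteq> 0" using nin C.y_axis_special[of \<beta>] by auto
  interpret pencil n G d \<alpha> \<beta>
  proof unfold_locales
    show "of_nat n \<noteq> (0 :: 'k alg_closure)" using pn char by simp
    show "(2 :: 'k alg_closure) \<noteq> 0" using p2 char[of 2] by simp
    show "of_nat (d - 2) \<noteq> (0 :: 'k alg_closure)" using pr char by (simp add: d_def)
    show "poly (pderiv G) z \<noteq> 0" if "poly G z = 0" for z
      using squarefree_simple_root[OF assms(11)] that by (simp add: G_def)
  qed (use degG n0 G0 G\<alpha> \<alpha>0 oddr r3 in \<open>auto simp: d_def\<close>)
  have "galois_group M (\<sigma> ` projection_subfield (curve_poly n G) \<alpha> \<beta>) \<cong> sym_group (n + d)"
    using assms(15,19,20) m2r m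
    by (intro galois_group_symmetric[OF nin assms(7) d_def]) (simp_all add: f \<alpha>_def \<beta>_def)
  then show ?thesis by (simp add: assms(19) f m \<alpha>_def \<beta>_def)
qed

end
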